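(* For every integer $r\ge 2$, let $\mathbb{F}_r$ be the (discrete) free group with $r$ generators. The Fourier algebra $A(\mathbb{F}_r)$ is extremely non-Arens regular but not strongly Arens irregular.
   Context: $A(G)$ is the Fourier algebra of $G$ (Eymard), with pointwise multiplication. For a Banach algebra $\mathscr{A}$, $f\in\mathscr{A}^*$, $\varphi,\psi\in\mathscr{A}$, $\mu,\nu\in\mathscr{A}^{**}$: $\langle f\varphi,\psi\rangle=\langle f,\varphi\psi\rangle$, $\langle\nu f,\varphi\rangle=\langle\nu,f\varphi\rangle$, and the first Arens product is $\langle\mu\nu,f\rangle=\langle\mu,\nu f\rangle$; symmetrically $\langle\varphi.f,\psi\rangle=\langle f,\psi\varphi\rangle$, $\langle f.\mu,\varphi\rangle=\langle\mu,\varphi.f\rangle$, and the second Arens product is $\langle\mu.\nu,f\rangle=\langle\nu,f.\mu\rangle$. $\mathscr{WAP}(\mathscr{A})$ is the closed subspace of all $f\in\mathscr{A}^*$ such that $\{f\varphi:\|\varphi\|\le 1\}$ is relatively weakly compact in $\mathscr{A}^*$. $\mathscr{A}$ is extremely non-Arens regular (enAr) if $\mathscr{A}^*/\mathscr{WAP}(\mathscr{A})$ contains a closed subspace that admits a surjective bounded linear map onto $\mathscr{A}^*$. $\mathscr{A}$ is strongly Arens irregular (sAir, in the sense of Dales and Lau) if separate $\sigma(\mathscr{A}^{**},\mathscr{A}^* )$-continuity of the products happens only at elements of $\mathscr{A}$, i.e. the only $\mu\in\mathscr{A}^{**}$ for which $\nu\mapsto\mu\nu$ is $\sigma(\mathscr{A}^{**},\mathscr{A}^*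 )$-continuous on $\mathscr{A}^{**}$ are those in $\mathscr{A}$, and the only $\mu\in\mathscr{A}^{**}$ for which $\nu\mapsto\nu.\mu$ is $\sigma(\mathscr{A}^{**},\mathscr{A}^* )$-continuous are those in $\mathscr{A}$. *)

theory Defs
  imports "HOL-Analysis.Analysis" "HOL-Algebra.Group"
begin

text \<open>
  The type classes of the library only provide real scalars, and the spaces below depend on a
  natural number; hence the explicit carriers. No axioms are built into the records.
\<close>

record 'a cnspace = "'a partial_object" +
  vadd :: "'a \<Rightarrow> 'a \<Rightarrow> 'a"
  vscale :: "complex \<Rightarrow> 'a \<Rightarrow> 'a"
  vnorm :: "'a \<Rightarrow> real"

record 'a cnalgebra = "'a cnspace" +
  amult :: "'a \<Rightarrow> 'a \<Rightarrow> 'a"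

definition bounded_clinear_map ::
  "('a, 'm) cnspace_scheme \<Rightarrow> ('b, 'n) cnspace_scheme \<Rightarrow> ('a \<Rightarrow> 'b) \<Rightarrow> bool" where
  "bounded_clinear_map X Y T \<longleftrightarrow>
     T \<in> carrier X \<rightarrow> carrier Y \<and>
     (\<forall>x\<in>carrier X. \<forall>y\<in>carrier X. T (vadd X x y) = vadd Y (T x) (T y)) \<and>
     (\<forall>c. \<forall>x\<in>carrier X. T (vscale X c x) = vscale Y c (T x)) \<and>
     (\<exists>C. \<forall>x\<in>carrier X. vnorm Y (T x) \<le> C * vnorm X x)"

definition closed_csubspace :: "('a, 'm) cnspace_scheme \<Rightarrow> 'a set \<Rightarrow> bool" where
  "closed_csubspace X S \<longleftrightarrow>
     S \<subseteq> carrier X \<and> S \<noteq> {} \<and>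
     (\<forall>x\<in>S. \<forall>y\<in>S. vadd X x y \<in> S) \<and>
     (\<forall>c. \<forall>x\<in>S. vscale X c x \<in> S) \<and>
     (\<forall>x\<in>carrier X. (\<forall>e>0. \<exists>s\<in>S. vnorm X (vadd X x (vscale X (-1) s)) < e) \<longrightarrow> x \<in> S)"

definition complex_space :: "complex cnspace" where
  "complex_space = \<lparr>carrier = UNIV, vadd = (+), vscale = (*), vnorm = cmod\<rparr>"

text \<open>
  Functionals vanish outside the carrier, so that equality of functionals is equality of
  functions and the pointwise operations need no restriction.
\<close>

definition dual :: "('a, 'm) cnspace_scheme \<Rightarrow> ('a \<Rightarrow> complex) cnspace" where
  "dual X =
     \<lparr>carrier = {f. bounded_clinear_map X complex_space f \<and> (\<forall>x. x \<notin> carrier X \<longrightarrow> f x = 0)},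
      vadd = (\<lambda>f g x. f x + g x),
      vscale = (\<lambda>c f x. c * f x),
      vnorm = (\<lambda>f. SUP x\<in>{x\<in>carrier X. vnorm X x \<le> 1}. cmod (f x))\<rparr>"

definition vcoset :: "('a, 'm) cnspace_scheme \<Rightarrow> 'a set \<Rightarrow> 'a \<Rightarrow> 'a set" where
  "vcoset X W x = vadd X x ` W"

definition quotient_space :: "('a, 'm) cnspace_scheme \<Rightarrow> 'a set \<Rightarrow> 'a set cnspace" where
  "quotient_space X W =
     \<lparr>carrier = vcoset X W ` carrier X,
      vadd = (\<lambda>A B. \<Union>a\<in>A. \<Union>b\<in>B. vcoset X W (vadd X a b)),
      vscale = (\<lambda>c A. \<Union>a\<in>A. vcoset X W (vscale X c a)),
      vnorm = (\<lambda>A. INF a\<in>A. vnorm X a)\<rparr>"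

definition weak_topology :: "('a, 'm) cnspace_scheme \<Rightarrow> 'a topology" where
  "weak_topology X =
     topology_generated_by {{x\<in>carrier X. f x \<in> U} |f U. f \<in> carrier (dual X) \<and> open U}"

text \<open>The topology \<open>\<sigma>(X\<^sup>*, X)\<close> on the dual of \<open>X\<close>.\<close>

definition weak_star_topology :: "('a, 'm) cnspace_scheme \<Rightarrow> ('a \<Rightarrow> complex) topology" where
  "weak_star_topology X =
     topology_generated_by {{f\<in>carrier (dual X). f x \<in> U} |x U. x \<in> carrier X \<and> open U}"

definition relatively_weakly_compact :: "('a, 'm) cnspace_scheme \<Rightarrow> 'a set \<Rightarrow> bool" where
  "relatively_weakly_compact X S \<longleftrightarrow>
     S \<subseteq> carrier X \<and> compactin (weak_topology X) (weak_topology X closure_of S)"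

definition canonical_embedding ::
  "('a, 'm) cnspace_scheme \<Rightarrow> 'a \<Rightarrow> ('a \<Rightarrow> complex) \<Rightarrow> complex" where
  "canonical_embedding X x = (\<lambda>f. if f \<in> carrier (dual X) then f x else 0)"

text \<open>
  The suffix \<open>1\<close> marks the operations \<open>f\<phi>\<close>, \<open>\<nu>f\<close>, \<open>\<mu>\<nu>\<close> leading to the first Arens
  product, the suffix \<open>2\<close> the operations \<open>\<phi>.f\<close>, \<open>f.\<mu>\<close>, \<open>\<mu>.\<nu>\<close> leading to the second one.
  The arguments are in the order in which they are written in these products.
\<close>

definition act1 :: "('a, 'm) cnalgebra_scheme \<Rightarrow> ('a \<Rightarrow> complex) \<Rightarrow> 'a \<Rightarrow> 'a \<Rightarrow> complex" where
  "act1 A f \<phi> = (\<lambda>\<psi>. if \<psi> \<in> carrier A then f (amult A \<phi> \<psi>) else 0)"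

definition bidual_act1 ::
  "('a, 'm) cnalgebra_scheme \<Rightarrow> (('a \<Rightarrow> complex) \<Rightarrow> complex) \<Rightarrow> ('a \<Rightarrow> complex) \<Rightarrow> 'a \<Rightarrow> complex" where
  "bidual_act1 A \<nu> f = (\<lambda>\<phi>. if \<phi> \<in> carrier A then \<nu> (act1 A f \<phi>) else 0)"

definition arens1 ::
  "('a, 'm) cnalgebra_scheme \<Rightarrow> (('a \<Rightarrow> complex) \<Rightarrow> complex) \<Rightarrow> (('a \<Rightarrow> complex) \<Rightarrow> complex)
    \<Rightarrow> ('a \<Rightarrow> complex) \<Rightarrow> complex" where
  "arens1 A \<mu> \<nu> = (\<lambda>f. if f \<in> carrier (dual A) then \<mu> (bidual_act1 A \<nu> f) else 0)"

definition act2 :: "('a, 'm) cnalgebra_scheme \<Rightarrow> 'a \<Rightarrow> ('a \<Rightarrow> complex) \<Rightarrow> 'a \<Rightarrow> complex" where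
  "act2 A \<phi> f = (\<lambda>\<psi>. if \<psi> \<in> carrier A then f (amult A \<psi> \<phi>) else 0)"

definition bidual_act2 ::
  "('a, 'm) cnalgebra_scheme \<Rightarrow> ('a \<Rightarrow> complex) \<Rightarrow> (('a \<Rightarrow> complex) \<Rightarrow> complex) \<Rightarrow> 'a \<Rightarrow> complex" where
  "bidual_act2 A f \<mu> = (\<lambda>\<phi>. if \<phi> \<in> carrier A then \<mu> (act2 A \<phi> f) else 0)"

definition arens2 ::
  "('a, 'm) cnalgebra_scheme \<Rightarrow> (('a \<Rightarrow> complex) \<Rightarrow> complex) \<Rightarrow> (('a \<Rightarrow> complex) \<Rightarrow> complex)
    \<Rightarrow> ('a \<Rightarrow> complex) \<Rightarrow> complex" where
  "arens2 A \<mu> \<nu> = (\<lambda>f. if f \<in> carrier (dual A) then \<nu> (bidual_act2 A f \<mu>) else 0)"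

definition WAP :: "('a, 'm) cnalgebra_scheme \<Rightarrow> ('a \<Rightarrow> complex) set" where
  "WAP A = {f\<in>carrier (dual A).
     relatively_weakly_compact (dual A) {act1 A f \<phi> |\<phi>. \<phi> \<in> carrier A \<and> vnorm A \<phi> \<le> 1}}"

definition extremely_non_Arens_regular :: "('a, 'm) cnalgebra_scheme \<Rightarrow> bool" where
  "extremely_non_Arens_regular A \<longleftrightarrow>
     (let Q = quotient_space (dual A) (WAP A) in
      \<exists>S T. closed_csubspace Q S \<and>
        bounded_clinear_map (Q\<lparr>carrier := S\<rparr>) (dual A) T \<and> T ` S = carrier (dual A))"

definition strongly_Arens_irregular :: "('a, 'm) cnalgebra_scheme \<Rightarrow> bool" where
  "strongly_Arens_irregular A \<longleftrightarrow>
     (let \<sigma> = weak_star_topology (dual A) in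
      \<forall>\<mu>\<in>carrier (dual (dual A)).
        (continuous_map \<sigma> \<sigma> (\<lambda>\<nu>. arens1 A \<mu> \<nu>) \<longrightarrow> \<mu> \<in> canonical_embedding A ` carrier A) \<and>
        (continuous_map \<sigma> \<sigma> (\<lambda>\<nu>. arens2 A \<nu> \<mu>) \<longrightarrow> \<mu> \<in> canonical_embedding A ` carrier A))"

text \<open>
  Elements of \<open>\<ell>\<^sup>2(G)\<close> are represented by functions whose values outside \<open>carrier G\<close> are
  irrelevant.
\<close>

definition l2 :: "('g, 'm) monoid_scheme \<Rightarrow> ('g \<Rightarrow> complex) set" where
  "l2 G = {\<xi>. (\<lambda>y. (cmod (\<xi> y))\<^sup>2) summable_on carrier G}"

definition l2_norm :: "('g, 'm) monoid_scheme \<Rightarrow> ('g \<Rightarrow> complex) \<Rightarrow> real" where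
  "l2_norm G \<xi> = sqrt (\<Sum>\<^sub>\<infinity>y\<in>carrier G. (cmod (\<xi> y))\<^sup>2)"

definition l2_inner :: "('g, 'm) monoid_scheme \<Rightarrow> ('g \<Rightarrow> complex) \<Rightarrow> ('g \<Rightarrow> complex) \<Rightarrow> complex" where
  "l2_inner G \<xi> \<eta> = (\<Sum>\<^sub>\<infinity>y\<in>carrier G. \<xi> y * cnj (\<eta> y))"

definition left_regular :: "('g, 'm) monoid_scheme \<Rightarrow> 'g \<Rightarrow> ('g \<Rightarrow> complex) \<Rightarrow> 'g \<Rightarrow> complex" where
  "left_regular G x \<xi> = (\<lambda>y. \<xi> (inv\<^bsub>G\<^esub> x \<otimes>\<^bsub>G\<^esub> y))"

text \<open>
  \<open>A(G)\<close> is the predual of the group von Neumann algebra \<open>VN(G)\<close>: it consists of the functions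
  \<open>x \<mapsto> \<omega>(\<lambda>(x))\<close>, where \<open>\<lambda>\<close> is the left regular representation and
  \<open>\<omega> = \<Sum>n. \<langle>\<cdot> \<xi>\<^sub>n, \<eta>\<^sub>n\<rangle>\<close> with \<open>\<Sum>n. \<parallel>\<xi>\<^sub>n\<parallel> \<parallel>\<eta>\<^sub>n\<parallel> < \<infinity>\<close> is a normal functional. Its norm is the
  infimum of \<open>\<Sum>n. \<parallel>\<xi>\<^sub>n\<parallel> \<parallel>\<eta>\<^sub>n\<parallel>\<close> over all such representations; as a Banach space, \<open>A(G)\<close> is thus
  the quotient of the projective tensor product of \<open>\<ell>\<^sup>2(G)\<close> with its conjugate by the annihilator
  of \<open>VN(G)\<close>. (By Eymard, a single coefficient always suffices and the infimum is attained.)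
\<close>

definition fourier_rep :: "('g, 'm) monoid_scheme \<Rightarrow> ('g \<Rightarrow> complex)
    \<Rightarrow> (nat \<Rightarrow> 'g \<Rightarrow> complex) \<Rightarrow> (nat \<Rightarrow> 'g \<Rightarrow> complex) \<Rightarrow> bool" where
  "fourier_rep G u \<xi> \<eta> \<longleftrightarrow>
     (\<forall>n. \<xi> n \<in> l2 G \<and> \<eta> n \<in> l2 G) \<and>
     summable (\<lambda>n. l2_norm G (\<xi> n) * l2_norm G (\<eta> n)) \<and>
     (\<forall>x\<in>carrier G. u x = (\<Sum>n. l2_inner G (left_regular G x (\<xi> n)) (\<eta> n)))"

definition fourier_norm :: "('g, 'm) monoid_scheme \<Rightarrow> ('g \<Rightarrow> complex) \<Rightarrow> real" where
  "fourier_norm G u = Inf {\<Sum>n. l2_norm G (\<xi> n) * l2_norm G (\<eta> n) |\<xi> \<eta>. fourier_rep G u \<xi> \<eta>}"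

definition fourier_algebra :: "('g, 'm) monoid_scheme \<Rightarrow> ('g \<Rightarrow> complex) cnalgebra" where
  "fourier_algebra G =
     \<lparr>carrier = {u. (\<exists>\<xi> \<eta>. fourier_rep G u \<xi> \<eta>) \<and> (\<forall>x. x \<notin> carrier G \<longrightarrow> u x = 0)},
      vadd = (\<lambda>u v x. u x + v x),
      vscale = (\<lambda>c u x. c * u x),
      vnorm = fourier_norm G,
      amult = (\<lambda>u v x. u x * v x)\<rparr>"

text \<open>
  The letter \<open>(i, True)\<close> stands for the \<open>i\<close>-th generator and \<open>(i, False)\<close> for its inverse.
  The elements of the free group are the reduced words.
\<close>

type_synonym letter = "nat \<times> bool"

definition inv_letter :: "letter \<Rightarrow> letter" where
  "inv_letter a = (fst a, \<not> snd a)"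

definition reduced_word :: "letter list \<Rightarrow> bool" where
  "reduced_word w \<longleftrightarrow> successively (\<lambda>a b. b \<noteq> inv_letter a) w"

fun cons_reduce :: "letter \<Rightarrow> letter list \<Rightarrow> letter list" where
  "cons_reduce a [] = [a]"
| "cons_reduce a (b # w) = (if b = inv_letter a then w else a # b # w)"

definition free_group :: "nat \<Rightarrow> letter list monoid" where
  "free_group r =
     \<lparr>carrier = {w. reduced_word w \<and> fst ` set w \<subseteq> {..<r}},
      mult = foldr cons_reduce,
      one = []\<rparr>"

lemma inv_letter_invol [simp]: "inv_letter (inv_letter a) = a"
  by (simp add: inv_letter_def)

lemma fst_inv_letter [simp]: "fst (inv_letter a) = fst a"
  by (simp add: inv_letter_def)

lemma inv_letter_neq [simp]: "inv_letter a \<noteq> a" "a \<noteq> inv_letter a"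
  by (cases a; simp add: inv_letter_def)+

lemma inv_letter_eq_iff [simp]: "inv_letter a = inv_letter b \<longleftrightarrow> a = b"
  by (metis inv_letter_invol)

lemma reduced_Cons: "reduced_word (a # w) \<Longrightarrow> reduced_word w"
  by (cases w) (auto simp: reduced_word_def)

lemma reduced_cons_reduce: "reduced_word w \<Longrightarrow> reduced_word (cons_reduce a w)"
  by (cases w) (auto simp: reduced_word_def dest: reduced_Cons[unfolded reduced_word_def])

lemma set_cons_reduce: "set (cons_reduce a w) \<subseteq> insert a (set w)"
  by (cases w) auto

lemma cons_reduce_cancel:
  assumes "reduced_word w" shows "cons_reduce a (cons_reduce (inv_letter a) w) = w"
proof (cases w)
  case (Cons b w')
  then show ?thesis using assms by (cases w') (auto simp: reduced_word_def)
qed simp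

lemma reduced_foldr: "reduced_word v \<Longrightarrow> reduced_word (foldr cons_reduce u v)"
  by (induction u) (auto intro: reduced_cons_reduce)

lemma set_foldr: "set (foldr cons_reduce u v) \<subseteq> set u \<union> set v"
  by (induction u) (use set_cons_reduce in fastforce)+

lemma foldr_cons_reduce:
  "reduced_word v \<Longrightarrow> foldr cons_reduce (cons_reduce a u) v = cons_reduce a (foldr cons_reduce u v)"
  by (cases u) (auto simp: cons_reduce_cancel reduced_foldr)

lemma foldr_assoc:
  "reduced_word w \<Longrightarrow>
     foldr cons_reduce (foldr cons_reduce u v) w = foldr cons_reduce u (foldr cons_reduce v w)"
  by (induction u) (auto simp: foldr_cons_reduce)

lemma foldr_Nil: "reduced_word u \<Longrightarrow> foldr cons_reduce u [] = u"
proof (induction u)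
  case (Cons a u)
  then show ?case by (cases u) (auto simp: reduced_word_def)
qed simp

lemma foldr_inverse:
  "reduced_word v \<Longrightarrow> foldr cons_reduce (rev (map inv_letter u)) (foldr cons_reduce u v) = v"
proof (induction u arbitrary: v)
  case (Cons a u)
  then show ?case
    using cons_reduce_cancel[of "foldr cons_reduce u v" "inv_letter a"] by (simp add: reduced_foldr)
qed simp

lemma reduced_rev_inv: "reduced_word u \<Longrightarrow> reduced_word (rev (map inv_letter u))"
  unfolding reduced_word_def successively_rev successively_map
  by (erule successively_mono) auto

lemma group_free_group: "group (free_group r)"
proof (rule groupI)
  fix x y assume *: "x \<in> carrier (free_group r)" "y \<in> carrier (free_group r)"
  have "fst ` set (foldr cons_reduce x y) \<subseteq> fst ` (set x \<union> set y)"
    by (intro image_mono set_foldr)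
  with * have "fst ` set (foldr cons_reduce x y) \<subseteq> {..<r}"
    unfolding free_group_def by (simp add: image_Un) blast
  with * show "x \<otimes>\<^bsub>free_group r\<^esub> y \<in> carrier (free_group r)"
    by (auto simp: free_group_def reduced_foldr)
next
  fix x assume *: "x \<in> carrier (free_group r)"
  have "foldr cons_reduce (rev (map inv_letter x)) x = []"
    using foldr_inverse[of "[]" x] foldr_Nil[of x] * by (simp add: free_group_def reduced_word_def)
  moreover have "rev (map inv_letter x) \<in> carrier (free_group r)"
    using * by (auto simp: free_group_def reduced_rev_inv)
  ultimately show "\<exists>y\<in>carrier (free_group r). y \<otimes>\<^bsub>free_group r\<^esub> x = \<one>\<^bsub>free_group r\<^esub>"
    by (intro bexI[of _ "rev (map inv_letter x)"]) (simp_all add: free_group_def)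
qed (auto simp: free_group_def foldr_assoc reduced_word_def[of "[]"])

end

theory Submission
  imports Defs
begin

text \<open>
  A weak* cluster point in the bidual of a bounded sequence \<open>\<Phi>\<^sub>n\<close> in \<open>A(G)\<close> whose multiplier norms tend
  to \<open>0\<close> annihilates the bidual under the Arens products, and it lies outside \<open>A(G)\<close> as soon as it is not \<open>0\<close>. In
  a free group such a sequence is obtained by averaging, over many mutually free infinite cyclic
  subgroups, a flat function of bounded norm with long support. By a ping-pong argument the
  operator norm of \<open>\<Sum> c\<^sub>p \<lambda>(g\<^sub>p)\<close> with \<open>g\<^sub>p\<close> in these subgroups is essentially its \<open>\<ell>\<^sup>2\<close>-norm; this
  makes the multiplier norms small and also gives a functional taking the value \<open>1\<close> at every \<open>\<Phi>\<^sub>n\<close>.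

  For extreme non-Arens regularity it suffices that the quotient by the weakly almost periodic
  functionals contains a copy of \<open>\<ell>\<^sup>\<infinity>\<close>, because the dual of the separable space \<open>A(G)\<close> embeds into
  \<open>\<ell>\<^sup>\<infinity>\<close>. On one infinite cyclic subgroup, functionals oscillating at lacunary scales have symbols
  that are absolutely summable uniformly on the circle. Differences of iterated limits along Fejer
  kernels and plateau functions vanish on weakly almost periodic functionals and recover the
  coefficients of such a series.
\<close>

section \<open>Square-summable functions\<close>

text \<open>The sizes in the averaging are balanced against each other. With N subgroups and support
  length L, the multiplier norm is of order sqrt L / N, while the functional with coefficient 1 / L
  at N L points has l2-norm sqrt (N / L). Hence N < L < N^2. The choice N = 4^n, L = 8^n sends the
  first to 0 and makes the squares of the second summable over n, so that one functional serves all
  levels, each living on its own subgroups.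

  On the single cyclic subgroup the obstacle is the point 1 of the circle: a triangular weight of
  mass 1 centred at the exponent 3 * 5^m has symbol 1 there for every m. Subtracting the weight
  centred at the opposite exponent makes the symbol vanish at 1, to first order in 5^m |z - 1|; for
  large values of that quantity the decay of the Fejer kernel helps. The plateau functions see only
  positive exponents and therefore still detect the coefficient.

  Upper bounds for the norm of A(G) come from explicit coefficients, for finitely supported
  functions from the l2-norm. Bounds for functionals are checked on single coefficients and summed
  over a representation.\<close>

abbreviation sq_summable_on :: "('a \<Rightarrow> complex) \<Rightarrow> 'a set \<Rightarrow> bool" where
  "sq_summable_on f A \<equiv> (\<lambda>x. (cmod (f x))\<^sup>2) summable_on A"

lemma finite_sum_le_CauchySchwarz:
  fixes f g :: "'a \<Rightarrow> complex"
  assumes "sq_summable_on f A" "sq_summable_on g A" "finite F" "F \<subseteq> A"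
  shows "(\<Sum>x\<in>F. cmod (f x * cnj (g x))) \<le>
    sqrt (\<Sum>\<^sub>\<infinity>x\<in>A. (cmod (f x))\<^sup>2) * sqrt (\<Sum>\<^sub>\<infinity>x\<in>A. (cmod (g x))\<^sup>2)"
proof -
  have "(\<Sum>x\<in>F. cmod (f x * cnj (g x))) = (\<Sum>x\<in>F. \<bar>cmod (f x)\<bar> * \<bar>cmod (g x)\<bar>)"
    by (simp add: norm_mult)
  also have "\<dots> \<le> L2_set (\<lambda>x. cmod (f x)) F * L2_set (\<lambda>x. cmod (g x)) F"
    by (rule L2_set_mult_ineq)
  also have "\<dots> \<le> sqrt (\<Sum>\<^sub>\<infinity>x\<in>A. (cmod (f x))\<^sup>2) * sqrt (\<Sum>\<^sub>\<infinity>x\<in>A. (cmod (g x))\<^sup>2)"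
    unfolding L2_set_def using assms
    by (intro mult_mono real_sqrt_le_mono finite_sum_le_infsum) (auto intro!: infsum_nonneg sum_nonneg)
  finally show ?thesis .
qed

lemma abs_summable_CauchySchwarz:
  fixes f g :: "'a \<Rightarrow> complex"
  assumes "sq_summable_on f A" "sq_summable_on g A"
  shows "(\<lambda>x. cmod (f x * cnj (g x))) summable_on A"
  using finite_sum_le_CauchySchwarz[OF assms]
  by (intro nonneg_bdd_above_summable_on bdd_aboveI2) auto

lemma cmod_infsum_CauchySchwarz:
  fixes f g :: "'a \<Rightarrow> complex"
  assumes "sq_summable_on f A" "sq_summable_on g A"
  shows "cmod (\<Sum>\<^sub>\<infinity>x\<in>A. f x * cnj (g x)) \<le>
    sqrt (\<Sum>\<^sub>\<infinity>x\<in>A. (cmod (f x))\<^sup>2) * sqrt (\<Sum>\<^sub>\<infinity>x\<in>A. (cmod (g x))\<^sup>2)"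
  using norm_infsum_bound[OF abs_summable_CauchySchwarz[OF assms]]
    infsum_le_finite_sums[OF abs_summable_CauchySchwarz[OF assms] finite_sum_le_CauchySchwarz[OF assms]]
  by linarith

lemma sq_summable_on_add:
  assumes "sq_summable_on f A" "sq_summable_on g A"
  shows "sq_summable_on (\<lambda>x. f x + g x) A"
proof (rule summable_on_comparison_test)
  show "(\<lambda>x. 2 * (cmod (f x))\<^sup>2 + 2 * (cmod (g x))\<^sup>2) summable_on A"
    using assms by (intro summable_on_add summable_on_cmult_right)
  fix x
  have "(cmod (f x + g x))\<^sup>2 \<le> (cmod (f x) + cmod (g x))\<^sup>2"
    by (intro power_mono norm_triangle_ineq) auto
  also have "\<dots> \<le> 2 * (cmod (f x))\<^sup>2 + 2 * (cmod (g x))\<^sup>2"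
    using sum_squares_bound[of "cmod (f x)" "cmod (g x)"] by (simp add: power2_sum)
  finally show "(cmod (f x + g x))\<^sup>2 \<le> 2 * (cmod (f x))\<^sup>2 + 2 * (cmod (g x))\<^sup>2" .
qed auto

lemma l2_add: "\<xi> \<in> l2 G \<Longrightarrow> \<eta> \<in> l2 G \<Longrightarrow> (\<lambda>x. \<xi> x + \<eta> x) \<in> l2 G"
  by (simp add: l2_def sq_summable_on_add)

lemma l2_cmult: "\<xi> \<in> l2 G \<Longrightarrow> (\<lambda>x. c * \<xi> x) \<in> l2 G"
  by (simp add: l2_def norm_mult power_mult_distrib summable_on_cmult_right)

lemma l2_diff: "\<xi> \<in> l2 G \<Longrightarrow> \<eta> \<in> l2 G \<Longrightarrow> (\<lambda>x. \<xi> x - \<eta> x) \<in> l2 G"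
  using l2_add[of \<xi> G "\<lambda>x. (-1) * \<eta> x"] l2_cmult[of \<eta> G "-1"] by simp

lemma l2_norm_cmult: "l2_norm G (\<lambda>x. c * \<xi> x) = cmod c * l2_norm G \<xi>"
  by (simp add: l2_norm_def norm_mult power_mult_distrib infsum_cmult_right' real_sqrt_mult)

lemma l2_norm_nonneg [simp]: "0 \<le> l2_norm G \<xi>"
  by (simp add: l2_norm_def infsum_nonneg)

lemma l2_norm_power2: "(l2_norm G \<xi>)\<^sup>2 = (\<Sum>\<^sub>\<infinity>y\<in>carrier G. (cmod (\<xi> y))\<^sup>2)"
  by (simp add: l2_norm_def infsum_nonneg)

lemma sum_le_l2_norm_power2:
  assumes "\<xi> \<in> l2 G" "finite F" "F \<subseteq> carrier G"
  shows "(\<Sum>x\<in>F. (cmod (\<xi> x))\<^sup>2) \<le> (l2_norm G \<xi>)\<^sup>2"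
  using assms unfolding l2_norm_power2 l2_def by (auto intro!: finite_sum_le_infsum)

lemma cmod_l2_inner_le:
  "\<xi> \<in> l2 G \<Longrightarrow> \<eta> \<in> l2 G \<Longrightarrow> cmod (l2_inner G \<xi> \<eta>) \<le> l2_norm G \<xi> * l2_norm G \<eta>"
  unfolding l2_def l2_inner_def l2_norm_def mem_Collect_eq by (rule cmod_infsum_CauchySchwarz)

lemma l2_inner_summable:
  "\<xi> \<in> l2 G \<Longrightarrow> \<eta> \<in> l2 G \<Longrightarrow> (\<lambda>x. \<xi> x * cnj (\<eta> x)) summable_on carrier G"
  unfolding l2_def mem_Collect_eq by (rule abs_summable_summable[OF abs_summable_CauchySchwarz])

lemma l2_inner_add_left:
  "\<xi> \<in> l2 G \<Longrightarrow> \<xi>' \<in> l2 G \<Longrightarrow> \<eta> \<in> l2 G \<Longrightarrow>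
    l2_inner G (\<lambda>x. \<xi> x + \<xi>' x) \<eta> = l2_inner G \<xi> \<eta> + l2_inner G \<xi>' \<eta>"
  unfolding l2_inner_def by (simp add: algebra_simps infsum_add l2_inner_summable)

lemma l2_inner_add_right:
  "\<xi> \<in> l2 G \<Longrightarrow> \<eta> \<in> l2 G \<Longrightarrow> \<eta>' \<in> l2 G \<Longrightarrow>
    l2_inner G \<xi> (\<lambda>x. \<eta> x + \<eta>' x) = l2_inner G \<xi> \<eta> + l2_inner G \<xi> \<eta>'"
  unfolding l2_inner_def by (simp add: algebra_simps infsum_add l2_inner_summable)

lemma l2_inner_cmult_left: "l2_inner G (\<lambda>x. c * \<xi> x) \<eta> = c * l2_inner G \<xi> \<eta>"
  unfolding l2_inner_def by (simp add: mult.assoc infsum_cmult_right')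

lemma l2_finite_support:
  assumes "finite F" "\<And>x. x \<in> carrier G - F \<Longrightarrow> \<xi> x = 0"
  shows "\<xi> \<in> l2 G"
  unfolding l2_def mem_Collect_eq
  by (rule finite_nonzero_values_imp_summable_on) (use assms in \<open>auto intro: finite_subset[of _ F]\<close>)

lemma l2_norm_finite_support:
  assumes "finite F" "F \<subseteq> carrier G" "\<And>x. x \<in> carrier G - F \<Longrightarrow> \<xi> x = 0"
  shows "l2_norm G \<xi> = sqrt (\<Sum>x\<in>F. (cmod (\<xi> x))\<^sup>2)"
proof -
  have "(\<Sum>\<^sub>\<infinity>x\<in>carrier G. (cmod (\<xi> x))\<^sup>2) = (\<Sum>\<^sub>\<infinity>x\<in>F. (cmod (\<xi> x))\<^sup>2)"
    by (rule infsum_cong_neutral) (use assms in auto)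
  then show ?thesis
    using assms by (simp add: l2_norm_def)
qed

lemma l2_inner_finite_support:
  assumes "finite F" "F \<subseteq> carrier G" "\<And>x. x \<in> carrier G - F \<Longrightarrow> \<eta> x = 0"
  shows "l2_inner G \<xi> \<eta> = (\<Sum>x\<in>F. \<xi> x * cnj (\<eta> x))"
proof -
  have "(\<Sum>\<^sub>\<infinity>x\<in>carrier G. \<xi> x * cnj (\<eta> x)) = (\<Sum>\<^sub>\<infinity>x\<in>F. \<xi> x * cnj (\<eta> x))"
    by (rule infsum_cong_neutral) (use assms in auto)
  then show ?thesis
    using assms by (simp add: l2_inner_def)
qed

section \<open>Coefficient functions\<close>

text \<open>The cutoff outside the carrier makes this an element of
  \<open>fourier_algebra G\<close>, whose members vanish there.\<close>

definition coef :: "('g, 'm) monoid_scheme \<Rightarrow> ('g \<Rightarrow> complex) \<Rightarrow> ('g \<Rightarrow> complex) \<Rightarrow> 'g \<Rightarrow> complex" where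
  "coef G \<xi> \<eta> x = (if x \<in> carrier G then l2_inner G (left_regular G x \<xi>) \<eta> else 0)"

lemma coef_outside: "x \<notin> carrier G \<Longrightarrow> coef G \<xi> \<eta> x = 0"
  by (simp add: coef_def)

lemma coef_cmult_left: "coef G (\<lambda>x. c * \<xi> x) \<eta> x = c * coef G \<xi> \<eta> x"
  by (simp add: coef_def left_regular_def l2_inner_cmult_left)

lemma fourier_algebra_simps [simp]:
  "vadd (fourier_algebra G) u v = (\<lambda>x. u x + v x)"
  "vscale (fourier_algebra G) c u = (\<lambda>x. c * u x)"
  "vnorm (fourier_algebra G) = fourier_norm G"
  "amult (fourier_algebra G) u v = (\<lambda>x. u x * v x)"
  by (simp_all add: fourier_algebra_def)

lemma fourier_algebra_outside: "u \<in> carrier (fourier_algebra G) \<Longrightarrow> x \<notin> carrier G \<Longrightarrow> u x = 0"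
  by (simp add: fourier_algebra_def)

lemma fourier_rep_norm_nonneg: "fourier_rep G u \<xi> \<eta> \<Longrightarrow> 0 \<le> (\<Sum>n. l2_norm G (\<xi> n) * l2_norm G (\<eta> n))"
  unfolding fourier_rep_def by (auto intro: suminf_nonneg)

lemma fourier_norm_le:
  "fourier_rep G u \<xi> \<eta> \<Longrightarrow> fourier_norm G u \<le> (\<Sum>n. l2_norm G (\<xi> n) * l2_norm G (\<eta> n))"
  unfolding fourier_norm_def
  by (rule cInf_lower) (auto intro!: bdd_belowI[of _ 0] fourier_rep_norm_nonneg)

lemma fourier_norm_greatest:
  assumes "u \<in> carrier (fourier_algebra G)"
    and "\<And>\<xi> \<eta>. fourier_rep G u \<xi> \<eta> \<Longrightarrow> c \<le> (\<Sum>n. l2_norm G (\<xi> n) * l2_norm G (\<eta> n))"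
  shows "c \<le> fourier_norm G u"
  unfolding fourier_norm_def
  by (rule cInf_greatest) (use assms in \<open>auto simp: fourier_algebra_def\<close>)

lemma fourier_norm_nonneg: "u \<in> carrier (fourier_algebra G) \<Longrightarrow> 0 \<le> fourier_norm G u"
  by (rule fourier_norm_greatest) (auto intro: fourier_rep_norm_nonneg)

context group
begin

lemma left_regular_l2:
  assumes "x \<in> carrier G" "\<xi> \<in> l2 G"
  shows "left_regular G x \<xi> \<in> l2 G" "l2_norm G (left_regular G x \<xi>) = l2_norm G \<xi>"
proof -
  have b: "bij_betw (\<lambda>y. inv x \<otimes> y) (carrier G) (carrier G)"
    by (rule bij_betw_byWitness[where f' = "\<lambda>y. x \<otimes> y"])
       (use assms in \<open>auto simp: m_assoc[symmetric]\<close>)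
  show "left_regular G x \<xi> \<in> l2 G"
    using assms(2) summable_on_reindex_bij_betw[OF b, of "\<lambda>y. (cmod (\<xi> y))\<^sup>2"]
    by (simp add: l2_def left_regular_def)
  show "l2_norm G (left_regular G x \<xi>) = l2_norm G \<xi>"
    using infsum_reindex_bij_betw[OF b, of "\<lambda>y. (cmod (\<xi> y))\<^sup>2"]
    by (simp add: l2_norm_def left_regular_def)
qed

lemma cmod_coef_le:
  assumes "\<xi> \<in> l2 G" "\<eta> \<in> l2 G"
  shows "cmod (coef G \<xi> \<eta> x) \<le> l2_norm G \<xi> * l2_norm G \<eta>"
  using assms cmod_l2_inner_le[OF left_regular_l2(1)[of x \<xi>] assms(2)]
  by (auto simp: coef_def left_regular_l2)

lemma coef_add_left:
  assumes "\<xi> \<in> l2 G" "\<xi>' \<in> l2 G" "\<eta> \<in> l2 G"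
  shows "coef G (\<lambda>x. \<xi> x + \<xi>' x) \<eta> x = coef G \<xi> \<eta> x + coef G \<xi>' \<eta> x"
  using assms l2_inner_add_left[OF left_regular_l2(1)[of x \<xi>] left_regular_l2(1)[of x \<xi>'], of \<eta>]
  by (auto simp: coef_def left_regular_def)

lemma coef_add_right:
  assumes "\<xi> \<in> l2 G" "\<eta> \<in> l2 G" "\<eta>' \<in> l2 G"
  shows "coef G \<xi> (\<lambda>x. \<eta> x + \<eta>' x) x = coef G \<xi> \<eta> x + coef G \<xi> \<eta>' x"
  using assms by (auto simp: coef_def l2_inner_add_right left_regular_l2)

text \<open>\<open>fourier_rep\<close> gives the values as a \<open>suminf\<close>, which alone says
  nothing about convergence; the summable products of norms dominate the coefficients, so the series
  converges absolutely.\<close>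

lemma fourier_rep_sums:
  assumes "fourier_rep G u \<xi> \<eta>" "x \<in> carrier G"
  shows "(\<lambda>n. coef G (\<xi> n) (\<eta> n) x) sums u x"
proof -
  have "summable (\<lambda>n. cmod (coef G (\<xi> n) (\<eta> n) x))"
    by (rule summable_comparison_test'[where N = 0 and g = "\<lambda>n. l2_norm G (\<xi> n) * l2_norm G (\<eta> n)"])
       (use assms(1) in \<open>auto simp: fourier_rep_def intro!: cmod_coef_le\<close>)
  then show ?thesis
    using assms summable_sums[OF summable_norm_cancel]
    by (fastforce simp: fourier_rep_def coef_def)
qed

text \<open>Representations are sequences, so the finite family is enumerated and padded with zero
  vectors.\<close>

lemma fourier_algebraI_finite_sum:
  assumes R: "finite R" and l2: "\<And>r. r \<in> R \<Longrightarrow> \<xi> r \<in> l2 G" "\<And>r. r \<in> R \<Longrightarrow> \<eta> r \<in> l2 G"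
    and u: "\<And>x. u x = (\<Sum>r\<in>R. coef G (\<xi> r) (\<eta> r) x)"
  shows "u \<in> carrier (fourier_algebra G)"
    and "fourier_norm G u \<le> (\<Sum>r\<in>R. l2_norm G (\<xi> r) * l2_norm G (\<eta> r))"
proof -
  obtain e where e: "bij_betw e {..<card R} R"
    using ex_bij_betw_nat_finite[OF R] by (auto simp: atLeast0LessThan)
  define X where "X = (\<lambda>n. if n < card R then \<xi> (e n) else (\<lambda>_. 0))"
  define H where "H = (\<lambda>n. if n < card R then \<eta> (e n) else (\<lambda>_. 0))"
  have zero: "(\<lambda>_. 0) \<in> l2 G" "l2_norm G (\<lambda>_. 0) = 0" "l2_inner G (\<lambda>_. 0) (\<lambda>_. 0) = 0"
    by (simp_all add: l2_def l2_norm_def l2_inner_def)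
  have eR: "n < card R \<Longrightarrow> e n \<in> R" for n
    using e by (auto simp: bij_betw_def)
  have s1: "(\<lambda>n. l2_norm G (X n) * l2_norm G (H n)) sums (\<Sum>r\<in>R. l2_norm G (\<xi> r) * l2_norm G (\<eta> r))"
  proof -
    have "(\<Sum>n<card R. l2_norm G (X n) * l2_norm G (H n)) = (\<Sum>r\<in>R. l2_norm G (\<xi> r) * l2_norm G (\<eta> r))"
      using sum.reindex_bij_betw[OF e, of "\<lambda>r. l2_norm G (\<xi> r) * l2_norm G (\<eta> r)"]
      by (simp add: X_def H_def)
    moreover have "(\<lambda>n. l2_norm G (X n) * l2_norm G (H n)) sums (\<Sum>n<card R. l2_norm G (X n) * l2_norm G (H n))"
      by (rule sums_finite) (auto simp: X_def H_def zero)
    ultimately show ?thesis by simp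
  qed
  have s2: "(\<lambda>n. l2_inner G (left_regular G x (X n)) (H n)) sums u x" if "x \<in> carrier G" for x
  proof -
    have "(\<Sum>n<card R. l2_inner G (left_regular G x (X n)) (H n)) = u x"
      using sum.reindex_bij_betw[OF e, of "\<lambda>r. coef G (\<xi> r) (\<eta> r) x"] that
      by (simp add: X_def H_def u coef_def)
    moreover have "(\<lambda>n. l2_inner G (left_regular G x (X n)) (H n)) sums
        (\<Sum>n<card R. l2_inner G (left_regular G x (X n)) (H n))"
      by (rule sums_finite) (auto simp: X_def H_def zero left_regular_def)
    ultimately show ?thesis by simp
  qed
  have rep: "fourier_rep G u X H"
    unfolding fourier_rep_def
    using s1 s2 by (auto simp: sums_iff X_def H_def zero l2 eR)
  moreover have "u x = 0" if "x \<notin> carrier G" for x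
    using that by (simp add: u coef_def)
  ultimately show "u \<in> carrier (fourier_algebra G)"
    by (auto simp: fourier_algebra_def)
  show "fourier_norm G u \<le> (\<Sum>r\<in>R. l2_norm G (\<xi> r) * l2_norm G (\<eta> r))"
    using fourier_norm_le[OF rep] s1 by (simp add: sums_iff)
qed

lemma coef_in_fourier_algebra:
  assumes "\<xi> \<in> l2 G" "\<eta> \<in> l2 G"
  shows "coef G \<xi> \<eta> \<in> carrier (fourier_algebra G)"
    and "fourier_norm G (coef G \<xi> \<eta>) \<le> l2_norm G \<xi> * l2_norm G \<eta>"
  using fourier_algebraI_finite_sum[of "{()}" "\<lambda>_. \<xi>" "\<lambda>_. \<eta>"] assms by auto

lemma zero_in_fourier_algebra: "(\<lambda>_. 0) \<in> carrier (fourier_algebra G)"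
  using fourier_algebraI_finite_sum(1)[of "{}" "\<lambda>_ _. 0" "\<lambda>_ _. 0" "\<lambda>_. 0"] by simp

lemma fourier_algebra_cmult:
  assumes "u \<in> carrier (fourier_algebra G)"
  shows "(\<lambda>x. c * u x) \<in> carrier (fourier_algebra G)"
    and "fourier_norm G (\<lambda>x. c * u x) \<le> cmod c * fourier_norm G u"
proof -
  have rep: "fourier_rep G (\<lambda>x. c * u x) (\<lambda>n x. c * \<xi> n x) \<eta> \<and>
      (\<Sum>n. l2_norm G (\<lambda>x. c * \<xi> n x) * l2_norm G (\<eta> n)) =
      cmod c * (\<Sum>n. l2_norm G (\<xi> n) * l2_norm G (\<eta> n))" if r: "fourier_rep G u \<xi> \<eta>" for \<xi> \<eta>
  proof -
    have "(\<lambda>n. l2_norm G (\<lambda>x. c * \<xi> n x) * l2_norm G (\<eta> n)) sums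
        (cmod c * (\<Sum>n. l2_norm G (\<xi> n) * l2_norm G (\<eta> n)))"
      using r unfolding l2_norm_cmult mult.assoc
      by (intro sums_mult summable_sums) (auto simp: fourier_rep_def)
    moreover have "(\<lambda>n. l2_inner G (left_regular G x (\<lambda>x. c * \<xi> n x)) (\<eta> n)) sums (c * u x)"
      if "x \<in> carrier G" for x
      using sums_mult[OF fourier_rep_sums[OF r that], of c] that
      by (simp add: coef_def left_regular_def l2_inner_cmult_left)
    ultimately show ?thesis
      using r unfolding fourier_rep_def by (auto simp: sums_iff l2_cmult)
  qed
  show "(\<lambda>x. c * u x) \<in> carrier (fourier_algebra G)"
    using assms rep by (auto simp: fourier_algebra_def)
  show "fourier_norm G (\<lambda>x. c * u x) \<le> cmod c * fourier_norm G u"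
  \<comment> \<open>The infimum is reached after division by |c|; for c = 0 the empty representation
    shows that the zero function has norm at most 0.\<close>
  proof (cases "c = 0")
    case True
    then show ?thesis
      using fourier_algebraI_finite_sum(2)[of "{}" "\<lambda>_ _. 0" "\<lambda>_ _. 0" "\<lambda>_. 0"] by simp
  next
    case False
    have "fourier_norm G (\<lambda>x. c * u x) / cmod c \<le> fourier_norm G u"
    proof (rule fourier_norm_greatest[OF assms])
      fix \<xi> \<eta> assume r: "fourier_rep G u \<xi> \<eta>"
      show "fourier_norm G (\<lambda>x. c * u x) / cmod c \<le> (\<Sum>n. l2_norm G (\<xi> n) * l2_norm G (\<eta> n))"
        using fourier_norm_le[OF conjunct1[OF rep[OF r]]] rep[OF r] False
        by (simp add: pos_divide_le_eq mult.commute)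
    qed
    then show ?thesis
      using False by (simp add: pos_divide_le_eq mult.commute)
  qed
qed

text \<open>The sum is the value at u of the operator \<Sum> a p \<lambda>(g p). A bound on rank-one
  functionals is summed over a representation of u, and the infimum over representations turns it
  into a bound by the norm.\<close>

lemma fourier_pairing_bound:
  assumes "finite E" "C \<ge> 0" "u \<in> carrier (fourier_algebra G)" "\<And>p. p \<in> E \<Longrightarrow> g p \<in> carrier G"
    and bound: "\<And>\<xi> \<eta>. \<xi> \<in> l2 G \<Longrightarrow> \<eta> \<in> l2 G \<Longrightarrow>
      cmod (\<Sum>p\<in>E. a p * coef G \<xi> \<eta> (g p)) \<le> C * (l2_norm G \<xi> * l2_norm G \<eta>)"
  shows "cmod (\<Sum>p\<in>E. a p * u (g p)) \<le> C * fourier_norm G u"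
proof -
  have le: "cmod (\<Sum>p\<in>E. a p * u (g p)) \<le> C * (\<Sum>n. l2_norm G (\<xi> n) * l2_norm G (\<eta> n))"
    if r: "fourier_rep G u \<xi> \<eta>" for \<xi> \<eta>
  proof -
    let ?t = "\<lambda>n. \<Sum>p\<in>E. a p * coef G (\<xi> n) (\<eta> n) (g p)"
    have s: "?t sums (\<Sum>p\<in>E. a p * u (g p))"
      by (intro sums_sum sums_mult fourier_rep_sums[OF r] assms)
    have b: "norm (?t n) \<le> C * (l2_norm G (\<xi> n) * l2_norm G (\<eta> n))" for n
      using r by (intro bound) (auto simp: fourier_rep_def)
    have sm: "summable (\<lambda>n. C * (l2_norm G (\<xi> n) * l2_norm G (\<eta> n)))"
      using r by (intro summable_mult) (auto simp: fourier_rep_def)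
    have "norm (\<Sum>n. ?t n) \<le> (\<Sum>n. C * (l2_norm G (\<xi> n) * l2_norm G (\<eta> n)))"
      by (rule norm_suminf_le[OF b sm])
    also have "\<dots> = C * (\<Sum>n. l2_norm G (\<xi> n) * l2_norm G (\<eta> n))"
      using r by (intro suminf_mult) (auto simp: fourier_rep_def)
    finally show ?thesis
      using s by (simp add: sums_iff)
  qed
  show ?thesis
  proof (cases "C = 0")
    case True
    then show ?thesis
      using le assms(3) by (auto simp: fourier_algebra_def)
  next
    case False
    with assms(2) have C: "C > 0" by simp
    have "cmod (\<Sum>p\<in>E. a p * u (g p)) / C \<le> fourier_norm G u"
    proof (rule fourier_norm_greatest[OF assms(3)])
      fix \<xi> \<eta> assume "fourier_rep G u \<xi> \<eta>"
      from le[OF this] C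
      show "cmod (\<Sum>p\<in>E. a p * u (g p)) / C \<le> (\<Sum>n. l2_norm G (\<xi> n) * l2_norm G (\<eta> n))"
        by (simp add: pos_divide_le_eq mult.commute)
    qed
    then show ?thesis
      using C by (simp add: pos_divide_le_eq mult.commute)
  qed
qed

lemma cmod_le_fourier_norm:
  assumes "u \<in> carrier (fourier_algebra G)"
  shows "cmod (u x) \<le> fourier_norm G u"
proof (cases "x \<in> carrier G")
  case True
  have "cmod (\<Sum>p\<in>{()}. 1 * u x) \<le> 1 * fourier_norm G u"
    using fourier_pairing_bound[of "{()}" 1 u "\<lambda>_. x" "\<lambda>_. 1"] assms True cmod_coef_le by simp
  then show ?thesis by simp
qed (simp add: fourier_algebra_outside[OF assms] fourier_norm_nonneg[OF assms])

text \<open>Pairing \<lambda>(x) \<xi> with the point mass at the identity gives the value of \<xi>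
  at x^-1. Hence v is the coefficient of its reflection against a unit vector, and reflection
  preserves the l2-norm.\<close>

lemma finite_support_in_fourier_algebra:
  assumes "finite F" "F \<subseteq> carrier G" "\<And>x. x \<notin> F \<Longrightarrow> v x = 0"
  shows "v \<in> carrier (fourier_algebra G)"
    and "fourier_norm G v \<le> sqrt (\<Sum>x\<in>F. (cmod (v x))\<^sup>2)"
proof -
  define \<xi> where "\<xi> = (\<lambda>y. v (inv y))"
  define \<eta> where "\<eta> = (\<lambda>y. if y = \<one> then 1 else (0::complex))"
  have FG: "x \<in> carrier G" if "x \<in> F" for x
    using that assms(2) by auto
  have F': "y \<in> (\<lambda>x. inv x) ` F" if "y \<in> carrier G" "inv y \<in> F" for y
    by (rule image_eqI[of _ _ "inv y"]) (use that in simp_all)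
  have fin: "finite ((\<lambda>x. inv x) ` F)" "(\<lambda>x. inv x) ` F \<subseteq> carrier G"
    using assms(1) FG by auto
  have supp: "\<xi> y = 0" if "y \<in> carrier G - (\<lambda>x. inv x) ` F" for y
    using that assms(3)[of "inv y"] F'[of y] by (auto simp: \<xi>_def)
  have 1: "\<xi> \<in> l2 G"
    by (rule l2_finite_support[OF fin(1) supp])
  have 2: "\<eta> \<in> l2 G"
    by (rule l2_finite_support[of "{\<one>}"]) (auto simp: \<eta>_def)
  have "(\<Sum>x\<in>(\<lambda>x. inv x) ` F. (cmod (\<xi> x))\<^sup>2) = (\<Sum>x\<in>F. (cmod (v x))\<^sup>2)"
    by (subst sum.reindex) (auto simp: \<xi>_def FG intro!: inj_onI dest: inv_equality cong: sum.cong, metis FG inv_inv)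
  then have 3: "l2_norm G \<xi> = sqrt (\<Sum>x\<in>F. (cmod (v x))\<^sup>2)"
    using l2_norm_finite_support[OF fin supp] by simp
  have 4: "l2_norm G \<eta> = 1"
    by (subst l2_norm_finite_support[of "{\<one>}"]) (auto simp: \<eta>_def)
  have "v = coef G \<xi> \<eta>"
  proof
    fix x
    show "v x = coef G \<xi> \<eta> x"
    proof (cases "x \<in> carrier G")
      case True
      then show ?thesis
        by (subst coef_def, subst l2_inner_finite_support[of "{\<one>}"])
           (auto simp: \<eta>_def left_regular_def \<xi>_def)
    next
      case False
      then show ?thesis
        using assms by (auto simp: coef_def)
    qed
  qed
  then show "v \<in> carrier (fourier_algebra G)" "fourier_norm G v \<le> sqrt (\<Sum>x\<in>F. (cmod (v x))\<^sup>2)"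
    using coef_in_fourier_algebra[OF 1 2] 3 4 by auto
qed

end

section \<open>Operator norms of sums over group elements in ping-pong position\<close>

lemma has_sum_finite_sum:
  fixes f :: "'i \<Rightarrow> 'a \<Rightarrow> complex"
  assumes "finite P" "\<And>p. p \<in> P \<Longrightarrow> (f p has_sum s p) A"
  shows "((\<lambda>y. \<Sum>p\<in>P. f p y) has_sum (\<Sum>p\<in>P. s p)) A"
  using assms by (induction P rule: finite_induct) (auto intro: has_sum_add)

context group
begin

lemma coef_has_sum:
  assumes "\<xi> \<in> l2 G" "\<eta> \<in> l2 G" "x \<in> carrier G"
  shows "((\<lambda>y. \<xi> (inv x \<otimes> y) * cnj (\<eta> y)) has_sum coef G \<xi> \<eta> x) (carrier G)"
  using l2_inner_summable[OF left_regular_l2(1)[OF assms(3,1)] assms(2)] assms(3)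
  by (simp add: coef_def l2_inner_def left_regular_def summable_iff_has_sum_infsum)

lemma sum_translate_le_l2_norm:
  assumes "\<xi> \<in> l2 G" "x \<in> carrier G" "finite Y" "Y \<subseteq> carrier G"
  shows "(\<Sum>y\<in>Y. (cmod (\<xi> (inv x \<otimes> y)))\<^sup>2) \<le> (l2_norm G \<xi>)\<^sup>2"
  using sum_le_l2_norm_power2[OF left_regular_l2(1)[OF assms(2,1)] assms(3,4)]
  unfolding left_regular_l2(2)[OF assms(2,1)] by (simp add: left_regular_def)

text \<open>
  The norm of \<open>\<Sum>p. a p \<lambda>(g p)\<close> for elements playing ping-pong with the disjoint sets \<open>W i\<close>.
  A matrix entry \<open>(y, g\<^sup>-\<^sup>1y)\<close> has at least one of its two indices in the relevant \<open>W i\<close>. Where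
  both are, the Schur test applies; otherwise \<open>p\<close> is determined by the index inside.
\<close>

lemma ping_pong_bound:
  fixes a :: "'p \<Rightarrow> complex" and g :: "'p \<Rightarrow> 'a" and cls :: "'p \<Rightarrow> 'i" and W :: "'i \<Rightarrow> 'a set"
  assumes P: "finite P" and g: "\<And>p. p \<in> P \<Longrightarrow> g p \<in> carrier G"
    and disj: "\<And>i j. i \<noteq> j \<Longrightarrow> W i \<inter> W j = {}"
    and into: "\<And>p y. p \<in> P \<Longrightarrow> y \<in> carrier G \<Longrightarrow> y \<notin> W (cls p) \<Longrightarrow> g p \<otimes> y \<in> W (cls p)"
    and sep: "\<And>p q y. p \<in> P \<Longrightarrow> q \<in> P \<Longrightarrow> p \<noteq> q \<Longrightarrow> cls p = cls q \<Longrightarrow>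
      y \<in> carrier G \<Longrightarrow> y \<notin> W (cls p) \<Longrightarrow> inv (g p) \<otimes> (g q \<otimes> y) \<in> W (cls p)"
    and into': "\<And>p y. p \<in> P \<Longrightarrow> y \<in> carrier G \<Longrightarrow> y \<notin> W (cls p) \<Longrightarrow> inv (g p) \<otimes> y \<in> W (cls p)"
    and sep': "\<And>p q y. p \<in> P \<Longrightarrow> q \<in> P \<Longrightarrow> p \<noteq> q \<Longrightarrow> cls p = cls q \<Longrightarrow>
      y \<in> carrier G \<Longrightarrow> y \<notin> W (cls p) \<Longrightarrow> g p \<otimes> (inv (g q) \<otimes> y) \<in> W (cls p)"
    and B0: "B \<ge> 0" and B: "\<And>i. (\<Sum>p\<in>{p\<in>P. cls p = i}. cmod (a p)) \<le> B"
    and D0: "D \<ge> 0" and D: "(\<Sum>p\<in>P. (cmod (a p))\<^sup>2) \<le> D\<^sup>2"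
    and \<xi>: "\<xi> \<in> l2 G" and \<eta>: "\<eta> \<in> l2 G"
  shows "cmod (\<Sum>p\<in>P. a p * coef G \<xi> \<eta> (g p)) \<le> (B + 2 * D) * (l2_norm G \<xi> * l2_norm G \<eta>)"
proof -
  define K where "K = (B + 2 * D) * (l2_norm G \<xi> * l2_norm G \<eta>)"
  define z where "z = (\<lambda>(p, y). inv (g p) \<otimes> y)"
  define t where "t = (\<lambda>(p, y). cmod (a p) * cmod (\<xi> (z (p, y))) * cmod (\<eta> y))"
  have z_inv: "g p \<otimes> z (p, y) = y" if "p \<in> P" "y \<in> carrier G" for p y
    using that g by (simp add: z_def m_assoc[symmetric])
  have z_carr: "z (p, y) \<in> carrier G" if "p \<in> P" "y \<in> carrier G" for p y
    using that g by (simp add: z_def)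
  have weighted: "(\<Sum>(p, y)\<in>Q. cmod (a p) * (cmod (\<zeta> y))\<^sup>2) \<le> B * (l2_norm G \<zeta>)\<^sup>2"
    if Q: "finite Q" "Q \<subseteq> P \<times> carrier G" "\<And>p y. (p, y) \<in> Q \<Longrightarrow> y \<in> W (cls p)" and \<zeta>: "\<zeta> \<in> l2 G" for Q \<zeta>
  proof -
    let ?Y = "snd ` Q"
    have "(\<Sum>(p, y)\<in>Q. cmod (a p) * (cmod (\<zeta> y))\<^sup>2)
        \<le> (\<Sum>(y, p)\<in>Sigma ?Y (\<lambda>y. {p\<in>P. y \<in> W (cls p)}). cmod (a p) * (cmod (\<zeta> y))\<^sup>2)"
      by (rule sum_le_included[where i = "\<lambda>(y, p). (p, y)"])
         (use Q P in \<open>force intro!: finite_SigmaI mult_nonneg_nonneg\<close>)+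
    also have "\<dots> = (\<Sum>y\<in>?Y. \<Sum>p\<in>{p\<in>P. y \<in> W (cls p)}. cmod (a p) * (cmod (\<zeta> y))\<^sup>2)"
      by (rule sum.Sigma[symmetric]) (use Q P in auto)
    also have "\<dots> \<le> (\<Sum>y\<in>?Y. B * (cmod (\<zeta> y))\<^sup>2)"
    proof (rule sum_mono)
      fix y assume "y \<in> ?Y"
      then obtain p where p: "(p, y) \<in> Q" by auto
      have "{q\<in>P. y \<in> W (cls q)} \<subseteq> {q\<in>P. cls q = cls p}"
        using Q(3)[OF p] disj by blast
      then have "(\<Sum>p\<in>{p\<in>P. y \<in> W (cls p)}. cmod (a p)) \<le> (\<Sum>q\<in>{q\<in>P. cls q = cls p}. cmod (a q))"
        using P by (intro sum_mono2) auto
      also note B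
      finally show "(\<Sum>p\<in>{p\<in>P. y \<in> W (cls p)}. cmod (a p) * (cmod (\<zeta> y))\<^sup>2) \<le> B * (cmod (\<zeta> y))\<^sup>2"
        unfolding sum_distrib_right[symmetric] by (rule mult_right_mono) auto
    qed
    also have "\<dots> \<le> B * (l2_norm G \<zeta>)\<^sup>2"
      unfolding sum_distrib_left[symmetric] using Q \<zeta> B0
      by (intro mult_left_mono sum_le_l2_norm_power2) auto
    finally show ?thesis .
  qed
  have CS: "(\<Sum>q\<in>Q. u q * v q) \<le> s * r"
    if "(\<Sum>q\<in>Q. (u q)\<^sup>2) \<le> s\<^sup>2" "(\<Sum>q\<in>Q. (v q)\<^sup>2) \<le> r\<^sup>2" "s \<ge> 0" "r \<ge> 0"
      "\<And>q. q \<in> Q \<Longrightarrow> u q \<ge> 0" "\<And>q. q \<in> Q \<Longrightarrow> v q \<ge> 0"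
    for Q :: "('p \<times> 'a) set" and u v :: "'p \<times> 'a \<Rightarrow> real" and s r :: real
  proof -
    have "(\<Sum>q\<in>Q. u q * v q) = (\<Sum>q\<in>Q. \<bar>u q\<bar> * \<bar>v q\<bar>)"
      using that by (intro sum.cong) auto
    also have "\<dots> \<le> L2_set u Q * L2_set v Q"
      by (rule L2_set_mult_ineq)
    also have "\<dots> \<le> s * r"
      unfolding L2_set_def using that by (intro mult_mono real_le_lsqrt sum_nonneg real_sqrt_ge_zero) auto
    finally show ?thesis .
  qed
  have fin: "(\<Sum>q\<in>P \<times> Y. t q) \<le> K" if Y: "finite Y" "Y \<subseteq> carrier G" for Y
  proof -
    let ?N = "l2_norm G \<xi>" and ?M = "l2_norm G \<eta>"
    \<comment> \<open>Row index y and column index \<open>z (p, y)\<close> both inside; only y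
      inside; y outside, in which case \<open>into'\<close> puts the column index inside.\<close>
    define Q1 where "Q1 = {(p, y)\<in>P \<times> Y. y \<in> W (cls p) \<and> z (p, y) \<in> W (cls p)}"
    define Q2 where "Q2 = {(p, y)\<in>P \<times> Y. y \<in> W (cls p) \<and> z (p, y) \<notin> W (cls p)}"
    define Q3 where "Q3 = {(p, y)\<in>P \<times> Y. y \<notin> W (cls p)}"
    have Qfin: "finite Q1" "finite Q2" "finite Q3"
      unfolding Q1_def Q2_def Q3_def
      by (rule finite_subset[of _ "P \<times> Y"]; use P Y in auto)+
    have inj1: "inj_on (\<lambda>(p, y). (p, z (p, y))) Q1"
      by (rule inj_onI) (use z_inv Y in \<open>auto simp: Q1_def, metis subsetD\<close>)
    \<comment> \<open>Two different p at the same y would be in one class, and \<open>sep\<close>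
      applied to \<open>z (p', y)\<close> would put \<open>z (p, y)\<close> back into the
      set.\<close>
    have inj2: "inj_on snd Q2"
    proof (rule inj_onI)
      fix q q' assume *: "q \<in> Q2" "q' \<in> Q2" "snd q = snd q'"
      obtain p y p' where q: "q = (p, y)" "q' = (p', y)"
        using * by (metis prod.collapse)
      have pq: "p \<in> P" "p' \<in> P" "y \<in> carrier G" "y \<in> W (cls p)" "y \<in> W (cls p')" "z (p, y) \<notin> W (cls p)"
          "z (p', y) \<notin> W (cls p')"
        using * Y unfolding q by (auto simp: Q2_def)
      then have c: "cls p = cls p'"
        using disj by blast
      have "p = p'"
      proof (rule ccontr)
        assume "p \<noteq> p'"
        then have "inv (g p) \<otimes> (g p' \<otimes> z (p', y)) \<in> W (cls p)"
          using pq c by (intro sep z_carr) auto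
        then show False
          using pq z_inv[of p' y] by (simp add: z_def)
      qed
      then show "q = q'" by (simp add: q)
    qed
    \<comment> \<open>The mirror image for columns: \<open>sep'\<close> applied to y' would force y
      into the set.\<close>
    have inj3: "inj_on z Q3"
    proof (rule inj_onI)
      fix q q' assume *: "q \<in> Q3" "q' \<in> Q3" "z q = z q'"
      obtain p y p' y' where q: "q = (p, y)" "q' = (p', y')"
        by (metis prod.collapse)
      have pq: "p \<in> P" "p' \<in> P" "y \<in> carrier G" "y \<notin> W (cls p)" "y' \<in> carrier G" "y' \<notin> W (cls p')"
          "z (p, y) = z (p', y')"
        using * Y unfolding q by (auto simp: Q3_def)
      then have "z (p, y) \<in> W (cls p)" "z (p, y) \<in> W (cls p')"
        using into'[of p y] into'[of p' y'] by (auto simp: z_def)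
      then have c: "cls p = cls p'"
        using disj by blast
      have "p = p'"
      proof (rule ccontr)
        assume "p \<noteq> p'"
        then have "g p \<otimes> (inv (g p') \<otimes> y') \<in> W (cls p)"
          using pq c by (intro sep') auto
        then show False
          using pq z_inv[of p y] by (simp add: z_def)
      qed
      moreover have "y = g p \<otimes> z (p, y)" "y' = g p' \<otimes> z (p', y')"
        using pq z_inv by metis+
      ultimately show "q = q'"
        unfolding q using pq(7) by metis
    qed
    \<comment> \<open>Each |a p| is split into two square roots, so that both Cauchy-Schwarz factors
      are weighted sums as above.\<close>
    have 1: "(\<Sum>q\<in>Q1. t q) \<le> (sqrt B * ?N) * (sqrt B * ?M)"
    proof -
      have "(\<Sum>q\<in>Q1. cmod (a (fst q)) * (cmod (\<xi> (z q)))\<^sup>2)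
          = (\<Sum>(p, y)\<in>(\<lambda>(p, y). (p, z (p, y))) ` Q1. cmod (a p) * (cmod (\<xi> y))\<^sup>2)"
        by (rule sym, rule sum.reindex_cong[OF inj1 refl]) auto
      also have "\<dots> \<le> B * ?N\<^sup>2"
        by (rule weighted[OF _ _ _ \<xi>]) (use Qfin z_carr Y in \<open>auto simp: Q1_def subset_iff\<close>)
      finally have u: "(\<Sum>q\<in>Q1. (sqrt (cmod (a (fst q))) * cmod (\<xi> (z q)))\<^sup>2) \<le> (sqrt B * ?N)\<^sup>2"
        using B0 by (simp add: power_mult_distrib)
      have "(\<Sum>(p, y)\<in>Q1. cmod (a p) * (cmod (\<eta> y))\<^sup>2) \<le> B * ?M\<^sup>2"
        by (rule weighted[OF _ _ _ \<eta>]) (use Qfin Y in \<open>auto simp: Q1_def subset_iff\<close>)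
      then have v: "(\<Sum>q\<in>Q1. (sqrt (cmod (a (fst q))) * cmod (\<eta> (snd q)))\<^sup>2) \<le> (sqrt B * ?M)\<^sup>2"
        using B0 by (simp add: power_mult_distrib case_prod_unfold)
      have "(\<Sum>q\<in>Q1. (sqrt (cmod (a (fst q))) * cmod (\<xi> (z q))) * (sqrt (cmod (a (fst q))) * cmod (\<eta> (snd q))))
          \<le> (sqrt B * ?N) * (sqrt B * ?M)"
        using B0 by (intro CS[OF u v]) auto
      moreover have "t q = (sqrt (cmod (a (fst q))) * cmod (\<xi> (z q))) * (sqrt (cmod (a (fst q))) * cmod (\<eta> (snd q)))" for q
        by (cases q) (simp add: t_def)
      ultimately show ?thesis by simp
    qed
    \<comment> \<open>Each y occurs at most once, so \<eta> contributes at most its norm; the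
      coefficients go with \<xi> and contribute D. On \<open>Q3\<close> the two roles are
      exchanged.\<close>
    have 2: "(\<Sum>q\<in>Q2. t q) \<le> (D * ?N) * ?M"
    proof -
      have "(\<Sum>q\<in>Q2. (cmod (a (fst q)) * cmod (\<xi> (z q)))\<^sup>2) \<le> (\<Sum>q\<in>P \<times> Y. (cmod (a (fst q)) * cmod (\<xi> (z q)))\<^sup>2)"
        using P Y by (intro sum_mono2) (auto simp: Q2_def)
      also have "\<dots> = (\<Sum>p\<in>P. (cmod (a p))\<^sup>2 * (\<Sum>y\<in>Y. (cmod (\<xi> (inv (g p) \<otimes> y)))\<^sup>2))"
        by (simp add: sum.cartesian_product' z_def sum_distrib_left power_mult_distrib)
      also have "\<dots> \<le> (\<Sum>p\<in>P. (cmod (a p))\<^sup>2 * ?N\<^sup>2)"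
        using Y g \<xi> by (intro sum_mono mult_left_mono sum_translate_le_l2_norm) auto
      also have "\<dots> \<le> (D * ?N)\<^sup>2"
        unfolding sum_distrib_right[symmetric] power_mult_distrib using D by (intro mult_right_mono) auto
      finally have u: "(\<Sum>q\<in>Q2. (cmod (a (fst q)) * cmod (\<xi> (z q)))\<^sup>2) \<le> (D * ?N)\<^sup>2" .
      have "(\<Sum>q\<in>Q2. (cmod (\<eta> (snd q)))\<^sup>2) = (\<Sum>y\<in>snd ` Q2. (cmod (\<eta> y))\<^sup>2)"
        by (simp add: sum.reindex[OF inj2])
      also have "\<dots> \<le> ?M\<^sup>2"
        by (rule sum_le_l2_norm_power2[OF \<eta>]) (use Qfin Y in \<open>auto simp: Q2_def\<close>)
      finally have v: "(\<Sum>q\<in>Q2. (cmod (\<eta> (snd q)))\<^sup>2) \<le> ?M\<^sup>2" .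
      have "(\<Sum>q\<in>Q2. (cmod (a (fst q)) * cmod (\<xi> (z q))) * cmod (\<eta> (snd q))) \<le> (D * ?N) * ?M"
        using D0 by (intro CS[OF u v]) auto
      moreover have "t q = (cmod (a (fst q)) * cmod (\<xi> (z q))) * cmod (\<eta> (snd q))" for q
        by (cases q) (simp add: t_def)
      ultimately show ?thesis by simp
    qed
    have 3: "(\<Sum>q\<in>Q3. t q) \<le> ?N * (D * ?M)"
    proof -
      have "(\<Sum>q\<in>Q3. (cmod (a (fst q)) * cmod (\<eta> (snd q)))\<^sup>2) \<le> (\<Sum>q\<in>P \<times> Y. (cmod (a (fst q)) * cmod (\<eta> (snd q)))\<^sup>2)"
        using P Y by (intro sum_mono2) (auto simp: Q3_def)
      also have "\<dots> = (\<Sum>p\<in>P. (cmod (a p))\<^sup>2 * (\<Sum>y\<in>Y. (cmod (\<eta> y))\<^sup>2))"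
        by (simp add: sum.cartesian_product' sum_distrib_left power_mult_distrib)
      also have "\<dots> \<le> (\<Sum>p\<in>P. (cmod (a p))\<^sup>2 * ?M\<^sup>2)"
        using Y \<eta> by (intro sum_mono mult_left_mono sum_le_l2_norm_power2) auto
      also have "\<dots> \<le> (D * ?M)\<^sup>2"
        unfolding sum_distrib_right[symmetric] power_mult_distrib using D by (intro mult_right_mono) auto
      finally have v: "(\<Sum>q\<in>Q3. (cmod (a (fst q)) * cmod (\<eta> (snd q)))\<^sup>2) \<le> (D * ?M)\<^sup>2" .
      have "(\<Sum>q\<in>Q3. (cmod (\<xi> (z q)))\<^sup>2) = (\<Sum>y\<in>z ` Q3. (cmod (\<xi> y))\<^sup>2)"
        by (simp add: sum.reindex[OF inj3])
      also have "\<dots> \<le> ?N\<^sup>2"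
        by (rule sum_le_l2_norm_power2[OF \<xi>]) (use Qfin Y z_carr in \<open>auto simp: Q3_def\<close>)
      finally have u: "(\<Sum>q\<in>Q3. (cmod (\<xi> (z q)))\<^sup>2) \<le> ?N\<^sup>2" .
      have "(\<Sum>q\<in>Q3. cmod (\<xi> (z q)) * (cmod (a (fst q)) * cmod (\<eta> (snd q)))) \<le> ?N * (D * ?M)"
        using D0 by (intro CS[OF u v]) auto
      moreover have "t q = cmod (\<xi> (z q)) * (cmod (a (fst q)) * cmod (\<eta> (snd q)))" for q
        by (cases q) (simp add: t_def)
      ultimately show ?thesis by simp
    qed
    have split: "P \<times> Y = Q1 \<union> (Q2 \<union> Q3)" "Q1 \<inter> (Q2 \<union> Q3) = {}" "Q2 \<inter> Q3 = {}"
      by (auto simp: Q1_def Q2_def Q3_def)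
    have "(\<Sum>q\<in>P \<times> Y. t q) = (\<Sum>q\<in>Q1. t q) + ((\<Sum>q\<in>Q2. t q) + (\<Sum>q\<in>Q3. t q))"
      unfolding split(1) using Qfin split(2,3) by (simp add: sum.union_disjoint)
    also have "\<dots> \<le> (sqrt B * ?N) * (sqrt B * ?M) + ((D * ?N) * ?M + ?N * (D * ?M))"
      by (intro add_mono 1 2 3)
    also have "(sqrt B * ?N) * (sqrt B * ?M) = (sqrt B * sqrt B) * (?N * ?M)"
      by (simp only: ac_simps)
    also have "\<dots> + ((D * ?N) * ?M + ?N * (D * ?M)) = K"
      using B0 by (simp add: K_def algebra_simps)
    finally show ?thesis .
  qed
  define h where "h = (\<lambda>y. \<Sum>p\<in>P. a p * (\<xi> (inv (g p) \<otimes> y) * cnj (\<eta> y)))"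
  have hs: "(h has_sum (\<Sum>p\<in>P. a p * coef G \<xi> \<eta> (g p))) (carrier G)"
    unfolding h_def by (intro has_sum_finite_sum P has_sum_cmult_right coef_has_sum \<xi> \<eta> g)
  have hb: "(\<Sum>y\<in>Y. cmod (h y)) \<le> K" if Y: "finite Y" "Y \<subseteq> carrier G" for Y
  proof -
    have "(\<Sum>y\<in>Y. cmod (h y)) \<le> (\<Sum>y\<in>Y. \<Sum>p\<in>P. t (p, y))"
      unfolding h_def by (intro sum_mono sum_norm_le) (simp add: t_def z_def norm_mult)
    also have "\<dots> = (\<Sum>q\<in>P \<times> Y. t q)"
      by (subst sum.swap) (simp add: sum.cartesian_product')
    finally show ?thesis
      using fin[OF Y] by linarith
  qed
  have abs: "(\<lambda>y. cmod (h y)) summable_on carrier G"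
    by (rule nonneg_bdd_above_summable_on) (auto intro!: bdd_aboveI2 hb)
  have "cmod (infsum h (carrier G)) \<le> infsum (\<lambda>y. cmod (h y)) (carrier G)"
    by (rule norm_infsum_bound[OF abs])
  also have "\<dots> \<le> K"
    by (rule infsum_le_finite_sums[OF abs hb])
  finally show ?thesis
    using hs by (simp add: has_sum_iff K_def)
qed

end

section \<open>Toeplitz forms and symbols of functions on a cyclic subgroup\<close>

lemma sum_roots_of_unity:
  fixes m :: int
  assumes "\<bar>m\<bar> < int R"
  shows "(\<Sum>r<R. cis (2 * pi * real r / real R) powi m) = (if m = 0 then of_nat R else 0)"
proof -
  have R: "R > 0" using assms by (cases R) auto
  define w where "w = cis (2 * pi * of_int m / real R)"
  have p: "cis (2 * pi * real r / real R) powi m = w ^ r" for r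
    by (simp add: w_def cis_power_int Complex.DeMoivre mult_ac)
  have "(\<Sum>r<R. w ^ r) = 0" if "m \<noteq> 0"
  proof -
    have "w \<noteq> 1"
    proof
      assume "w = 1"
      then have "cos (2 * pi * of_int m / real R) = 1"
        by (simp add: w_def complex_eq_iff)
      then obtain n :: int where "2 * pi * of_int m / real R = of_int n * 2 * pi"
        by (auto simp: cos_one_2pi_int)
      then have "real_of_int m = real_of_int (n * int R)"
        using R by (simp add: field_simps)
      then have m: "m = n * int R"
        by (simp only: of_int_eq_iff)
      with that have "1 \<le> \<bar>n\<bar>"
        by (cases "n = 0") auto
      then have "1 * int R \<le> \<bar>n\<bar> * int R"
        by (intro mult_right_mono) auto
      then show False
        using assms by (simp add: m abs_mult)
    qed
    moreover have "w ^ R = 1"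
      using R by (simp add: w_def Complex.DeMoivre)
    ultimately show ?thesis
      by (simp add: geometric_sum)
  qed
  then show ?thesis
    by (cases "m = 0") (simp_all add: p w_def)
qed

text \<open>Since j, l < N, the exponent k + j - l stays below R in modulus. Orthogonality of the
  R-th roots of unity therefore sees no wrap-around and selects exactly l = j + k.\<close>

lemma dft_convolution:
  fixes a :: "int \<Rightarrow> complex" and \<alpha> \<beta> :: "nat \<Rightarrow> complex"
  assumes K: "finite K" "\<And>k. k \<in> K \<Longrightarrow> \<bar>k\<bar> + int N \<le> int R" and R: "R > 0"
  defines "w \<equiv> \<lambda>r. cis (2 * pi * real r / real R)"
  shows "(\<Sum>r<R. (\<Sum>k\<in>K. a k * w r powi k) * (\<Sum>j<N. \<alpha> j * w r ^ j) * cnj (\<Sum>l<N. \<beta> l * w r ^ l)) =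
    of_nat R * (\<Sum>k\<in>K. a k * (\<Sum>j<N. \<Sum>l<N. if int l = int j + k then \<alpha> j * cnj (\<beta> l) else 0))"
proof -
  have mon: "w r powi k * w r ^ j * cnj (w r ^ l) = w r powi (k + int j - int l)" for r k j l
  proof -
    obtain t where t: "w r = cis t" by (simp add: w_def)
    show ?thesis
      by (simp add: t cis_cnj cis_power_int Complex.DeMoivre cis_mult algebra_simps)
  qed
  have "(\<Sum>r<R. (\<Sum>k\<in>K. a k * w r powi k) * (\<Sum>j<N. \<alpha> j * w r ^ j) * cnj (\<Sum>l<N. \<beta> l * w r ^ l))
      = (\<Sum>r<R. \<Sum>k\<in>K. \<Sum>j<N. \<Sum>l<N. a k * \<alpha> j * cnj (\<beta> l) * w r powi (k + int j - int l))"
  proof (rule sum.cong[OF refl])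
    fix r
    have "(\<Sum>k\<in>K. a k * w r powi k) * (\<Sum>j<N. \<alpha> j * w r ^ j) * cnj (\<Sum>l<N. \<beta> l * w r ^ l) =
        (\<Sum>k\<in>K. \<Sum>j<N. (a k * w r powi k) * (\<alpha> j * w r ^ j)) * (\<Sum>l<N. cnj (\<beta> l * w r ^ l))"
      by (simp only: sum_product cnj_sum)
    also have "\<dots> = (\<Sum>k\<in>K. \<Sum>j<N. (a k * w r powi k) * (\<alpha> j * w r ^ j) * (\<Sum>l<N. cnj (\<beta> l * w r ^ l)))"
      by (simp only: sum_distrib_right)
    also have "\<dots> = (\<Sum>k\<in>K. \<Sum>j<N. \<Sum>l<N. (a k * w r powi k) * (\<alpha> j * w r ^ j) * cnj (\<beta> l * w r ^ l))"
      by (simp only: sum_distrib_left)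
    also have "\<dots> = (\<Sum>k\<in>K. \<Sum>j<N. \<Sum>l<N. a k * \<alpha> j * cnj (\<beta> l) * w r powi (k + int j - int l))"
      unfolding mon[symmetric] by (intro sum.cong refl) simp
    finally show "(\<Sum>k\<in>K. a k * w r powi k) * (\<Sum>j<N. \<alpha> j * w r ^ j) * cnj (\<Sum>l<N. \<beta> l * w r ^ l) =
        (\<Sum>k\<in>K. \<Sum>j<N. \<Sum>l<N. a k * \<alpha> j * cnj (\<beta> l) * w r powi (k + int j - int l))" .
  qed
  also have "\<dots> = (\<Sum>k\<in>K. \<Sum>j<N. \<Sum>l<N. \<Sum>r<R. a k * \<alpha> j * cnj (\<beta> l) * w r powi (k + int j - int l))"
    by (simp only: sum.swap[where A = "{..<R}" and B = K] sum.swap[where A = "{..<R}" and B = "{..<N}"])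
  also have "\<dots> = (\<Sum>k\<in>K. \<Sum>j<N. \<Sum>l<N. a k * \<alpha> j * cnj (\<beta> l) *
      (if k + int j - int l = 0 then of_nat R else 0))"
    unfolding sum_distrib_left[symmetric] w_def
    by (intro sum.cong refl arg_cong2[where f = "(*)"] sum_roots_of_unity) (use K(2) in fastforce)
  also have "\<dots> = of_nat R * (\<Sum>k\<in>K. a k * (\<Sum>j<N. \<Sum>l<N. if int l = int j + k then \<alpha> j * cnj (\<beta> l) else 0))"
    by (auto simp: sum_distrib_left intro!: sum.cong)
  finally show ?thesis .
qed

lemma dft_parseval:
  fixes \<alpha> :: "nat \<Rightarrow> complex"
  assumes "N \<le> R" "R > 0"
  shows "(\<Sum>r<R. (cmod (\<Sum>j<N. \<alpha> j * cis (2 * pi * real r / real R) ^ j))\<^sup>2) = real R * (\<Sum>j<N. (cmod (\<alpha> j))\<^sup>2)"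
proof -
  have "complex_of_real (\<Sum>r<R. (cmod (\<Sum>j<N. \<alpha> j * cis (2 * pi * real r / real R) ^ j))\<^sup>2) =
      (\<Sum>r<R. (\<Sum>j<N. \<alpha> j * cis (2 * pi * real r / real R) ^ j) * cnj (\<Sum>j<N. \<alpha> j * cis (2 * pi * real r / real R) ^ j))"
    by (simp only: of_real_sum complex_norm_square)
  also have "\<dots> = of_nat R * (\<Sum>j<N. \<Sum>l<N. if l = j then \<alpha> j * cnj (\<alpha> l) else 0)"
    using dft_convolution[of "{0}" N R "\<lambda>_. 1" \<alpha> \<alpha>] assms by simp
  also have "\<dots> = complex_of_real (real R * (\<Sum>j<N. (cmod (\<alpha> j))\<^sup>2))"
    by (simp add: of_real_sum complex_norm_square del: of_real_power)
  finally show ?thesis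
    unfolding of_real_eq_iff .
qed

text \<open>The form is an average over R-th roots of unity of the symbol times two trigonometric
  polynomials; the symbol is bounded by C at each root, and Cauchy-Schwarz with Parseval does the
  rest.\<close>

lemma toeplitz_bound:
  fixes a :: "int \<Rightarrow> complex" and \<alpha> \<beta> :: "nat \<Rightarrow> complex"
  assumes K: "finite K" and C: "\<And>z. cmod z = 1 \<Longrightarrow> cmod (\<Sum>k\<in>K. a k * z powi k) \<le> C"
  shows "cmod (\<Sum>k\<in>K. a k * (\<Sum>j<N. \<Sum>l<N. if int l = int j + k then \<alpha> j * cnj (\<beta> l) else 0))
    \<le> C * (sqrt (\<Sum>j<N. (cmod (\<alpha> j))\<^sup>2) * sqrt (\<Sum>l<N. (cmod (\<beta> l))\<^sup>2))"
proof -
  define S where "S = (\<Sum>k\<in>K. nat \<bar>k\<bar>)"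
  \<comment> \<open>S dominates every |k|, so no wrap-around occurs; the summand 1 keeps R
    positive.\<close>
  define R where "R = N + S + 1"
  define w where "w = (\<lambda>r. cis (2 * pi * real r / real R))"
  define A where "A = (\<lambda>r. \<Sum>j<N. \<alpha> j * w r ^ j)"
  define B where "B = (\<lambda>r. \<Sum>j<N. \<beta> j * w r ^ j)"
  have R: "R > 0" "N \<le> R" by (simp_all add: R_def)
  have KR: "\<bar>k\<bar> + int N \<le> int R" if "k \<in> K" for k
  proof -
    have "nat \<bar>k\<bar> \<le> S"
      unfolding S_def using K that by (intro member_le_sum) auto
    then show ?thesis by (simp add: R_def)
  qed
  have C0: "C \<ge> 0"
    using order_trans[OF norm_ge_zero C[of 1]] by simp
  let ?S = "\<Sum>k\<in>K. a k * (\<Sum>j<N. \<Sum>l<N. if int l = int j + k then \<alpha> j * cnj (\<beta> l) else 0)"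
  have "real R * cmod ?S = cmod (\<Sum>r<R. (\<Sum>k\<in>K. a k * w r powi k) * A r * cnj (B r))"
    unfolding A_def B_def w_def by (subst dft_convolution[OF K KR R(1)]) (simp_all add: norm_mult)
  also have "\<dots> \<le> (\<Sum>r<R. C * (\<bar>cmod (A r)\<bar> * \<bar>cmod (B r)\<bar>))"
  proof (rule sum_norm_le)
    fix r
    show "cmod ((\<Sum>k\<in>K. a k * w r powi k) * A r * cnj (B r)) \<le> C * (\<bar>cmod (A r)\<bar> * \<bar>cmod (B r)\<bar>)"
      using C[of "w r"] by (simp add: norm_mult mult.assoc w_def mult_right_mono)
  qed
  also have "\<dots> = C * (\<Sum>r<R. \<bar>cmod (A r)\<bar> * \<bar>cmod (B r)\<bar>)"
    by (simp add: sum_distrib_left)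
  also have "\<dots> \<le> C * (L2_set (\<lambda>r. cmod (A r)) {..<R} * L2_set (\<lambda>r. cmod (B r)) {..<R})"
    by (intro mult_left_mono L2_set_mult_ineq C0)
  also have "\<dots> = real R * (C * (sqrt (\<Sum>j<N. (cmod (\<alpha> j))\<^sup>2) * sqrt (\<Sum>l<N. (cmod (\<beta> l))\<^sup>2)))"
    unfolding L2_set_def A_def B_def w_def dft_parseval[OF R(2,1)] by (simp add: real_sqrt_mult)
  finally show ?thesis
    using R by simp
qed

context group
begin

text \<open>
  Both sides of the Toeplitz bound, applied to the segments \<open>j \<mapsto> \<xi> (x\<^sup>jy)\<close> of length \<open>N\<close> of the
  orbits of \<open>x\<close>, are summed over \<open>y\<close>; the boundary effects vanish as \<open>N \<rightarrow> \<infinity>\<close>.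
\<close>

lemma cyclic_symbol_bound:
  fixes a :: "int \<Rightarrow> complex"
  assumes K: "finite K" and C: "\<And>z. cmod z = 1 \<Longrightarrow> cmod (\<Sum>k\<in>K. a k * z powi k) \<le> C"
    and x: "x \<in> carrier G" and \<xi>: "\<xi> \<in> l2 G" and \<eta>: "\<eta> \<in> l2 G"
  shows "cmod (\<Sum>k\<in>K. a k * coef G \<xi> \<eta> (x [^] k)) \<le> C * (l2_norm G \<xi> * l2_norm G \<eta>)"
proof -
  have C0: "C \<ge> 0"
    using order_trans[OF norm_ge_zero C[of 1]] by simp
  have tr: "left_regular G (inv (x [^] j)) \<zeta> \<in> l2 G"
      "l2_norm G (left_regular G (inv (x [^] j)) \<zeta>) = l2_norm G \<zeta>"
    if "\<zeta> \<in> l2 G" for \<zeta> and j :: nat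
    using left_regular_l2[of "inv (x [^] j)" \<zeta>] that x by auto
  \<comment> \<open>Substituting x^l y for y shows that the inner product of two shifted copies
    depends only on l - j.\<close>
  have trans: "((\<lambda>y. \<xi> (x [^] j \<otimes> y) * cnj (\<eta> (x [^] l \<otimes> y))) has_sum coef G \<xi> \<eta> (x [^] k)) (carrier G)"
    if "int l = int j + k" for j l :: nat and k
  proof -
    have b: "bij_betw (\<lambda>y. x [^] l \<otimes> y) (carrier G) (carrier G)"
      by (rule bij_betw_byWitness[where f' = "\<lambda>y. inv (x [^] l) \<otimes> y"])
         (use x in \<open>auto simp: m_assoc[symmetric]\<close>)
    have e: "inv (x [^] k) \<otimes> (x [^] l \<otimes> y) = x [^] j \<otimes> y" if y: "y \<in> carrier G" for y
    proof -
      have "x [^] l = x [^] k \<otimes> x [^] j"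
        using x \<open>int l = int j + k\<close>
        by (metis int_pow_int int_pow_mult add.commute)
      then show ?thesis
        using x y by (simp add: m_assoc[symmetric])
    qed
    have "((\<lambda>y. \<xi> (inv (x [^] k) \<otimes> (x [^] l \<otimes> y)) * cnj (\<eta> (x [^] l \<otimes> y))) has_sum coef G \<xi> \<eta> (x [^] k)) (carrier G)"
      using coef_has_sum[OF \<xi> \<eta>, of "x [^] k"] x
        has_sum_reindex_bij_betw[OF b, of "\<lambda>y. \<xi> (inv (x [^] k) \<otimes> y) * cnj (\<eta> y)" "coef G \<xi> \<eta> (x [^] k)"]
      by simp
    then show ?thesis
      by (rule has_sum_cong[THEN iffD1, rotated]) (simp add: e)
  qed
  \<comment> \<open>Length of the k-th diagonal of the N by N square, that is N - |k| cut off at 0;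
    divided by N it tends to 1, which removes the boundary effects.\<close>
  define cnt where "cnt = (\<lambda>N k. \<Sum>j<N. \<Sum>l<N. if int l = int j + k then 1 else (0::real))"
  have cnt_eq: "cnt N k = real (N - nat \<bar>k\<bar>)" for N k
  proof -
    have "cnt N k = (\<Sum>j<N. if 0 \<le> int j + k \<and> int j + k < int N then 1 else 0)"
      unfolding cnt_def
    proof (rule sum.cong)
      fix j
      have "(\<Sum>l<N. if int l = int j + k then 1 else (0::real)) = (\<Sum>l<N. if l = nat (int j + k) \<and> 0 \<le> int j + k then 1 else 0)"
        by (intro sum.cong) auto
      also have "\<dots> = (if 0 \<le> int j + k \<and> int j + k < int N then 1 else 0)"
        by (cases "0 \<le> int j + k") (auto simp: nat_less_iff)
      finally show "(\<Sum>l<N. if int l = int j + k then 1 else (0::real)) = \<dots>" .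
    qed simp
    also have "\<dots> = real (card {j\<in>{..<N}. 0 \<le> int j + k \<and> int j + k < int N})"
      by (simp add: sum.If_cases Int_def)
    also have "{j\<in>{..<N}. 0 \<le> int j + k \<and> int j + k < int N} = {nat (-k)..<N - nat k}"
      by auto
    also have "card \<dots> = N - nat \<bar>k\<bar>"
      by simp
    finally show ?thesis .
  qed
  have N: "cmod (\<Sum>k\<in>K. a k * (of_real (cnt N k) * coef G \<xi> \<eta> (x [^] k))) \<le> real N * (C * (l2_norm G \<xi> * l2_norm G \<eta>))" for N
  proof -
    define h where "h = (\<lambda>y. \<Sum>k\<in>K. a k * (\<Sum>j<N. \<Sum>l<N.
      if int l = int j + k then \<xi> (x [^] j \<otimes> y) * cnj (\<eta> (x [^] l \<otimes> y)) else 0))"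
    have "(h has_sum (\<Sum>k\<in>K. a k * (\<Sum>j<N. \<Sum>l<N. if int l = int j + k then coef G \<xi> \<eta> (x [^] k) else 0))) (carrier G)"
      unfolding h_def
      by (intro has_sum_finite_sum K has_sum_cmult_right finite_lessThan) (use trans in auto)
    also have "(\<Sum>k\<in>K. a k * (\<Sum>j<N. \<Sum>l<N. if int l = int j + k then coef G \<xi> \<eta> (x [^] k) else 0)) =
        (\<Sum>k\<in>K. a k * (of_real (cnt N k) * coef G \<xi> \<eta> (x [^] k)))"
      unfolding cnt_def by (auto simp: sum_distrib_right intro!: sum.cong arg_cong2[where f = "(*)"])
    finally have hs: "(h has_sum (\<Sum>k\<in>K. a k * (of_real (cnt N k) * coef G \<xi> \<eta> (x [^] k)))) (carrier G)" .
    have hb: "(\<Sum>y\<in>Y. cmod (h y)) \<le> real N * (C * (l2_norm G \<xi> * l2_norm G \<eta>))"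
      if Y: "finite Y" "Y \<subseteq> carrier G" for Y
    proof -
      let ?A = "\<lambda>y. sqrt (\<Sum>j<N. (cmod (\<xi> (x [^] j \<otimes> y)))\<^sup>2)"
      let ?B = "\<lambda>y. sqrt (\<Sum>j<N. (cmod (\<eta> (x [^] j \<otimes> y)))\<^sup>2)"
      have seg: "(\<Sum>y\<in>Y. (sqrt (\<Sum>j<N. (cmod (\<zeta> (x [^] j \<otimes> y)))\<^sup>2))\<^sup>2) \<le> real N * (l2_norm G \<zeta>)\<^sup>2"
        if \<zeta>: "\<zeta> \<in> l2 G" for \<zeta>
      proof -
        have "(\<Sum>y\<in>Y. (sqrt (\<Sum>j<N. (cmod (\<zeta> (x [^] j \<otimes> y)))\<^sup>2))\<^sup>2) = (\<Sum>y\<in>Y. \<Sum>j<N. (cmod (\<zeta> (x [^] j \<otimes> y)))\<^sup>2)"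
          by (intro sum.cong) (auto simp: sum_nonneg)
        also have "\<dots> = (\<Sum>j<N. \<Sum>y\<in>Y. (cmod (\<zeta> (x [^] j \<otimes> y)))\<^sup>2)"
          by (rule sum.swap)
        also have "\<dots> \<le> (\<Sum>j<N. (l2_norm G \<zeta>)\<^sup>2)"
        proof (rule sum_mono)
          fix j :: nat
          show "(\<Sum>y\<in>Y. (cmod (\<zeta> (x [^] j \<otimes> y)))\<^sup>2) \<le> (l2_norm G \<zeta>)\<^sup>2"
            using sum_translate_le_l2_norm[OF \<zeta>, of "inv (x [^] j)" Y] Y x by simp
        qed
        finally show ?thesis by simp
      qed
      have "(\<Sum>y\<in>Y. cmod (h y)) \<le> (\<Sum>y\<in>Y. C * (\<bar>?A y\<bar> * \<bar>?B y\<bar>))"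
      proof (rule sum_mono)
        fix y
        have eq: "\<bar>?A y\<bar> = ?A y" "\<bar>?B y\<bar> = ?B y"
          by (auto simp: sum_nonneg)
        show "cmod (h y) \<le> C * (\<bar>?A y\<bar> * \<bar>?B y\<bar>)"
          unfolding eq h_def by (rule toeplitz_bound[OF K C])
      qed
      also have "\<dots> = C * (\<Sum>y\<in>Y. \<bar>?A y\<bar> * \<bar>?B y\<bar>)"
        by (simp add: sum_distrib_left)
      also have "\<dots> \<le> C * (L2_set ?A Y * L2_set ?B Y)"
        by (intro mult_left_mono L2_set_mult_ineq C0)
      also have "\<dots> \<le> C * (sqrt (real N * (l2_norm G \<xi>)\<^sup>2) * sqrt (real N * (l2_norm G \<eta>)\<^sup>2))"
        unfolding L2_set_def
        by (intro mult_left_mono mult_mono real_sqrt_le_mono seg \<xi> \<eta> C0) (auto intro!: sum_nonneg)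
      also have "\<dots> = (sqrt (real N) * sqrt (real N)) * (C * (l2_norm G \<xi> * l2_norm G \<eta>))"
        by (simp only: real_sqrt_mult real_sqrt_abs abs_of_nonneg l2_norm_nonneg ac_simps)
      finally show ?thesis by simp
    qed
    have abs: "(\<lambda>y. cmod (h y)) summable_on carrier G"
      by (rule nonneg_bdd_above_summable_on) (auto intro!: bdd_aboveI2 hb)
    have "cmod (infsum h (carrier G)) \<le> infsum (\<lambda>y. cmod (h y)) (carrier G)"
      by (rule norm_infsum_bound[OF abs])
    also have "\<dots> \<le> real N * (C * (l2_norm G \<xi> * l2_norm G \<eta>))"
      by (rule infsum_le_finite_sums[OF abs hb])
    finally show ?thesis
      using hs by (simp add: has_sum_iff)
  qed
  have ev: "eventually (\<lambda>N. cmod (\<Sum>k\<in>K. a k * (of_real (cnt N k / real N) * coef G \<xi> \<eta> (x [^] k)))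
      \<le> C * (l2_norm G \<xi> * l2_norm G \<eta>)) sequentially"
    using eventually_gt_at_top[of 0]
  proof eventually_elim
    case (elim n)
    have "(\<Sum>k\<in>K. a k * (of_real (cnt n k / real n) * coef G \<xi> \<eta> (x [^] k))) =
        (\<Sum>k\<in>K. a k * (of_real (cnt n k) * coef G \<xi> \<eta> (x [^] k))) / of_nat n"
      by (simp add: sum_divide_distrib)
    with N[of n] elim show ?case
      by (simp add: norm_divide divide_le_eq mult_ac)
  qed
  have lim: "(\<lambda>N. cnt N k / real N) \<longlonglongrightarrow> 1" for k
  proof -
    have "(\<lambda>N. 1 - real (nat \<bar>k\<bar>) / real N) \<longlonglongrightarrow> 1 - 0"
      by (intro tendsto_intros lim_const_over_n)
    moreover have "eventually (\<lambda>N. 1 - real (nat \<bar>k\<bar>) / real N = cnt N k / real N) sequentially"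
      using eventually_gt_at_top[of "nat \<bar>k\<bar>"]
      by eventually_elim (simp add: cnt_eq of_nat_diff field_simps)
    ultimately show ?thesis
      by (simp add: filterlim_cong)
  qed
  have "(\<lambda>N. cmod (\<Sum>k\<in>K. a k * (of_real (cnt N k / real N) * coef G \<xi> \<eta> (x [^] k)))) \<longlonglongrightarrow>
      cmod (\<Sum>k\<in>K. a k * (of_real 1 * coef G \<xi> \<eta> (x [^] k)))"
    by (intro tendsto_intros lim)
  from tendsto_upperbound[OF this ev] show ?thesis
    by simp
qed

end

section \<open>Limits along an ultrafilter\<close>

text \<open>Zorn in the reversed order yields a minimal proper filter below F. If adding P leaves it
  proper, minimality shows that P already holds eventually; otherwise the negation of P
  does.\<close>

lemma ultrafilter_exists:
  fixes F :: "'a filter"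
  assumes "F \<noteq> bot"
  shows "\<exists>U\<le>F. U \<noteq> bot \<and> (\<forall>P. eventually P U \<or> eventually (\<lambda>x. \<not> P x) U)"
proof -
  define A where "A = {G. G \<le> F \<and> G \<noteq> bot}"
  let ?r = "\<lambda>G H :: 'a filter. H \<le> G"
  have "\<exists>U\<in>A. \<forall>G\<in>A. ?r U G \<longrightarrow> G = U"
  proof (rule predicate_Zorn)
    show "partial_order_on A (relation_of ?r A)"
      by (rule partial_order_on_relation_ofI) auto
  next
    fix C assume "C \<in> Chains (relation_of ?r A)"
    then have C: "C \<subseteq> A" "\<And>G H. G \<in> C \<Longrightarrow> H \<in> C \<Longrightarrow> G \<le> H \<or> H \<le> G"
      by (auto simp: Chains_def relation_of_def)
    show "\<exists>u\<in>A. \<forall>a\<in>C. ?r a u"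
    proof (cases "C = {}")
      case True
      then show ?thesis using assms by (auto simp: A_def)
    next
      case False
      then obtain G where G: "G \<in> C" by blast
      \<comment> \<open>A chain is directed, so eventuality in its infimum is decided by a single
        member, and the infimum stays proper.\<close>
      have "eventually P (Inf C) \<longleftrightarrow> (\<exists>b\<in>C. eventually P b)" for P
        using C by (intro eventually_Inf_base[OF False]) (metis le_inf_iff order_refl)
      then have "Inf C \<noteq> bot"
        using C(1) by (auto simp: trivial_limit_def A_def)
      moreover have "Inf C \<le> F"
        using C(1) G by (auto simp: A_def intro: Inf_lower2)
      ultimately show ?thesis
        by (auto simp: A_def intro!: bexI[of _ "Inf C"] Inf_lower)
    qed
  qed
  then obtain U where U: "U \<in> A" "\<And>G. G \<in> A \<Longrightarrow> G \<le> U \<Longrightarrow> G = U"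
    by blast
  have "eventually P U \<or> eventually (\<lambda>x. \<not> P x) U" for P
  proof (cases "inf U (principal {x. P x}) = bot")
    case True
    then show ?thesis
      by (simp add: trivial_limit_def eventually_inf_principal)
  next
    case False
    then have "inf U (principal {x. P x}) = U"
      using U by (intro U(2)) (auto simp: A_def le_infI1)
    moreover have "eventually P (inf U (principal {x. P x}))"
      by (simp add: eventually_inf_principal)
    ultimately show ?thesis by simp
  qed
  with U show ?thesis
    by (auto simp: A_def)
qed

text \<open>One ultrafilter, fixed once for all, chooses cluster points consistently: limits along
  it exist for all bounded sequences, are linear in the sequence, and agree with ordinary
  limits.\<close>

definition ultra :: "nat filter" where
  "ultra = (SOME U. U \<le> sequentially \<and> U \<noteq> bot \<and> (\<forall>P. eventually P U \<or> eventually (\<lambda>x. \<not> P x) U))"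

lemma ultra: "ultra \<le> sequentially" "ultra \<noteq> bot" "eventually P ultra \<or> eventually (\<lambda>x. \<not> P x) ultra"
  using someI_ex[OF ultrafilter_exists[OF sequentially_bot]] unfolding ultra_def by auto

text \<open>If no point of K were a limit, each would have a neighbourhood that the sequence
  eventually avoids, by the ultrafilter property; finitely many of these cover K.\<close>

lemma compactin_ultra_limit:
  assumes K: "compactin X K" and g: "\<And>n. g n \<in> K"
  shows "\<exists>l\<in>K. limitin X g l ultra"
proof (rule ccontr)
  assume "\<not> ?thesis"
  then have "\<forall>l\<in>K. \<exists>V. openin X V \<and> l \<in> V \<and> \<not> eventually (\<lambda>n. g n \<in> V) ultra"
    using compactin_subset_topspace[OF K] unfolding limitin_def by blast
  then obtain V where V: "\<And>l. l \<in> K \<Longrightarrow> openin X (V l)" "\<And>l. l \<in> K \<Longrightarrow> l \<in> V l"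
      "\<And>l. l \<in> K \<Longrightarrow> \<not> eventually (\<lambda>n. g n \<in> V l) ultra"
    by metis
  have "\<exists>\<F>. finite \<F> \<and> \<F> \<subseteq> V ` K \<and> K \<subseteq> \<Union>\<F>"
    using V(1,2) by (intro compactinD[OF K]) auto
  then obtain \<F> where F: "finite \<F>" "\<F> \<subseteq> V ` K" "K \<subseteq> \<Union>\<F>" by blast
  have "eventually (\<lambda>n. \<forall>W\<in>\<F>. g n \<notin> W) ultra"
  proof (rule eventually_ball_finite[OF F(1)], rule ballI)
    fix W assume "W \<in> \<F>"
    then have "\<not> eventually (\<lambda>n. g n \<in> W) ultra"
      using F(2) V(3) by auto
    with ultra(3)[of "\<lambda>n. g n \<in> W"] show "eventually (\<lambda>n. g n \<notin> W) ultra"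
      by blast
  qed
  moreover have "\<not> (\<forall>W\<in>\<F>. g n \<notin> W)" for n
    using F(3) g[of n] by auto
  ultimately show False
    using ultra(2) by (simp add: eventually_False)
qed

definition ulim :: "(nat \<Rightarrow> complex) \<Rightarrow> complex" where
  "ulim s = Lim ultra s"

lemma ulim_eq: "(s \<longlongrightarrow> l) ultra \<Longrightarrow> ulim s = l"
  unfolding ulim_def by (rule tendsto_Lim[OF ultra(2)])

lemma ulim_eq_sequentially: "s \<longlonglongrightarrow> l \<Longrightarrow> ulim s = l"
  by (rule ulim_eq) (rule filterlim_mono[OF _ order_refl ultra(1)])

lemma tendsto_ulim:
  assumes "\<And>n. cmod (s n) \<le> B"
  shows "(s \<longlongrightarrow> ulim s) ultra"
proof -
  have "compactin euclidean (cball (0::complex) B)"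
    by simp
  from compactin_ultra_limit[OF this, of s] assms obtain l where "(s \<longlongrightarrow> l) ultra"
    by auto
  then show ?thesis
    by (simp add: ulim_eq)
qed

lemma cmod_ulim_le:
  assumes "\<And>n. cmod (s n) \<le> B"
  shows "cmod (ulim s) \<le> B"
  by (rule tendsto_upperbound[OF tendsto_norm[OF tendsto_ulim[OF assms]] _ ultra(2)])
     (simp add: assms)

lemma ulim_add:
  assumes "\<And>n. cmod (s n) \<le> B" "\<And>n. cmod (t n) \<le> C"
  shows "ulim (\<lambda>n. s n + t n) = ulim s + ulim t"
  using assms by (intro ulim_eq tendsto_add tendsto_ulim)

lemma ulim_cmult:
  assumes "\<And>n. cmod (s n) \<le> B"
  shows "ulim (\<lambda>n. c * s n) = c * ulim s"
  using assms by (intro ulim_eq tendsto_mult_left tendsto_ulim)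

section \<open>Dual spaces\<close>

lemma dual_simps [simp]:
  "vadd (dual X) f g = (\<lambda>x. f x + g x)"
  "vscale (dual X) c f = (\<lambda>x. c * f x)"
  by (simp_all add: dual_def)

lemma dual_iff:
  "f \<in> carrier (dual X) \<longleftrightarrow>
    (\<forall>x\<in>carrier X. \<forall>y\<in>carrier X. f (vadd X x y) = f x + f y) \<and>
    (\<forall>c. \<forall>x\<in>carrier X. f (vscale X c x) = c * f x) \<and>
    (\<exists>C. \<forall>x\<in>carrier X. cmod (f x) \<le> C * vnorm X x) \<and>
    (\<forall>x. x \<notin> carrier X \<longrightarrow> f x = 0)"
  by (auto simp: dual_def bounded_clinear_map_def complex_space_def)

lemma dual_add: "f \<in> carrier (dual X) \<Longrightarrow> x \<in> carrier X \<Longrightarrow> y \<in> carrier X \<Longrightarrow> f (vadd X x y) = f x + f y"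
  and dual_scale: "f \<in> carrier (dual X) \<Longrightarrow> x \<in> carrier X \<Longrightarrow> f (vscale X c x) = c * f x"
  and dual_outside: "f \<in> carrier (dual X) \<Longrightarrow> x \<notin> carrier X \<Longrightarrow> f x = 0"
  by (auto simp: dual_iff)

lemma dual_obtain_bound:
  assumes "f \<in> carrier (dual X)"
  obtains C where "\<And>x. x \<in> carrier X \<Longrightarrow> cmod (f x) \<le> C * vnorm X x"
  using assms unfolding dual_iff by blast

lemma dual_closed_add:
  assumes "f \<in> carrier (dual X)" "g \<in> carrier (dual X)"
  shows "(\<lambda>x. f x + g x) \<in> carrier (dual X)"
proof -
  obtain C where C: "\<And>x. x \<in> carrier X \<Longrightarrow> cmod (f x) \<le> C * vnorm X x"
    using dual_obtain_bound[OF assms(1)] by blast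
  obtain D where D: "\<And>x. x \<in> carrier X \<Longrightarrow> cmod (g x) \<le> D * vnorm X x"
    using dual_obtain_bound[OF assms(2)] by blast
  have "cmod (f x + g x) \<le> (C + D) * vnorm X x" if "x \<in> carrier X" for x
    using norm_triangle_mono[OF C[OF that] D[OF that]] by (simp add: distrib_right)
  then have "\<exists>B. \<forall>x\<in>carrier X. cmod (f x + g x) \<le> B * vnorm X x"
    by blast
  with assms show ?thesis
    by (simp add: dual_iff algebra_simps)
qed

lemma dual_closed_scale:
  assumes "f \<in> carrier (dual X)"
  shows "(\<lambda>x. c * f x) \<in> carrier (dual X)"
proof -
  obtain C where C: "\<And>x. x \<in> carrier X \<Longrightarrow> cmod (f x) \<le> C * vnorm X x"
    using dual_obtain_bound[OF assms] by blast
  have "cmod (c * f x) \<le> (cmod c * C) * vnorm X x" if "x \<in> carrier X" for x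
    using C[OF that] by (simp add: norm_mult mult_left_mono mult.assoc)
  then have "\<exists>B. \<forall>x\<in>carrier X. cmod (c * f x) \<le> B * vnorm X x"
    by blast
  with assms show ?thesis
    by (simp add: dual_iff algebra_simps)
qed

lemma dual_closed_diff:
  "f \<in> carrier (dual X) \<Longrightarrow> g \<in> carrier (dual X) \<Longrightarrow> (\<lambda>x. f x - g x) \<in> carrier (dual X)"
  using dual_closed_add[OF _ dual_closed_scale[of g X "-1"], of f] by simp

text \<open>The records carry no axioms; these are the facts that make the supremum over the unit
  ball a bound for functionals. They pass to the dual (\<open>dual_cseminormed\<close>) and so to
  the bidual.\<close>

locale cseminormed =
  fixes X :: "('a, 'm) cnspace_scheme"
  assumes nonempty: "carrier X \<noteq> {}"
    and nonneg: "x \<in> carrier X \<Longrightarrow> 0 \<le> vnorm X x"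
    and scale_closed: "x \<in> carrier X \<Longrightarrow> vscale X c x \<in> carrier X"
    and scale_norm: "x \<in> carrier X \<Longrightarrow> vnorm X (vscale X c x) \<le> cmod c * vnorm X x"
begin

lemma ball_nonempty: "{x\<in>carrier X. vnorm X x \<le> 1} \<noteq> {}"
  using nonempty scale_closed[of _ 0] scale_norm[of _ 0] by fastforce

lemma dual_norm_le:
  assumes "\<And>x. x \<in> carrier X \<Longrightarrow> cmod (f x) \<le> C * vnorm X x" "C \<ge> 0"
  shows "vnorm (dual X) f \<le> C"
  unfolding dual_def cnspace.simps
proof (rule cSUP_least[OF ball_nonempty])
  fix x assume x: "x \<in> {x\<in>carrier X. vnorm X x \<le> 1}"
  then have "cmod (f x) \<le> C * vnorm X x" using assms by auto
  also have "\<dots> \<le> C * 1" using x assms by (intro mult_left_mono) auto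
  finally show "cmod (f x) \<le> C" by simp
qed

lemma dual_bdd_above:
  assumes "f \<in> carrier (dual X)"
  shows "bdd_above ((\<lambda>x. cmod (f x)) ` {x\<in>carrier X. vnorm X x \<le> 1})"
proof -
  obtain C where C: "\<And>x. x \<in> carrier X \<Longrightarrow> cmod (f x) \<le> C * vnorm X x"
    using dual_obtain_bound[OF assms] by blast
  show ?thesis
  proof (rule bdd_aboveI2)
    fix x assume x: "x \<in> {x\<in>carrier X. vnorm X x \<le> 1}"
    then have "cmod (f x) \<le> C * vnorm X x" using C by auto
    also have "\<dots> \<le> \<bar>C\<bar> * vnorm X x" using x nonneg by (intro mult_right_mono) auto
    also have "\<dots> \<le> \<bar>C\<bar> * 1" using x by (intro mult_left_mono) auto
    finally show "cmod (f x) \<le> \<bar>C\<bar>" by simp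
  qed
qed

lemma dual_norm_nonneg:
  assumes "f \<in> carrier (dual X)"
  shows "0 \<le> vnorm (dual X) f"
proof -
  obtain x where "x \<in> {x\<in>carrier X. vnorm X x \<le> 1}"
    using ball_nonempty by blast
  from cSUP_upper[OF this dual_bdd_above[OF assms]] show ?thesis
    unfolding dual_def cnspace.simps using norm_ge_zero order_trans by blast
qed

lemma dual_bound:
  assumes f: "f \<in> carrier (dual X)" and x: "x \<in> carrier X"
  shows "cmod (f x) \<le> vnorm (dual X) f * vnorm X x"
proof (cases "vnorm X x = 0")
  \<comment> \<open>A vector of norm 0 cannot be scaled to the unit sphere, but any boundedness
    constant shows that f vanishes there.\<close>
  case True
  moreover obtain C where "\<And>x. x \<in> carrier X \<Longrightarrow> cmod (f x) \<le> C * vnorm X x"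
    using dual_obtain_bound[OF f] by blast
  ultimately show ?thesis using x by (metis mult_zero_right)
next
  case False
  with nonneg[OF x] have pos: "vnorm X x > 0" by simp
  define c where "c = complex_of_real (inverse (vnorm X x))"
  have "vnorm X (vscale X c x) \<le> 1"
    using scale_norm[OF x, of c] pos by (simp add: c_def norm_inverse)
  then have "cmod (f (vscale X c x)) \<le> vnorm (dual X) f"
    unfolding dual_def cnspace.simps using x f
    by (intro cSUP_upper dual_bdd_above) (auto simp: scale_closed)
  then have "inverse (vnorm X x) * cmod (f x) \<le> vnorm (dual X) f"
    using pos by (simp add: dual_scale[OF f x] norm_mult c_def norm_inverse)
  then show ?thesis
    using pos by (simp add: field_simps)
qed

lemma dual_cseminormed: "cseminormed (dual X)"
proof
  show "carrier (dual X) \<noteq> {}"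
    by (rule ex_in_conv[THEN iffD1], rule exI[of _ "\<lambda>_. 0"]) (auto simp: dual_iff intro!: exI[of _ 0])
next
  fix f c assume f: "f \<in> carrier (dual X)"
  show "0 \<le> vnorm (dual X) f" by (rule dual_norm_nonneg[OF f])
  show "vscale (dual X) c f \<in> carrier (dual X)"
    using dual_closed_scale[OF f] by simp
  show "vnorm (dual X) (vscale (dual X) c f) \<le> cmod c * vnorm (dual X) f"
    using dual_bound[OF f] dual_norm_nonneg[OF f]
    by (intro dual_norm_le) (auto simp: norm_mult mult.assoc mult_left_mono)
qed

lemma dualI:
  assumes "\<And>x y. x \<in> carrier X \<Longrightarrow> y \<in> carrier X \<Longrightarrow> f (vadd X x y) = f x + f y"
    "\<And>c x. x \<in> carrier X \<Longrightarrow> f (vscale X c x) = c * f x"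
    "\<And>x. x \<in> carrier X \<Longrightarrow> cmod (f x) \<le> C * vnorm X x"
    "\<And>x. x \<notin> carrier X \<Longrightarrow> f x = 0"
  shows "f \<in> carrier (dual X)"
  using assms unfolding dual_iff by blast

lemma canonical_embedding_in_bidual:
  assumes "x \<in> carrier X"
  shows "canonical_embedding X x \<in> carrier (dual (dual X))"
proof (rule cseminormed.dualI[OF dual_cseminormed])
  fix f assume "f \<in> carrier (dual X)"
  then show "cmod (canonical_embedding X x f) \<le> vnorm X x * vnorm (dual X) f"
    using dual_bound[of f x] assms by (simp add: canonical_embedding_def mult.commute)
qed (auto simp: canonical_embedding_def dual_closed_add dual_closed_scale)

text \<open>For a bounded sequence \<phi> this is one of its weak* cluster points in the
  bidual.\<close>

definition ultra_functional :: "(nat \<Rightarrow> 'a) \<Rightarrow> ('a \<Rightarrow> complex) \<Rightarrow> complex" where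
  "ultra_functional \<phi> f = (if f \<in> carrier (dual X) then ulim (\<lambda>n. f (\<phi> n)) else 0)"

lemma ultra_functional_in_bidual:
  assumes \<phi>: "\<And>n. \<phi> n \<in> carrier X" "\<And>n. vnorm X (\<phi> n) \<le> C"
  shows "ultra_functional \<phi> \<in> carrier (dual (dual X))"
proof (rule cseminormed.dualI[OF dual_cseminormed, where C = C])
  have b: "cmod (f (\<phi> n)) \<le> C * vnorm (dual X) f" if "f \<in> carrier (dual X)" for f n
    using dual_bound[OF that \<phi>(1)[of n]] mult_left_mono[OF \<phi>(2)[of n] dual_norm_nonneg[OF that]]
    by (simp add: mult.commute)
  fix f assume f: "f \<in> carrier (dual X)"
  show "cmod (ultra_functional \<phi> f) \<le> C * vnorm (dual X) f"
    using cmod_ulim_le[OF b[OF f]] f by (simp add: ultra_functional_def)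
  show "ultra_functional \<phi> (vscale (dual X) c f) = c * ultra_functional \<phi> f" for c
    using ulim_cmult[OF b[OF f]] f by (simp add: ultra_functional_def dual_closed_scale)
  fix g assume g: "g \<in> carrier (dual X)"
  show "ultra_functional \<phi> (vadd (dual X) f g) = ultra_functional \<phi> f + ultra_functional \<phi> g"
    using ulim_add[OF b[OF f] b[OF g]] f g by (simp add: ultra_functional_def dual_closed_add)
qed (simp add: ultra_functional_def)

section \<open>The weak topology of a dual space\<close>

abbreviation weak_dual :: "('a \<Rightarrow> complex) topology" where
  "weak_dual \<equiv> weak_topology (dual X)"

lemma openin_weak_dual:
  assumes "\<nu> \<in> carrier (dual (dual X))" "open V"
  shows "openin weak_dual {f\<in>carrier (dual X). \<nu> f \<in> V}"
  unfolding weak_topology_def by (rule topology_generated_by_Basis) (use assms in blast)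

lemma topspace_weak_dual: "topspace weak_dual = carrier (dual X)"
proof
  show "topspace weak_dual \<subseteq> carrier (dual X)"
    unfolding weak_topology_def topology_generated_by_topspace by blast
  obtain x where "x \<in> carrier X" using nonempty by blast
  from openin_subset[OF openin_weak_dual[OF canonical_embedding_in_bidual[OF this] open_UNIV]]
  show "carrier (dual X) \<subseteq> topspace weak_dual" by simp
qed

lemma continuous_map_weak_dual:
  assumes "\<nu> \<in> carrier (dual (dual X))"
  shows "continuous_map weak_dual euclidean \<nu>"
  using openin_weak_dual[OF assms] by (auto simp: continuous_map topspace_weak_dual open_openin[symmetric])

lemma limitin_weak_dual:
  assumes "limitin weak_dual g l F" "\<nu> \<in> carrier (dual (dual X))"
  shows "((\<lambda>n. \<nu> (g n)) \<longlongrightarrow> \<nu> l) F"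
  using continuous_map_limit[OF continuous_map_weak_dual[OF assms(2)] assms(1)]
  by (simp add: comp_def)

lemma Hausdorff_weak_dual: "Hausdorff_space weak_dual"
  unfolding Hausdorff_space_def topspace_weak_dual
proof (intro allI impI)
  fix f g assume fg: "f \<in> carrier (dual X) \<and> g \<in> carrier (dual X) \<and> f \<noteq> g"
  then obtain x where x: "f x \<noteq> g x" by auto
  with fg have xX: "x \<in> carrier X" by (metis dual_outside)
  let ?\<nu> = "canonical_embedding X x"
  obtain U V where UV: "open U" "open V" "f x \<in> U" "g x \<in> V" "U \<inter> V = {}"
    using hausdorff[OF x] by blast
  show "\<exists>U V. openin weak_dual U \<and> openin weak_dual V \<and> f \<in> U \<and> g \<in> V \<and> disjnt U V"
    using UV fg openin_weak_dual[OF canonical_embedding_in_bidual[OF xX]]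
    by (intro exI[of _ "{f\<in>carrier (dual X). ?\<nu> f \<in> U}"] exI[of _ "{f\<in>carrier (dual X). ?\<nu> f \<in> V}"])
       (auto simp: canonical_embedding_def disjnt_def)
qed

text \<open>It suffices to test the generators of the topology, and a functional \<nu> turns the
  combination into \<open>c * \<nu> f + d * \<nu> g\<close>, which is continuous on the
  product.\<close>

lemma continuous_map_lincomb:
  "continuous_map (prod_topology weak_dual weak_dual) weak_dual
    (\<lambda>(f, g) x. c * f x + d * g x)"
proof -
  let ?h = "\<lambda>(f, g) x. c * f x + d * g x"
  let ?P = "prod_topology weak_dual weak_dual"
  let ?B = "{{x \<in> carrier (dual X). f x \<in> U} |f U. f \<in> carrier (dual (dual X)) \<and> open U}"
  let ?Q = "prod_topology (topology_generated_by ?B) (topology_generated_by ?B)"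
  have h: "?h p \<in> carrier (dual X)" if "p \<in> topspace ?P" for p
    using that by (auto simp: topspace_weak_dual dual_closed_add dual_closed_scale)
  show ?thesis
    unfolding weak_topology_def[of "dual X"]
  proof (rule continuous_on_generated_topo)
    fix S assume "S \<in> ?B"
    then obtain \<nu> V where S: "S = {f\<in>carrier (dual X). \<nu> f \<in> V}" and \<nu>: "\<nu> \<in> carrier (dual (dual X))"
      and V: "open V" by blast
    have "continuous_map ?P euclidean (\<lambda>p. c * \<nu> (fst p) + d * \<nu> (snd p))"
      using continuous_map_compose[OF continuous_map_fst continuous_map_weak_dual[OF dual_closed_scale[OF \<nu>, of c]], of weak_dual]
        continuous_map_compose[OF continuous_map_snd continuous_map_weak_dual[OF dual_closed_scale[OF \<nu>, of d]], of weak_dual]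
      by (intro continuous_map_add) (simp_all add: comp_def)
    then have "openin ?P {p \<in> topspace ?P. c * \<nu> (fst p) + d * \<nu> (snd p) \<in> V}"
      by (rule openin_continuous_map_preimage) (simp add: V)
    moreover have "\<nu> (?h p) = c * \<nu> (fst p) + d * \<nu> (snd p)" if "p \<in> topspace ?P" for p
      using that dual_add[OF \<nu>, of "\<lambda>x. c * fst p x" "\<lambda>x. d * snd p x"] dual_scale[OF \<nu>, of "fst p" c]
        dual_scale[OF \<nu>, of "snd p" d]
      by (auto simp: topspace_weak_dual dual_closed_scale case_prod_unfold)
    then have "?h -` S \<inter> topspace ?P = {p \<in> topspace ?P. c * \<nu> (fst p) + d * \<nu> (snd p) \<in> V}"
      using h by (auto simp: S)
    ultimately show "openin ?Q (?h -` S \<inter> topspace ?Q)"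
      by (simp add: weak_topology_def)
  next
    show "?h ` topspace ?Q \<subseteq> \<Union>?B"
      using h topspace_weak_dual
      unfolding weak_topology_def topology_generated_by_topspace by blast
  qed
qed

text \<open>The combinations of the two weak closures form a continuous image of a compact product.
  By the Hausdorff property it is closed, so it also contains the closure of R.\<close>

lemma relatively_weakly_compact_lincomb:
  assumes "relatively_weakly_compact (dual X) S" "relatively_weakly_compact (dual X) T"
    and R: "R \<subseteq> (\<lambda>(f, g) x. c * f x + d * g x) ` (S \<times> T)"
  shows "relatively_weakly_compact (dual X) R"
proof -
  let ?h = "\<lambda>(f, g) x. c * f x + d * g x"
  let ?K = "?h ` ((weak_dual closure_of S) \<times> (weak_dual closure_of T))"
  have ST: "S \<subseteq> carrier (dual X)" "T \<subseteq> carrier (dual X)"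
      "compactin weak_dual (weak_dual closure_of S)" "compactin weak_dual (weak_dual closure_of T)"
    using assms by (auto simp: relatively_weakly_compact_def)
  have K: "compactin weak_dual ?K"
    by (intro image_compactin[OF _ continuous_map_lincomb]) (simp add: compactin_Times ST)
  have "S \<times> T \<subseteq> (weak_dual closure_of S) \<times> (weak_dual closure_of T)"
    using ST by (intro Sigma_mono closure_of_subset) (auto simp: topspace_weak_dual)
  then have RK: "R \<subseteq> ?K"
    using R by blast
  then have "weak_dual closure_of R \<subseteq> ?K"
    by (rule closure_of_minimal) (rule compactin_imp_closedin[OF Hausdorff_weak_dual K])
  then have "compactin weak_dual (weak_dual closure_of R)"
    by (rule closed_compactin[OF K]) simp
  moreover have "R \<subseteq> carrier (dual X)"
    using RK compactin_subset_topspace[OF K] by (auto simp: topspace_weak_dual)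
  ultimately show ?thesis
    by (simp add: relatively_weakly_compact_def)
qed

end

section \<open>Weakly almost periodic functionals\<close>

locale cseminormed_algebra = cseminormed A for A :: "('a, 'm) cnalgebra_scheme"
begin

lemma WAP_in_dual: "f \<in> WAP A \<Longrightarrow> f \<in> carrier (dual A)"
  by (simp add: WAP_def)

lemma WAP_zero: "(\<lambda>_. 0) \<in> WAP A"
proof -
  have z: "(\<lambda>_. 0) \<in> carrier (dual A)"
    by (auto simp: dual_iff intro!: exI[of _ 0])
  let ?S = "{act1 A (\<lambda>_. 0) \<phi> |\<phi>. \<phi> \<in> carrier A \<and> vnorm A \<phi> \<le> 1}"
  have S: "?S \<subseteq> {\<lambda>_. 0}"
    by (auto simp: act1_def)
  have "closedin weak_dual {\<lambda>_. 0}"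
    using Hausdorff_weak_dual z
    by (intro compactin_imp_closedin) (simp_all add: topspace_weak_dual)
  then have "weak_dual closure_of ?S \<subseteq> {\<lambda>_. 0}"
    by (rule closure_of_minimal[OF S])
  then have "compactin weak_dual (weak_dual closure_of ?S)"
    using z by (intro finite_imp_compactin) (auto simp: topspace_weak_dual intro: finite_subset)
  then show ?thesis
    using z S by (auto simp: WAP_def relatively_weakly_compact_def)
qed

lemma WAP_lincomb:
  assumes "f \<in> WAP A" "g \<in> WAP A"
  shows "(\<lambda>x. c * f x + d * g x) \<in> WAP A"
proof -
  let ?S = "\<lambda>f. {act1 A f \<phi> |\<phi>. \<phi> \<in> carrier A \<and> vnorm A \<phi> \<le> 1}"
  have act: "act1 A (\<lambda>x. c * f x + d * g x) \<phi> = (\<lambda>x. c * act1 A f \<phi> x + d * act1 A g \<phi> x)" for \<phi>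
    by (auto simp: act1_def)
  have R: "?S (\<lambda>x. c * f x + d * g x) \<subseteq> (\<lambda>(f, g) x. c * f x + d * g x) ` (?S f \<times> ?S g)"
  proof
    fix h assume "h \<in> ?S (\<lambda>x. c * f x + d * g x)"
    then obtain \<phi> where \<phi>: "\<phi> \<in> carrier A" "vnorm A \<phi> \<le> 1" "h = act1 A (\<lambda>x. c * f x + d * g x) \<phi>"
      by blast
    show "h \<in> (\<lambda>(f, g) x. c * f x + d * g x) ` (?S f \<times> ?S g)"
      by (rule image_eqI[of _ _ "(act1 A f \<phi>, act1 A g \<phi>)"]) (use \<phi> act in auto)
  qed
  have "relatively_weakly_compact (dual A) (?S (\<lambda>x. c * f x + d * g x))"
    by (rule relatively_weakly_compact_lincomb[OF _ _ R]) (use assms in \<open>simp_all add: WAP_def\<close>)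
  with assms show ?thesis
    by (simp add: WAP_def dual_closed_add dual_closed_scale)
qed

lemma WAP_add: "f \<in> WAP A \<Longrightarrow> g \<in> WAP A \<Longrightarrow> (\<lambda>x. f x + g x) \<in> WAP A"
  using WAP_lincomb[of f g 1 1] by simp

lemma WAP_scale: "f \<in> WAP A \<Longrightarrow> (\<lambda>x. c * f x) \<in> WAP A"
  using WAP_lincomb[of f f c 0] by simp

text \<open>The easy half of Grothendieck's double limit criterion: compactness provides a weak
  limit l of the functionals \<open>act1 A w (\<phi> n)\<close>, and both iterated limits equal the
  limit of l at \<psi> m.\<close>

lemma WAP_iterated_limits:
  assumes w: "w \<in> WAP A" and \<phi>: "\<And>n. \<phi> n \<in> carrier A" "\<And>n. vnorm A (\<phi> n) \<le> 1"
    and \<psi>: "\<And>m. \<psi> m \<in> carrier A" "\<And>m. vnorm A (\<psi> m) \<le> C"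
  shows "ulim (\<lambda>n. ulim (\<lambda>m. w (amult A (\<phi> n) (\<psi> m)))) = ulim (\<lambda>m. ulim (\<lambda>n. w (amult A (\<phi> n) (\<psi> m))))"
proof -
  let ?S = "{act1 A w \<phi> |\<phi>. \<phi> \<in> carrier A \<and> vnorm A \<phi> \<le> 1}"
  define g where "g = (\<lambda>n. act1 A w (\<phi> n))"
  have S: "?S \<subseteq> carrier (dual A)" "compactin weak_dual (weak_dual closure_of ?S)"
    using w by (auto simp: WAP_def relatively_weakly_compact_def)
  have gS: "g n \<in> ?S" for n
    using \<phi> by (auto simp: g_def)
  then have "g n \<in> weak_dual closure_of ?S" for n
    using closure_of_subset[of ?S weak_dual] S(1) unfolding topspace_weak_dual by blast
  from compactin_ultra_limit[of _ _ g, OF S(2) this] obtain l where l: "limitin weak_dual g l ultra"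
    by blast
  have lA: "l \<in> carrier (dual A)"
    using limitin_topspace[OF l] by (simp only: topspace_weak_dual)
  have gA: "g n \<in> carrier (dual A)" for n
    by (rule subsetD[OF S(1) gS])
  have gw: "g n (\<psi> m) = w (amult A (\<phi> n) (\<psi> m))" for n m
    using \<psi>(1) by (simp add: g_def act1_def)
  \<comment> \<open>The inner limit over m is itself an element of the bidual, so weak convergence
    to l passes through it.\<close>
  have "((\<lambda>n. ultra_functional \<psi> (g n)) \<longlongrightarrow> ultra_functional \<psi> l) ultra"
    by (rule limitin_weak_dual[OF l ultra_functional_in_bidual[OF \<psi>]])
  then have "ulim (\<lambda>n. ulim (\<lambda>m. g n (\<psi> m))) = ulim (\<lambda>m. l (\<psi> m))"
    using ulim_eq by (simp add: ultra_functional_def gA lA)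
  moreover have "ulim (\<lambda>n. g n (\<psi> m)) = l (\<psi> m)" for m
  proof -
    have "((\<lambda>n. canonical_embedding A (\<psi> m) (g n)) \<longlongrightarrow> canonical_embedding A (\<psi> m) l) ultra"
      by (rule limitin_weak_dual[OF l canonical_embedding_in_bidual[OF \<psi>(1)]])
    then show ?thesis
      using ulim_eq by (simp add: canonical_embedding_def gA lA)
  qed
  ultimately show ?thesis
    by (simp add: gw)
qed

section \<open>Extreme non-Arens regularity\<close>

abbreviation "WAP_coset \<equiv> vcoset (dual A) (WAP A)"
abbreviation "WAP_quotient \<equiv> quotient_space (dual A) (WAP A)"

lemma mem_WAP_coset_self: "f \<in> WAP_coset f"
  using WAP_zero by (auto simp: vcoset_def image_iff intro!: bexI[of _ "\<lambda>_. 0"])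

lemma mem_WAP_cosetE:
  assumes "g \<in> WAP_coset f"
  obtains w where "w \<in> WAP A" "g = (\<lambda>x. f x + w x)"
  using assms by (auto simp: vcoset_def)

lemma WAP_cosetI: "w \<in> WAP A \<Longrightarrow> g = (\<lambda>x. f x + w x) \<Longrightarrow> g \<in> WAP_coset f"
  by (auto simp: vcoset_def)

lemma WAP_quotient_add: "vadd WAP_quotient (WAP_coset f) (WAP_coset g) = WAP_coset (\<lambda>x. f x + g x)"
proof -
  have "(\<Union>a\<in>WAP_coset f. \<Union>b\<in>WAP_coset g. WAP_coset (\<lambda>x. a x + b x)) = WAP_coset (\<lambda>x. f x + g x)"
  proof (intro equalityI subsetI)
    fix h assume "h \<in> (\<Union>a\<in>WAP_coset f. \<Union>b\<in>WAP_coset g. WAP_coset (\<lambda>x. a x + b x))"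
    then obtain u v w where "u \<in> WAP A" "v \<in> WAP A" "w \<in> WAP A"
        "h = (\<lambda>x. (f x + u x) + (g x + v x) + w x)"
      by (auto elim!: mem_WAP_cosetE)
    then show "h \<in> WAP_coset (\<lambda>x. f x + g x)"
      by (intro WAP_cosetI[of "\<lambda>x. u x + v x + w x"] WAP_add) (auto simp: algebra_simps)
  qed (use mem_WAP_coset_self in blast)
  then show ?thesis by (simp add: quotient_space_def)
qed

lemma WAP_quotient_scale: "vscale WAP_quotient c (WAP_coset f) = WAP_coset (\<lambda>x. c * f x)"
proof -
  have "(\<Union>a\<in>WAP_coset f. WAP_coset (\<lambda>x. c * a x)) = WAP_coset (\<lambda>x. c * f x)"
  proof (intro equalityI subsetI)
    fix h assume "h \<in> (\<Union>a\<in>WAP_coset f. WAP_coset (\<lambda>x. c * a x))"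
    then obtain u w where "u \<in> WAP A" "w \<in> WAP A" "h = (\<lambda>x. c * (f x + u x) + w x)"
      by (auto elim!: mem_WAP_cosetE)
    then show "h \<in> WAP_coset (\<lambda>x. c * f x)"
      by (intro WAP_cosetI[of "\<lambda>x. c * u x + w x"] WAP_add WAP_scale) (auto simp: algebra_simps)
  qed (use mem_WAP_coset_self in blast)
  then show ?thesis by (simp add: quotient_space_def)
qed

text \<open>
  The functionals \<open>\<Lambda> j\<close> embed the relevant part of the quotient into \<open>\<ell>\<^sup>\<infinity>\<close>, in which \<open>A\<^sup>*\<close> sits as
  well, via evaluation at the norming sequence \<open>u\<close>. The subspace is the preimage of \<open>A\<^sup>*\<close>.
\<close>

lemma extremely_non_Arens_regularI:
  fixes \<Lambda> :: "nat \<Rightarrow> ('a \<Rightarrow> complex) \<Rightarrow> complex" and u :: "nat \<Rightarrow> 'a"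
  assumes add: "\<And>j f g. f \<in> carrier (dual A) \<Longrightarrow> g \<in> carrier (dual A) \<Longrightarrow> \<Lambda> j (\<lambda>x. f x + g x) = \<Lambda> j f + \<Lambda> j g"
    and scale: "\<And>j f c. f \<in> carrier (dual A) \<Longrightarrow> \<Lambda> j (\<lambda>x. c * f x) = c * \<Lambda> j f"
    and bound: "\<And>j f. f \<in> carrier (dual A) \<Longrightarrow> cmod (\<Lambda> j f) \<le> C * vnorm (dual A) f" and C: "C > 0"
    and kill: "\<And>j w. w \<in> WAP A \<Longrightarrow> \<Lambda> j w = 0"
    and u: "\<And>j. u j \<in> carrier A"
    and norming: "\<And>x s. x \<in> carrier (dual A) \<Longrightarrow> (\<And>j. cmod (x (u j)) \<le> s) \<Longrightarrow> vnorm (dual A) x \<le> s"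
    and lift: "\<And>x. x \<in> carrier (dual A) \<Longrightarrow> \<exists>f\<in>carrier (dual A). \<forall>j. \<Lambda> j f = x (u j)"
  shows "extremely_non_Arens_regular A"
proof -
  interpret D: cseminormed "dual A" by (rule dual_cseminormed)
  define S where "S = {WAP_coset f |f x. f \<in> carrier (dual A) \<and> x \<in> carrier (dual A) \<and> (\<forall>j. x (u j) = \<Lambda> j f)}"
  define T where "T = (\<lambda>q. THE x. \<exists>f\<in>carrier (dual A). q = WAP_coset f \<and> x \<in> carrier (dual A) \<and> (\<forall>j. x (u j) = \<Lambda> j f))"
  have \<Lambda>_coset: "\<Lambda> j g = \<Lambda> j f" if "f \<in> carrier (dual A)" "g \<in> WAP_coset f" for f g j
    using that add[OF that(1) WAP_in_dual] kill by (auto elim!: mem_WAP_cosetE)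
  have coset_dual: "g \<in> carrier (dual A)" if "f \<in> carrier (dual A)" "g \<in> WAP_coset f" for f g
    using that by (auto elim!: mem_WAP_cosetE intro: dual_closed_add WAP_in_dual)
  \<comment> \<open>\<Lambda> j is constant on cosets, so its bound passes to the infimum that
    defines the quotient norm.\<close>
  have \<Lambda>_quot: "cmod (\<Lambda> j f) \<le> C * vnorm WAP_quotient (WAP_coset f)" if f: "f \<in> carrier (dual A)" for j f
  proof -
    have "cmod (\<Lambda> j f) / C \<le> (INF a\<in>WAP_coset f. vnorm (dual A) a)"
    proof (rule cINF_greatest)
      fix a assume a: "a \<in> WAP_coset f"
      have "cmod (\<Lambda> j a) \<le> C * vnorm (dual A) a"
        by (rule bound[OF coset_dual[OF f a]])
      then show "cmod (\<Lambda> j f) / C \<le> vnorm (dual A) a"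
        using \<Lambda>_coset[OF f a] C by (simp add: divide_le_eq mult.commute)
    qed (use mem_WAP_coset_self in blast)
    then show ?thesis
      using C by (simp add: quotient_space_def divide_le_eq mult.commute)
  qed
  \<comment> \<open>\<open>norming\<close> with s = 0: the sequence u separates the dual, so the
    description in \<open>T\<close> has at most one solution.\<close>
  have uniq: "x = y" if x: "x \<in> carrier (dual A)" and y: "y \<in> carrier (dual A)" and "\<And>j. x (u j) = y (u j)" for x y
  proof
    fix a
    have d: "(\<lambda>a. x a - y a) \<in> carrier (dual A)" by (rule dual_closed_diff[OF x y])
    have "vnorm (dual A) (\<lambda>a. x a - y a) \<le> 0"
      by (rule norming[OF d]) (simp add: that)
    then show "x a = y a"
      using dual_bound[OF d, of a] dual_norm_nonneg[OF d] dual_outside[OF x, of a] dual_outside[OF y, of a]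
      by (cases "a \<in> carrier A") auto
  qed
  have T: "T (WAP_coset f) = x"
    if "f \<in> carrier (dual A)" "x \<in> carrier (dual A)" "\<And>j. x (u j) = \<Lambda> j f" for f x
    unfolding T_def
  proof (rule the_equality)
    fix y assume "\<exists>g\<in>carrier (dual A). WAP_coset f = WAP_coset g \<and> y \<in> carrier (dual A) \<and> (\<forall>j. y (u j) = \<Lambda> j g)"
    then obtain g where g: "g \<in> carrier (dual A)" "WAP_coset f = WAP_coset g" "y \<in> carrier (dual A)" "\<And>j. y (u j) = \<Lambda> j g"
      by blast
    have "f \<in> WAP_coset g"
      using g(2) mem_WAP_coset_self by metis
    then show "y = x"
      using that g \<Lambda>_coset[OF g(1), of f] by (intro uniq) auto
  qed (use that in auto)
  have SI: "WAP_coset f \<in> S" if "f \<in> carrier (dual A)" "x \<in> carrier (dual A)" "\<And>j. x (u j) = \<Lambda> j f" for f x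
    using that by (auto simp: S_def)
  have SE: "\<exists>f x. f \<in> carrier (dual A) \<and> x \<in> carrier (dual A) \<and> (\<forall>j. x (u j) = \<Lambda> j f) \<and> q = WAP_coset f \<and> T q = x"
    if "q \<in> S" for q
    using that T by (fastforce simp: S_def)
  have closed: "closed_csubspace WAP_quotient S"
    unfolding closed_csubspace_def
  proof (intro conjI ballI allI impI)
    show "S \<subseteq> carrier WAP_quotient"
      by (auto simp: S_def quotient_space_def)
    show "S \<noteq> {}"
      using SI lift D.nonempty by (metis empty_iff ex_in_conv)
  next
    fix p q assume pq: "p \<in> S" "q \<in> S"
    obtain f x where 1: "f \<in> carrier (dual A)" "x \<in> carrier (dual A)" "\<And>j. x (u j) = \<Lambda> j f" "p = WAP_coset f"
      using SE[OF pq(1)] by blast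
    obtain g y where 2: "g \<in> carrier (dual A)" "y \<in> carrier (dual A)" "\<And>j. y (u j) = \<Lambda> j g" "q = WAP_coset g"
      using SE[OF pq(2)] by blast
    show "vadd WAP_quotient p q \<in> S"
      unfolding 1(4) 2(4) WAP_quotient_add
      by (rule SI[where x = "\<lambda>a. x a + y a"]) (simp_all add: 1 2 dual_closed_add add)
  next
    fix c p assume p: "p \<in> S"
    obtain f x where 1: "f \<in> carrier (dual A)" "x \<in> carrier (dual A)" "\<And>j. x (u j) = \<Lambda> j f" "p = WAP_coset f"
      using SE[OF p] by blast
    show "vscale WAP_quotient c p \<in> S"
      unfolding 1(4) WAP_quotient_scale
      by (rule SI[where x = "\<lambda>a. c * x a"]) (simp_all add: 1 dual_closed_scale scale)
  next
    fix q assume q: "q \<in> carrier WAP_quotient"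
      and lim: "\<forall>e>0. \<exists>s\<in>S. vnorm WAP_quotient (vadd WAP_quotient q (vscale WAP_quotient (-1) s)) < e"
    obtain f where f: "f \<in> carrier (dual A)" "q = WAP_coset f"
      using q by (auto simp: quotient_space_def)
    \<comment> \<open>Elements x that belong to nearby cosets of S approximate the values
      \<open>\<Lambda> j f\<close> uniformly in j. Through \<open>norming\<close> they become Cauchy
      at every point, and their pointwise limit shows that the coset of f is in S.\<close>
    have "\<exists>x. x \<in> carrier (dual A) \<and> (\<forall>j. cmod (\<Lambda> j f - x (u j)) \<le> C * inverse (real (Suc n)))" for n
    proof -
      have "inverse (real (Suc n)) > 0" by simp
      with lim obtain s where s: "s \<in> S"
        "vnorm WAP_quotient (vadd WAP_quotient q (vscale WAP_quotient (-1) s)) < inverse (real (Suc n))"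
        by blast
      obtain g x where 1: "g \<in> carrier (dual A)" "x \<in> carrier (dual A)" "\<And>j. x (u j) = \<Lambda> j g" "s = WAP_coset g"
        using SE[OF s(1)] by blast
      let ?h = "\<lambda>x. f x + (-1) * g x"
      have h: "?h \<in> carrier (dual A)"
        by (intro dual_closed_add dual_closed_scale f 1)
      have "cmod (\<Lambda> j f - x (u j)) \<le> C * inverse (real (Suc n))" for j
      proof -
        have "\<Lambda> j f - x (u j) = \<Lambda> j ?h"
          unfolding add[OF f(1) dual_closed_scale[OF 1(1)]] scale[OF 1(1)] 1(3) by simp
        also have "cmod \<dots> \<le> C * vnorm WAP_quotient (WAP_coset ?h)"
          by (rule \<Lambda>_quot[OF h])
        also have "\<dots> \<le> C * inverse (real (Suc n))"
          using s(2) C unfolding f(2) 1(4) WAP_quotient_scale WAP_quotient_add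
          by (intro mult_left_mono) auto
        finally show ?thesis .
      qed
      then show ?thesis using 1(2) by blast
    qed
    then obtain X where X: "\<And>n. X n \<in> carrier (dual A)"
        "\<And>n j. cmod (\<Lambda> j f - X n (u j)) \<le> C * inverse (real (Suc n))"
      by metis
    have diff: "cmod (X n a - X m a) \<le> (C * inverse (real (Suc n)) + C * inverse (real (Suc m))) * vnorm A a"
      if a: "a \<in> carrier A" for n m a
    proof -
      have d: "(\<lambda>a. X n a - X m a) \<in> carrier (dual A)" by (rule dual_closed_diff[OF X(1) X(1)])
      have "vnorm (dual A) (\<lambda>a. X n a - X m a) \<le> C * inverse (real (Suc n)) + C * inverse (real (Suc m))"
      proof (rule norming[OF d])
        fix j
        have "cmod (X n (u j) - X m (u j)) \<le> cmod (\<Lambda> j f - X n (u j)) + cmod (\<Lambda> j f - X m (u j))"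
          using norm_triangle_ineq4[of "\<Lambda> j f - X m (u j)" "\<Lambda> j f - X n (u j)"] by simp
        also have "\<dots> \<le> C * inverse (real (Suc n)) + C * inverse (real (Suc m))"
          by (intro add_mono X)
        finally show "cmod (X n (u j) - X m (u j)) \<le> C * inverse (real (Suc n)) + C * inverse (real (Suc m))" .
      qed
      then show ?thesis
        using dual_bound[OF d a] nonneg[OF a] by (meson mult_right_mono order_trans)
    qed
    have conv: "\<exists>l. (\<lambda>n. X n a) \<longlonglongrightarrow> l" for a
    proof (cases "a \<in> carrier A")
      case True
      have "Cauchy (\<lambda>n. X n a)"
      proof (rule metric_CauchyI)
        fix e :: real assume e: "e > 0"
        have "(\<lambda>n. 2 * C * vnorm A a * inverse (real (Suc n))) \<longlonglongrightarrow> 2 * C * vnorm A a * 0"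
          by (intro tendsto_intros LIMSEQ_inverse_real_of_nat)
        then have "eventually (\<lambda>n. 2 * C * vnorm A a * inverse (real (Suc n)) < e) sequentially"
          using e by (simp add: order_tendsto_iff)
        then obtain M where M: "2 * C * vnorm A a * inverse (real (Suc M)) < e"
          by (auto simp: eventually_sequentially)
        have "dist (X m a) (X n a) < e" if "m \<ge> M" "n \<ge> M" for m n
        proof -
          have i: "inverse (real (Suc k)) \<le> inverse (real (Suc M))" if "k \<ge> M" for k
            using that by (intro le_imp_inverse_le) auto
          have "dist (X m a) (X n a) \<le> (C * inverse (real (Suc m)) + C * inverse (real (Suc n))) * vnorm A a"
            using diff[OF True] by (simp add: dist_norm)
          also have "\<dots> \<le> (C * inverse (real (Suc M)) + C * inverse (real (Suc M))) * vnorm A a"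
            using i[OF \<open>m \<ge> M\<close>] i[OF \<open>n \<ge> M\<close>] C nonneg[OF True]
            by (intro mult_right_mono add_mono mult_left_mono) auto
          also have "\<dots> = 2 * C * vnorm A a * inverse (real (Suc M))"
            by (simp add: algebra_simps)
          finally show ?thesis using M by simp
        qed
        then show "\<exists>M. \<forall>m\<ge>M. \<forall>n\<ge>M. dist (X m a) (X n a) < e" by blast
      qed
      then show ?thesis by (simp add: Cauchy_convergent_iff convergent_def)
    next
      case False
      then have "(\<lambda>n. X n a) = (\<lambda>_. 0)"
        using dual_outside[OF X(1)] by auto
      then show ?thesis by auto
    qed
    then obtain x where x: "\<And>a. (\<lambda>n. X n a) \<longlonglongrightarrow> x a"
      by metis
    have xd: "x \<in> carrier (dual A)"
    proof (rule dualI)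
      fix a b assume ab: "a \<in> carrier A" "b \<in> carrier A"
      have "(\<lambda>n. X n a + X n b) \<longlonglongrightarrow> x a + x b" by (intro tendsto_add x)
      then show "x (vadd A a b) = x a + x b"
        using x[of "vadd A a b"] LIMSEQ_unique by (simp add: dual_add[OF X(1) ab])
    next
      fix c a assume a: "a \<in> carrier A"
      have "(\<lambda>n. c * X n a) \<longlonglongrightarrow> c * x a" by (intro tendsto_mult_left x)
      then show "x (vscale A c a) = c * x a"
        using x[of "vscale A c a"] LIMSEQ_unique by (simp add: dual_scale[OF X(1) a])
    next
      fix a assume "a \<notin> carrier A"
      then show "x a = 0"
        using x[of a] LIMSEQ_unique[OF _ tendsto_const] by (simp add: dual_outside[OF X(1)])
    next
      fix a assume a: "a \<in> carrier A"
      show "cmod (x a) \<le> (C + C * vnorm (dual A) f) * vnorm A a"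
      proof (rule tendsto_upperbound[OF tendsto_norm[OF x] _ sequentially_bot], rule always_eventually, rule allI)
        fix n
        have "vnorm (dual A) (X n) \<le> C + C * vnorm (dual A) f"
        proof (rule norming[OF X(1)])
          fix j
          have "cmod (X n (u j)) \<le> cmod (\<Lambda> j f - X n (u j)) + cmod (\<Lambda> j f)"
            using norm_triangle_ineq4[of "\<Lambda> j f" "\<Lambda> j f - X n (u j)"] by simp
          also have "\<dots> \<le> C * inverse (real (Suc n)) + C * vnorm (dual A) f"
            by (intro add_mono X bound f)
          also have "\<dots> \<le> C * 1 + C * vnorm (dual A) f"
            using C by (intro add_mono mult_left_mono) (auto simp: field_simps)
          finally show "cmod (X n (u j)) \<le> C + C * vnorm (dual A) f" by simp
        qed
        then show "cmod (X n a) \<le> (C + C * vnorm (dual A) f) * vnorm A a"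
          using dual_bound[OF X(1) a, of n] nonneg[OF a] by (meson mult_right_mono order_trans)
      qed
    qed
    have "x (u j) = \<Lambda> j f" for j
    proof -
      have "(\<lambda>n. C * inverse (real (Suc n))) \<longlonglongrightarrow> C * 0"
        by (intro tendsto_intros LIMSEQ_inverse_real_of_nat)
      then have "(\<lambda>n. \<Lambda> j f - X n (u j)) \<longlonglongrightarrow> 0"
        by (intro Lim_null_comparison[OF always_eventually[OF allI[OF X(2)]]]) simp
      moreover have "(\<lambda>n. \<Lambda> j f - X n (u j)) \<longlonglongrightarrow> \<Lambda> j f - x (u j)"
        by (intro tendsto_intros x)
      ultimately have "\<Lambda> j f - x (u j) = 0"
        by (rule LIMSEQ_unique[rotated])
      then show ?thesis by simp
    qed
    then show "q \<in> S"
      unfolding f(2) by (intro SI[OF f(1) xd]) auto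
  qed
  have bdd: "bounded_clinear_map (WAP_quotient\<lparr>carrier := S\<rparr>) (dual A) T"
    unfolding bounded_clinear_map_def
  proof (intro conjI ballI allI exI)
    show "T \<in> carrier (WAP_quotient\<lparr>carrier := S\<rparr>) \<rightarrow> carrier (dual A)"
    proof
      fix q assume "q \<in> carrier (WAP_quotient\<lparr>carrier := S\<rparr>)"
      then show "T q \<in> carrier (dual A)" using SE[of q] by auto
    qed
  next
    fix p q assume pq: "p \<in> carrier (WAP_quotient\<lparr>carrier := S\<rparr>)" "q \<in> carrier (WAP_quotient\<lparr>carrier := S\<rparr>)"
    then obtain f x where 1: "f \<in> carrier (dual A)" "x \<in> carrier (dual A)" "\<And>j. x (u j) = \<Lambda> j f" "p = WAP_coset f" "T p = x"
      using SE[of p] by auto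
    from pq obtain g y where 2: "g \<in> carrier (dual A)" "y \<in> carrier (dual A)" "\<And>j. y (u j) = \<Lambda> j g" "q = WAP_coset g" "T q = y"
      using SE[of q] by auto
    have "T (WAP_coset (\<lambda>x. f x + g x)) = (\<lambda>a. x a + y a)"
      by (rule T) (simp_all add: 1 2 dual_closed_add add)
    then show "T (vadd (WAP_quotient\<lparr>carrier := S\<rparr>) p q) = vadd (dual A) (T p) (T q)"
      using WAP_quotient_add[of f g] 1 2 by simp
  next
    fix c p assume p: "p \<in> carrier (WAP_quotient\<lparr>carrier := S\<rparr>)"
    then obtain f x where 1: "f \<in> carrier (dual A)" "x \<in> carrier (dual A)" "\<And>j. x (u j) = \<Lambda> j f" "p = WAP_coset f" "T p = x"
      using SE[of p] by auto
    have "T (WAP_coset (\<lambda>x. c * f x)) = (\<lambda>a. c * x a)"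
      by (rule T) (simp_all add: 1 dual_closed_scale scale)
    then show "T (vscale (WAP_quotient\<lparr>carrier := S\<rparr>) c p) = vscale (dual A) c (T p)"
      using WAP_quotient_scale[of c f] 1 by simp
  next
    fix p assume p: "p \<in> carrier (WAP_quotient\<lparr>carrier := S\<rparr>)"
    then obtain f x where 1: "f \<in> carrier (dual A)" "x \<in> carrier (dual A)" "\<And>j. x (u j) = \<Lambda> j f" "p = WAP_coset f" "T p = x"
      using SE[of p] by auto
    have "vnorm (dual A) x \<le> C * vnorm WAP_quotient (WAP_coset f)"
      using \<Lambda>_quot[OF 1(1)] by (intro norming 1) (simp add: 1)
    then show "vnorm (dual A) (T p) \<le> C * vnorm (WAP_quotient\<lparr>carrier := S\<rparr>) p"
      using 1 by simp
  qed
  have "T ` S = carrier (dual A)"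
  proof (intro equalityI subsetI)
    fix x assume x: "x \<in> carrier (dual A)"
    then obtain f where "f \<in> carrier (dual A)" "\<And>j. \<Lambda> j f = x (u j)"
      using lift by blast
    with x have "WAP_coset f \<in> S" "T (WAP_coset f) = x"
      by (auto intro!: SI T)
    then show "x \<in> T ` S" by blast
  next
    fix x assume "x \<in> T ` S"
    then show "x \<in> carrier (dual A)" using SE by blast
  qed
  with closed bdd show ?thesis
    unfolding extremely_non_Arens_regular_def Let_def by blast
qed

end

section \<open>Functions on cyclic subgroups\<close>

text \<open>Two interleaved series, treated through real and imaginary parts;
  \<open>fourier_algebra_add\<close> merges two representations in this way.\<close>

lemma sums_if_complex:
  fixes f g :: "nat \<Rightarrow> complex"
  assumes "g sums x" "f sums y"
  shows "(\<lambda>n. if even n then f (n div 2) else g ((n - 1) div 2)) sums (x + y)"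
  using sums_if[of "\<lambda>n. Re (g n)" "Re x" "\<lambda>n. Re (f n)" "Re y"]
    sums_if[of "\<lambda>n. Im (g n)" "Im x" "\<lambda>n. Im (f n)" "Im y"] assms
  unfolding sums_complex_iff by (simp add: if_distrib[of Re] if_distrib[of Im])

context group
begin

lemma cseminormed_algebra_fourier: "cseminormed_algebra (fourier_algebra G)"
proof (unfold cseminormed_algebra_def, unfold_locales)
  show "carrier (fourier_algebra G) \<noteq> {}"
    using zero_in_fourier_algebra by auto
qed (simp_all add: fourier_norm_nonneg fourier_algebra_cmult)

lemma fourier_algebra_add:
  assumes "u \<in> carrier (fourier_algebra G)" "v \<in> carrier (fourier_algebra G)"
  shows "(\<lambda>x. u x + v x) \<in> carrier (fourier_algebra G)"
proof -
  obtain \<xi> \<eta> where u: "fourier_rep G u \<xi> \<eta>"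
    using assms(1) by (auto simp: fourier_algebra_def)
  obtain \<xi>' \<eta>' where v: "fourier_rep G v \<xi>' \<eta>'"
    using assms(2) by (auto simp: fourier_algebra_def)
  define X where "X = (\<lambda>n. if even n then \<xi> (n div 2) else \<xi>' ((n - 1) div 2))"
  define Y where "Y = (\<lambda>n. if even n then \<eta> (n div 2) else \<eta>' ((n - 1) div 2))"
  have "summable (\<lambda>n. l2_norm G (X n) * l2_norm G (Y n))"
  proof -
    have eq: "(\<lambda>n. l2_norm G (X n) * l2_norm G (Y n)) =
        (\<lambda>n. if even n then l2_norm G (\<xi> (n div 2)) * l2_norm G (\<eta> (n div 2))
          else l2_norm G (\<xi>' ((n - 1) div 2)) * l2_norm G (\<eta>' ((n - 1) div 2)))"
      by (auto simp: X_def Y_def)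
    have "summable (\<lambda>n. l2_norm G (\<xi> n) * l2_norm G (\<eta> n))"
        "summable (\<lambda>n. l2_norm G (\<xi>' n) * l2_norm G (\<eta>' n))"
      using u v by (auto simp: fourier_rep_def)
    from sums_if[OF summable_sums[OF this(2)] summable_sums[OF this(1)], THEN sums_summable]
    show ?thesis unfolding eq .
  qed
  moreover have "u x + v x = (\<Sum>n. l2_inner G (left_regular G x (X n)) (Y n))" if x: "x \<in> carrier G" for x
  proof -
    have "(\<lambda>n. l2_inner G (left_regular G x (X n)) (Y n)) =
        (\<lambda>n. if even n then coef G (\<xi> (n div 2)) (\<eta> (n div 2)) x
          else coef G (\<xi>' ((n - 1) div 2)) (\<eta>' ((n - 1) div 2)) x)"
      using x by (auto simp: X_def Y_def coef_def)
    then have "(\<lambda>n. l2_inner G (left_regular G x (X n)) (Y n)) sums (v x + u x)"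
      using sums_if_complex[OF fourier_rep_sums[OF v x] fourier_rep_sums[OF u x]] by simp
    then show ?thesis by (simp add: sums_iff add.commute)
  qed
  ultimately have "fourier_rep G (\<lambda>x. u x + v x) X Y"
    using u v by (auto simp: fourier_rep_def X_def Y_def)
  then show ?thesis
    using assms by (auto simp: fourier_algebra_def)
qed

definition infinite_order :: "'a \<Rightarrow> bool" where
  "infinite_order x \<longleftrightarrow> x \<in> carrier G \<and> (\<forall>k::int. x [^] k = \<one> \<longrightarrow> k = 0)"

lemma infinite_order_carrier: "infinite_order x \<Longrightarrow> x \<in> carrier G"
  by (simp add: infinite_order_def)

lemma int_pow_eq_iff:
  assumes x: "infinite_order x"
  shows "x [^] (k::int) = x [^] l \<longleftrightarrow> k = l"
proof
  assume "x [^] k = x [^] l"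
  then have "x [^] (k - l) = \<one>"
    using infinite_order_carrier[OF x] by (simp add: int_pow_diff)
  then show "k = l" using x by (fastforce simp: infinite_order_def)
qed simp

definition block :: "'a \<Rightarrow> int \<Rightarrow> nat \<Rightarrow> 'a \<Rightarrow> complex" where
  "block x s n y = of_bool (y \<in> (\<lambda>l. x [^] l) ` {s..<s + int n})"

text \<open>On powers of x this is a trapezoid, the overlap of two integer intervals of lengths M
  and n divided by M (see \<open>block_coef_pow\<close>): a Fejer triangle for n = M, a plateau of
  height 1 with slopes of length M for n > M. Its norm is at most sqrt (n / M).\<close>

definition block_coef :: "'a \<Rightarrow> nat \<Rightarrow> int \<Rightarrow> nat \<Rightarrow> 'a \<Rightarrow> complex" where
  "block_coef x M s n = coef G (\<lambda>y. of_real (1 / real M) * block x 0 M y) (block x s n)"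

lemma block_l2:
  assumes x: "infinite_order x"
  shows "block x s n \<in> l2 G" "l2_norm G (block x s n) = sqrt (real n)"
proof -
  let ?F = "(\<lambda>l. x [^] l) ` {s..<s + int n}"
  have F: "finite ?F" "?F \<subseteq> carrier G" using infinite_order_carrier[OF x] by auto
  have z: "block x s n y = 0" if "y \<in> carrier G - ?F" for y
    using that by (simp add: block_def)
  show "block x s n \<in> l2 G"
    by (rule l2_finite_support[OF F(1) z])
  have "(\<Sum>y\<in>?F. (cmod (block x s n y))\<^sup>2) = (\<Sum>y\<in>?F. 1)"
    by (intro sum.cong) (auto simp: block_def)
  also have "\<dots> = real n"
    by (simp add: card_image inj_on_def int_pow_eq_iff[OF x])
  finally show "l2_norm G (block x s n) = sqrt (real n)"
    using l2_norm_finite_support[OF F z] by simp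
qed

lemma block_coef_in_fourier_algebra:
  assumes x: "infinite_order x"
  shows "block_coef x M s n \<in> carrier (fourier_algebra G)"
    and "fourier_norm G (block_coef x M s n) \<le> sqrt (real M * real n) / real M"
proof -
  note c = coef_in_fourier_algebra[OF l2_cmult[OF block_l2(1)[OF x, of 0 M]] block_l2(1)[OF x, of s n], of "of_real (1 / real M)"]
  show "block_coef x M s n \<in> carrier (fourier_algebra G)"
    unfolding block_coef_def[abs_def] by (rule c)
  show "fourier_norm G (block_coef x M s n) \<le> sqrt (real M * real n) / real M"
    using c(2) unfolding block_coef_def[abs_def] l2_norm_cmult
    by (simp add: block_l2(2)[OF x] real_sqrt_mult norm_divide)
qed

lemma l2_inner_block:
  assumes x: "infinite_order x"
  shows "l2_inner G \<zeta> (block x s n) = (\<Sum>l\<in>{s..<s + int n}. \<zeta> (x [^] l))"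
proof -
  let ?F = "(\<lambda>l. x [^] l) ` {s..<s + int n}"
  have "l2_inner G \<zeta> (block x s n) = (\<Sum>y\<in>?F. \<zeta> y * cnj (block x s n y))"
    by (rule l2_inner_finite_support) (use infinite_order_carrier[OF x] in \<open>auto simp: block_def\<close>)
  also have "\<dots> = (\<Sum>y\<in>?F. \<zeta> y)"
    by (intro sum.cong) (auto simp: block_def)
  also have "\<dots> = (\<Sum>l\<in>{s..<s + int n}. \<zeta> (x [^] l))"
    by (subst sum.reindex) (auto simp: inj_on_def int_pow_eq_iff[OF x])
  finally show ?thesis .
qed

lemma block_coef_pow:
  assumes x: "infinite_order x"
  shows "block_coef x M s n (x [^] (k::int)) = of_nat (card {l\<in>{s..<s + int n}. k \<le> l \<and> l < k + int M}) / of_nat M"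
proof -
  have v: "block x 0 M (inv (x [^] k) \<otimes> x [^] l) = of_bool (k \<le> l \<and> l < k + int M)" for l
  proof -
    have "inv (x [^] k) \<otimes> x [^] l = x [^] (l - k)"
      using infinite_order_carrier[OF x] by (simp add: int_pow_mult[symmetric] int_pow_neg[symmetric])
    then show ?thesis
      by (auto simp: block_def image_iff int_pow_eq_iff[OF x])
  qed
  have "block_coef x M s n (x [^] k) = (\<Sum>l\<in>{s..<s + int n}. of_real (1 / real M) * of_bool (k \<le> l \<and> l < k + int M))"
    unfolding block_coef_def coef_def using infinite_order_carrier[OF x] by (simp add: l2_inner_block[OF x] left_regular_def v)
  also have "\<dots> = of_real (1 / real M) * of_nat (card {l\<in>{s..<s + int n}. k \<le> l \<and> l < k + int M})"
    unfolding sum_distrib_left[symmetric] by (simp add: Int_def)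
  finally show ?thesis by simp
qed

text \<open>A common point of the two blocks writes y as x^(l - j) with 0 \<le> j < M and s \<le> l
  < s + n, an exponent that \<open>y_pow\<close> excludes.\<close>

lemma block_coef_eq_0:
  assumes x: "infinite_order x"
    and y_pow: "\<And>k::int. s - int M < k \<Longrightarrow> k < s + int n \<Longrightarrow> y \<noteq> x [^] k"
  shows "block_coef x M s n y = 0"
proof (cases "y \<in> carrier G")
  case y: True
  have "block x 0 M (inv y \<otimes> x [^] l) = 0" if l: "l \<in> {s..<s + int n}" for l
  proof (rule ccontr)
    assume "block x 0 M (inv y \<otimes> x [^] l) \<noteq> 0"
    then obtain j where j: "inv y \<otimes> x [^] l = x [^] j" "j \<in> {0..<int M}"
      by (auto simp: block_def)
    have "y = x [^] l \<otimes> inv (inv y \<otimes> x [^] l)"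
      using y infinite_order_carrier[OF x] by (simp add: inv_mult_group m_assoc[symmetric])
    then have "y = x [^] (l - j)"
      unfolding j using infinite_order_carrier[OF x] by (simp add: int_pow_diff)
    moreover have "s - int M < l - j" "l - j < s + int n"
      using j l by auto
    ultimately show False using y_pow by blast
  qed
  then show ?thesis
    unfolding block_coef_def coef_def using y by (simp add: l2_inner_block[OF x] left_regular_def)
qed (simp add: block_coef_def coef_outside)

lemma block_coef_eq_1:
  assumes x: "infinite_order x"
    and "M > 0" "s \<le> k" "k + int M \<le> s + int n"
  shows "block_coef x M s n (x [^] k) = 1"
proof -
  have "{l\<in>{s..<s + int n}. k \<le> l \<and> l < k + int M} = {k..<k + int M}"
    using assms by auto
  then show ?thesis
    using assms by (simp add: block_coef_pow)
qed

lemma cmod_block_coef_le: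
  assumes x: "infinite_order x"
  shows "cmod (block_coef x M s n y) \<le> 1"
proof (cases "\<exists>k::int. y = x [^] k")
  case True
  then obtain k :: int where k: "y = x [^] k" by blast
  have "card {l\<in>{s..<s + int n}. k \<le> l \<and> l < k + int M} \<le> card {k..<k + int M}"
    by (intro card_mono) auto
  then have "real (card {l\<in>{s..<s + int n}. k \<le> l \<and> l < k + int M}) \<le> real M"
    by simp
  then have "real (card {l\<in>{s..<s + int n}. k \<le> l \<and> l < k + int M}) / real M \<le> 1"
    by (cases "M = 0") (simp_all only: divide_le_eq, simp_all)
  then show ?thesis
    unfolding k block_coef_pow[OF x] norm_divide norm_of_nat .
next
  case False
  then show ?thesis
    by (subst block_coef_eq_0[OF x]) auto
qed

section \<open>Functionals given by series\<close>

text \<open>As \<open>bound\<close> holds for every c of modulus at most 1, aligning the phases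
  bounds \<Sum> |F n u| by the norm of u. Hence arbitrary bounded coefficients d are
  admissible.\<close>

lemma fourier_series_functional:
  fixes F :: "nat \<Rightarrow> ('a \<Rightarrow> complex) \<Rightarrow> complex"
  assumes C: "C \<ge> 0"
    and add: "\<And>n u v. F n (\<lambda>x. u x + v x) = F n u + F n v"
    and scale: "\<And>n c u. F n (\<lambda>x. c * u x) = c * F n u"
    and bound: "\<And>K c u. u \<in> carrier (fourier_algebra G) \<Longrightarrow> (\<And>n. cmod (c n) \<le> 1) \<Longrightarrow>
      cmod (\<Sum>n<K. c n * F n u) \<le> C * fourier_norm G u"
    and d: "\<And>n. cmod (d n) \<le> S"
  shows "(\<lambda>u. if u \<in> carrier (fourier_algebra G) then \<Sum>n. d n * F n u else 0) \<in> carrier (dual (fourier_algebra G))"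
proof -
  interpret cseminormed_algebra "fourier_algebra G" by (rule cseminormed_algebra_fourier)
  let ?A = "fourier_algebra G"
  have S: "S \<ge> 0" using order_trans[OF norm_ge_zero d[of 0]] .
  have part: "(\<Sum>n<K. cmod (F n u)) \<le> C * fourier_norm G u" if u: "u \<in> carrier ?A" for K u
  proof -
    \<comment> \<open>Rotates each term to its modulus; where F n u = 0 the quotient is 0 / 0 =
      0.\<close>
    define c where "c = (\<lambda>n. cnj (F n u) / of_real (cmod (F n u)))"
    have "c n * F n u = of_real (cmod (F n u))" for n
      by (cases "F n u = 0") (simp_all add: c_def divide_simps complex_norm_square[symmetric] power2_eq_square mult.commute[of "cnj _"])
    then have "(\<Sum>n<K. cmod (F n u)) = cmod (\<Sum>n<K. c n * F n u)"
      by (simp flip: of_real_sum add: sum_nonneg)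
    also have "\<dots> \<le> C * fourier_norm G u"
      by (rule bound[OF u]) (simp add: c_def norm_divide)
    finally show ?thesis .
  qed
  have sF: "summable (\<lambda>n. cmod (F n u))" and leF: "(\<Sum>n. cmod (F n u)) \<le> C * fourier_norm G u"
    if u: "u \<in> carrier ?A" for u
  proof -
    show "summable (\<lambda>n. cmod (F n u))"
      by (rule summableI_nonneg_bounded[OF _ part[OF u]]) simp
    then show "(\<Sum>n. cmod (F n u)) \<le> C * fourier_norm G u"
      by (rule suminf_le_const) (rule part[OF u])
  qed
  have sd: "summable (\<lambda>n. S * cmod (F n u))" if "u \<in> carrier ?A" for u
    by (rule summable_mult[OF sF[OF that]])
  have led: "cmod (d n * F n u) \<le> S * cmod (F n u)" for n u
    using d[of n] by (simp add: norm_mult mult_right_mono)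
  have s: "summable (\<lambda>n. d n * F n u)" if "u \<in> carrier ?A" for u
    by (rule summable_comparison_test'[OF sd[OF that] led])
  show ?thesis
  proof (rule dualI[where C = "S * C"])
    fix u v assume uv: "u \<in> carrier ?A" "v \<in> carrier ?A"
    show "(if vadd ?A u v \<in> carrier ?A then \<Sum>n. d n * F n (vadd ?A u v) else 0) =
      (if u \<in> carrier ?A then \<Sum>n. d n * F n u else 0) + (if v \<in> carrier ?A then \<Sum>n. d n * F n v else 0)"
      using uv fourier_algebra_add[OF uv] suminf_add[OF s[OF uv(1)] s[OF uv(2)]] by (simp add: add distrib_left)
  next
    fix c u assume u: "u \<in> carrier ?A"
    show "(if vscale ?A c u \<in> carrier ?A then \<Sum>n. d n * F n (vscale ?A c u) else 0) =
      c * (if u \<in> carrier ?A then \<Sum>n. d n * F n u else 0)"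
      using u scale_closed[OF u, of c] suminf_mult[OF s[OF u], of c] by (simp add: scale mult.left_commute)
  next
    fix u assume u: "u \<in> carrier ?A"
    have "cmod (\<Sum>n. d n * F n u) \<le> (\<Sum>n. S * cmod (F n u))"
      by (rule norm_suminf_le[OF led sd[OF u]])
    also have "\<dots> = S * (\<Sum>n. cmod (F n u))"
      by (rule suminf_mult[OF sF[OF u]])
    also have "\<dots> \<le> S * (C * fourier_norm G u)"
      by (rule mult_left_mono[OF leF[OF u] S])
    finally show "cmod (if u \<in> carrier ?A then \<Sum>n. d n * F n u else 0) \<le> S * C * vnorm ?A u"
      using u by (simp add: mult.assoc)
  qed simp
qed

end

section \<open>Failure of strong Arens irregularity\<close>

text \<open>Already the first Arens product violates the definition: with \<mu> the cluster point of
  \<Phi>, the map \<nu> \<mapsto> \<mu>\<nu> is constantly 0, hence continuous. If \<mu> came from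
  u, point evaluations would give u = 0, against \<mu> h = 1.\<close>

lemma (in group) not_strongly_Arens_irregularI:
  fixes \<Phi> :: "nat \<Rightarrow> 'a \<Rightarrow> complex"
  assumes \<Phi>: "\<And>n. \<Phi> n \<in> carrier (fourier_algebra G)" "\<And>n. fourier_norm G (\<Phi> n) \<le> C"
    and mult: "\<And>n u. u \<in> carrier (fourier_algebra G) \<Longrightarrow> (\<lambda>x. \<Phi> n x * u x) \<in> carrier (fourier_algebra G)"
    and mult_le: "\<And>n u. u \<in> carrier (fourier_algebra G) \<Longrightarrow>
      fourier_norm G (\<lambda>x. \<Phi> n x * u x) \<le> \<epsilon> n * fourier_norm G u"
    and \<epsilon>: "\<epsilon> \<longlonglongrightarrow> 0" "\<And>n. \<epsilon> n \<ge> 0"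
    and h: "h \<in> carrier (dual (fourier_algebra G))" "\<And>n. h (\<Phi> n) = 1"
  shows "\<not> strongly_Arens_irregular (fourier_algebra G)"
proof
  interpret cseminormed_algebra "fourier_algebra G" by (rule cseminormed_algebra_fourier)
  let ?A = "fourier_algebra G"
  assume sAir: "strongly_Arens_irregular ?A"
  define \<mu> where "\<mu> = ultra_functional \<Phi>"
  have \<mu>: "\<mu> \<in> carrier (dual (dual ?A))"
    unfolding \<mu>_def by (rule ultra_functional_in_bidual[where C = C]) (simp_all add: \<Phi>)
  have \<mu>_null: "\<mu> f = 0" if "f \<in> carrier (dual ?A)" "(\<lambda>n. f (\<Phi> n)) \<longlonglongrightarrow> 0" for f
    using that by (simp add: \<mu>_def ultra_functional_def ulim_eq_sequentially)
  have act: "act1 ?A f (\<Phi> n) \<in> carrier (dual ?A)" "vnorm (dual ?A) (act1 ?A f (\<Phi> n)) \<le> \<epsilon> n * vnorm (dual ?A) f"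
    if f: "f \<in> carrier (dual ?A)" for f n
  proof -
    have b: "cmod (act1 ?A f (\<Phi> n) u) \<le> (\<epsilon> n * vnorm (dual ?A) f) * vnorm ?A u" if u: "u \<in> carrier ?A" for u
    proof -
      have "cmod (f (\<lambda>x. \<Phi> n x * u x)) \<le> vnorm (dual ?A) f * fourier_norm G (\<lambda>x. \<Phi> n x * u x)"
        using dual_bound[OF f mult[OF u]] by simp
      also have "\<dots> \<le> vnorm (dual ?A) f * (\<epsilon> n * fourier_norm G u)"
        by (rule mult_left_mono[OF mult_le[OF u] dual_norm_nonneg[OF f]])
      finally show ?thesis
        using u by (simp add: act1_def mult_ac)
    qed
    show "act1 ?A f (\<Phi> n) \<in> carrier (dual ?A)"
    proof (rule dualI[OF _ _ b])
      fix u v assume uv: "u \<in> carrier ?A" "v \<in> carrier ?A"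
      then show "act1 ?A f (\<Phi> n) (vadd ?A u v) = act1 ?A f (\<Phi> n) u + act1 ?A f (\<Phi> n) v"
        using dual_add[OF f mult[OF uv(1), of n] mult[OF uv(2), of n]]
        by (simp add: act1_def fourier_algebra_add distrib_left)
    next
      fix c u assume u: "u \<in> carrier ?A"
      then show "act1 ?A f (\<Phi> n) (vscale ?A c u) = c * act1 ?A f (\<Phi> n) u"
        using dual_scale[OF f mult[OF u, of n], of c]
        by (simp add: act1_def fourier_algebra_cmult mult.left_commute)
    qed (simp_all add: act1_def)
    show "vnorm (dual ?A) (act1 ?A f (\<Phi> n)) \<le> \<epsilon> n * vnorm (dual ?A) f"
      by (rule dual_norm_le[OF b]) (simp_all add: \<epsilon> dual_norm_nonneg[OF f])
  qed
  have prod: "arens1 ?A \<mu> \<nu> = (\<lambda>_. 0)" if \<nu>: "\<nu> \<in> carrier (dual (dual ?A))" for \<nu>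
  proof
    fix f
    show "arens1 ?A \<mu> \<nu> f = 0"
    \<comment> \<open>Were \<open>bidual_act1 ?A \<nu> f\<close> outside the dual, \<mu> would be 0
      there by the convention on functionals, so the other case is immediate.\<close>
    proof (cases "f \<in> carrier (dual ?A) \<and> bidual_act1 ?A \<nu> f \<in> carrier (dual ?A)")
      case True
      then have f: "f \<in> carrier (dual ?A)" by simp
      interpret D: cseminormed "dual ?A" by (rule dual_cseminormed)
      let ?c = "vnorm (dual (dual ?A)) \<nu> * vnorm (dual ?A) f"
      have "cmod (bidual_act1 ?A \<nu> f (\<Phi> n)) \<le> ?c * \<epsilon> n" for n
      proof -
        have "cmod (\<nu> (act1 ?A f (\<Phi> n))) \<le> vnorm (dual (dual ?A)) \<nu> * vnorm (dual ?A) (act1 ?A f (\<Phi> n))"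
          by (rule D.dual_bound[OF \<nu> act(1)[OF f]])
        also have "\<dots> \<le> vnorm (dual (dual ?A)) \<nu> * (\<epsilon> n * vnorm (dual ?A) f)"
          by (rule mult_left_mono[OF act(2)[OF f] D.dual_norm_nonneg[OF \<nu>]])
        finally show ?thesis
          using \<Phi>(1) by (simp add: bidual_act1_def mult_ac)
      qed
      moreover have "(\<lambda>n. ?c * \<epsilon> n) \<longlonglongrightarrow> 0"
        using tendsto_mult_left[OF \<epsilon>(1), of ?c] by simp
      ultimately have "(\<lambda>n. bidual_act1 ?A \<nu> f (\<Phi> n)) \<longlonglongrightarrow> 0"
        by (rule Lim_null_comparison[OF always_eventually[OF allI]])
      then show ?thesis
        using \<mu>_null True by (simp add: arens1_def)
    next
      case False
      then show ?thesis
        using dual_outside[OF \<mu>] by (auto simp: arens1_def)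
    qed
  qed
  let ?\<sigma> = "weak_star_topology (dual ?A)"
  have zero: "(\<lambda>_. 0) \<in> topspace ?\<sigma>"
  proof -
    have "(\<lambda>_. 0) \<in> carrier (dual (dual ?A))"
      by (auto simp: dual_iff intro!: exI[of _ 0])
    moreover have "openin ?\<sigma> {\<nu>\<in>carrier (dual (dual ?A)). \<nu> h \<in> UNIV}"
      unfolding weak_star_topology_def
      by (rule topology_generated_by_Basis) (use h(1) open_UNIV in blast)
    ultimately show ?thesis
      using openin_subset by fastforce
  qed
  have "continuous_map ?\<sigma> ?\<sigma> (\<lambda>\<nu>. arens1 ?A \<mu> \<nu>)"
  proof (rule continuous_map_eq)
    show "continuous_map ?\<sigma> ?\<sigma> (\<lambda>_ _. 0)"
      using zero by simp
    fix \<nu> assume "\<nu> \<in> topspace ?\<sigma>"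
    then have "\<nu> \<in> carrier (dual (dual ?A))"
      unfolding weak_star_topology_def topology_generated_by_topspace by blast
    then show "(\<lambda>_. 0) = arens1 ?A \<mu> \<nu>"
      by (rule prod[symmetric])
  qed
  with sAir \<mu> have "\<mu> \<in> canonical_embedding ?A ` carrier ?A"
    by (simp add: strongly_Arens_irregular_def Let_def)
  then obtain u where u: "u \<in> carrier ?A" "\<mu> = canonical_embedding ?A u"
    by blast
  have "u x = 0" for x
  proof (cases "x \<in> carrier G")
    case True
    \<comment> \<open>The product of \<Phi> n and \<delta> has norm at most \<epsilon> n times that
      of \<delta> and takes the value \<Phi> n x at x; thus \<Phi> n tends to 0 pointwise.\<close>
    define \<delta> where "\<delta> = (\<lambda>y. of_bool (y = x) :: complex)"
    have \<delta>: "\<delta> \<in> carrier ?A"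
      by (rule finite_support_in_fourier_algebra[of "{x}"]) (use True in \<open>auto simp: \<delta>_def\<close>)
    define ev where "ev = (\<lambda>v. if v \<in> carrier ?A then v x else (0::complex))"
    have ev: "ev \<in> carrier (dual ?A)"
      by (rule dualI[where C = 1])
         (auto simp: ev_def fourier_algebra_add fourier_algebra_cmult cmod_le_fourier_norm)
    have "cmod (ev (\<Phi> n)) \<le> \<epsilon> n * fourier_norm G \<delta>" for n
      using cmod_le_fourier_norm[OF mult[OF \<delta>, of n], of x] mult_le[OF \<delta>, of n] \<Phi>(1)
      by (simp add: ev_def \<delta>_def)
    moreover have "(\<lambda>n. \<epsilon> n * fourier_norm G \<delta>) \<longlonglongrightarrow> 0"
      using tendsto_mult_right[OF \<epsilon>(1), of "fourier_norm G \<delta>"] by simp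
    ultimately have "(\<lambda>n. ev (\<Phi> n)) \<longlonglongrightarrow> 0"
      by (rule Lim_null_comparison[OF always_eventually[OF allI]])
    then have "\<mu> ev = 0"
      by (rule \<mu>_null[OF ev])
    then show ?thesis
      using u ev by (simp add: canonical_embedding_def ev_def)
  qed (rule fourier_algebra_outside[OF u(1)])
  then have "u = (\<lambda>x. 0 * u x)" by auto
  then have "h u = 0"
    using dual_scale[OF h(1) u(1), of 0] by simp
  then have "\<mu> h = 0"
    using u h(1) by (simp add: canonical_embedding_def)
  moreover have "\<mu> h = 1"
    using h by (simp add: \<mu>_def ultra_functional_def ulim_eq_sequentially)
  ultimately show False by simp
qed

text \<open>
  The conjugates \<open>a\<^sup>i b a\<^sup>-\<^sup>i\<close> generate infinite cyclic groups that are free from each other.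
\<close>

locale ping_pong = group G for G (structure) +
  fixes a b :: 'a and B :: "'a set"
  assumes a: "a \<in> carrier G" and b: "b \<in> carrier G"
    and ping: "y \<in> carrier G \<Longrightarrow> y \<notin> B \<Longrightarrow> (k::int) \<noteq> 0 \<Longrightarrow> b [^] k \<otimes> y \<in> B"
    and pong: "y \<in> B \<Longrightarrow> (k::int) \<noteq> 0 \<Longrightarrow> a [^] k \<otimes> y \<notin> B"
    and pow_notin: "a [^] (k::int) \<notin> B"
begin

definition conjugate :: "int \<Rightarrow> 'a" where
  "conjugate i = a [^] i \<otimes> b \<otimes> inv (a [^] i)"

text \<open>The set a^i B, on which a^i b a^-i plays ping-pong; \<open>pong\<close> makes these sets
  pairwise disjoint.\<close>

definition translate :: "int \<Rightarrow> 'a set" where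
  "translate i = {y\<in>carrier G. inv (a [^] i) \<otimes> y \<in> B}"

lemma conjugate_closed [simp]: "conjugate i \<in> carrier G"
  using a b by (simp add: conjugate_def)

lemma conjugate_pow: "conjugate i [^] (k::int) = a [^] i \<otimes> b [^] k \<otimes> inv (a [^] i)"
proof -
  let ?h = "\<lambda>y. a [^] i \<otimes> y \<otimes> inv (a [^] i)"
  have "?h \<in> hom G G"
  proof (rule homI)
    fix x y assume xy: "x \<in> carrier G" "y \<in> carrier G"
    have "inv (a [^] i) \<otimes> (a [^] i \<otimes> z) = z" if "z \<in> carrier G" for z
      using that a by (simp add: m_assoc[symmetric])
    then show "?h (x \<otimes> y) = ?h x \<otimes> ?h y"
      using xy a by (simp add: m_assoc)
  qed (use a in simp)
  from hom_int_pow[OF this b is_group is_group, of k] show ?thesis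
    by (simp add: conjugate_def)
qed

lemma conjugate_pow_translate:
  assumes "y \<in> carrier G" "y \<notin> translate i" "k \<noteq> 0"
  shows "conjugate i [^] (k::int) \<otimes> y \<in> translate i"
proof -
  have "inv (a [^] i) \<otimes> (conjugate i [^] k \<otimes> y) = b [^] k \<otimes> (inv (a [^] i) \<otimes> y)"
    using assms(1) a b by (simp add: conjugate_pow m_assoc[symmetric])
  moreover have "b [^] k \<otimes> (inv (a [^] i) \<otimes> y) \<in> B"
    using assms a by (intro ping) (auto simp: translate_def)
  ultimately show ?thesis
    using assms(1) by (simp add: translate_def)
qed

lemma translate_disjoint:
  assumes "i \<noteq> j"
  shows "translate i \<inter> translate j = {}"
proof (rule ccontr)
  assume "translate i \<inter> translate j \<noteq> {}"
  then obtain y where y: "y \<in> carrier G" "inv (a [^] i) \<otimes> y \<in> B" "inv (a [^] j) \<otimes> y \<in> B"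
    by (auto simp: translate_def)
  have "a [^] (i - j) = inv (a [^] j) \<otimes> a [^] i"
    using a by (metis diff_conv_add_uminus add.commute int_pow_mult int_pow_neg)
  then have "a [^] (i - j) \<otimes> (inv (a [^] i) \<otimes> y) = inv (a [^] j) \<otimes> y"
    using y(1) a by (simp add: m_assoc) (simp add: m_assoc[symmetric])
  with y pong[OF y(2), of "i - j"] assms show False by auto
qed

text \<open>The identity serves as base point: nonzero powers of a conjugate carry it into the
  corresponding translate, which yields infinite order and separates the powers of different
  conjugates.\<close>

lemma one_notin_translate: "\<one> \<notin> translate i"
  using pow_notin[of "- i"] a by (simp add: translate_def int_pow_neg)

lemma conjugate_pow_in_translate: "k \<noteq> 0 \<Longrightarrow> conjugate i [^] (k::int) \<in> translate i"
  using conjugate_pow_translate[of \<one> i k] one_notin_translate by simp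

lemma infinite_order_conjugate: "infinite_order (conjugate i)"
  using conjugate_pow_in_translate one_notin_translate by (metis infinite_order_def conjugate_closed)

lemma infinite_order_b: "infinite_order b"
  using infinite_order_conjugate[of 0] b by (simp add: conjugate_def)

lemma conjugate_pow_eq_iff:
  assumes "k \<noteq> 0"
  shows "conjugate i [^] (k::int) = conjugate j [^] l \<longleftrightarrow> i = j \<and> k = l"
proof
  assume eq: "conjugate i [^] k = conjugate j [^] l"
  have "i = j"
  proof (rule ccontr)
    assume "i \<noteq> j"
    have "l \<noteq> 0"
      using eq conjugate_pow_in_translate[OF assms, of i] one_notin_translate by auto
    then show False
      using eq conjugate_pow_in_translate[of k i] conjugate_pow_in_translate[of l j] translate_disjoint[OF \<open>i \<noteq> j\<close>] assms
      by auto
  qed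
  with eq show "i = j \<and> k = l"
    by (simp add: int_pow_eq_iff[OF infinite_order_conjugate])
qed simp

text \<open>\<open>ping_pong_bound\<close> with the translates as sets. Within a class, quotients of
  two elements are again powers of the same conjugate, nonzero by injectivity; positivity makes k p
  and - k p nonzero.\<close>

lemma conjugate_pow_pairing_bound:
  fixes c :: "'p \<Rightarrow> complex" and i k :: "'p \<Rightarrow> int"
  assumes P: "finite P" and pos: "\<And>p. p \<in> P \<Longrightarrow> k p > 0"
    and inj: "inj_on (\<lambda>p. (i p, k p)) P"
    and B0: "M \<ge> 0" "\<And>j. (\<Sum>p\<in>{p\<in>P. i p = j}. cmod (c p)) \<le> M"
    and D: "D \<ge> 0" "(\<Sum>p\<in>P. (cmod (c p))\<^sup>2) \<le> D\<^sup>2"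
    and u: "u \<in> carrier (fourier_algebra G)"
  shows "cmod (\<Sum>p\<in>P. c p * u (conjugate (i p) [^] k p)) \<le> (M + 2 * D) * fourier_norm G u"
proof (rule fourier_pairing_bound[OF P _ u])
  fix \<xi> \<eta> assume l2: "\<xi> \<in> l2 G" "\<eta> \<in> l2 G"
  have ne: "k p \<noteq> k q" if "p \<in> P" "q \<in> P" "p \<noteq> q" "i p = i q" for p q
    using inj that by (auto simp: inj_on_def)
  have inv_mult: "inv (conjugate j [^] (l::int)) \<otimes> (conjugate j [^] (m::int) \<otimes> y) = conjugate j [^] (m - l) \<otimes> y"
    "conjugate j [^] (l::int) \<otimes> (inv (conjugate j [^] (m::int)) \<otimes> y) = conjugate j [^] (l - m) \<otimes> y"
    if "y \<in> carrier G" for j l m y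
    using that by (simp_all add: m_assoc[symmetric] int_pow_neg[symmetric] int_pow_mult[symmetric])
  show "cmod (\<Sum>p\<in>P. c p * coef G \<xi> \<eta> (conjugate (i p) [^] k p)) \<le> (M + 2 * D) * (l2_norm G \<xi> * l2_norm G \<eta>)"
  proof (rule ping_pong_bound[OF P, where W = translate and cls = i])
    fix p y assume p: "p \<in> P" "y \<in> carrier G" "y \<notin> translate (i p)"
    show "conjugate (i p) [^] k p \<otimes> y \<in> translate (i p)"
      using conjugate_pow_translate[OF p(2,3), of "k p"] pos[OF p(1)] by simp
    show "inv (conjugate (i p) [^] k p) \<otimes> y \<in> translate (i p)"
      using conjugate_pow_translate[OF p(2,3), of "- k p"] pos[OF p(1)] by (simp add: int_pow_neg)
    fix q assume q: "q \<in> P" "p \<noteq> q" "i p = i q"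
    show "inv (conjugate (i p) [^] k p) \<otimes> (conjugate (i q) [^] k q \<otimes> y) \<in> translate (i p)"
      using conjugate_pow_translate[OF p(2,3), of "k q - k p"] ne[OF p(1) q(1) q(2,3)] q(3) inv_mult(1)[OF p(2)] by simp
    show "conjugate (i p) [^] k p \<otimes> (inv (conjugate (i q) [^] k q) \<otimes> y) \<in> translate (i p)"
      using conjugate_pow_translate[OF p(2,3), of "k p - k q"] ne[OF p(1) q(1) q(2,3)] q(3) inv_mult(2)[OF p(2)] by simp
  qed (rule conjugate_closed int_pow_closed translate_disjoint B0 D l2 | assumption)+
qed (use B0 D in simp_all)

text \<open>Pairing u with the conjugates of its own values gives s^2. A class of at most N members
  has l1-weight at most sqrt N times s by Cauchy-Schwarz, and one factor s cancels.\<close>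

lemma sum_square_conjugate_pow_le:
  fixes i k :: "'p \<Rightarrow> int"
  assumes P: "finite P" and pos: "\<And>p. p \<in> P \<Longrightarrow> k p > 0"
    and inj: "inj_on (\<lambda>p. (i p, k p)) P"
    and N: "\<And>j. card {p\<in>P. i p = j} \<le> N"
    and u: "u \<in> carrier (fourier_algebra G)"
  shows "sqrt (\<Sum>p\<in>P. (cmod (u (conjugate (i p) [^] k p)))\<^sup>2) \<le> (sqrt (real N) + 2) * fourier_norm G u"
proof -
  define v where "v = (\<lambda>p. u (conjugate (i p) [^] k p))"
  define s where "s = sqrt (\<Sum>p\<in>P. (cmod (v p))\<^sup>2)"
  have s0: "s \<ge> 0" by (simp add: s_def sum_nonneg)
  have s2: "(\<Sum>p\<in>P. (cmod (v p))\<^sup>2) = s\<^sup>2"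
    by (simp add: s_def sum_nonneg)
  have "cmod (\<Sum>p\<in>P. cnj (v p) * u (conjugate (i p) [^] k p)) \<le> (sqrt (real N) * s + 2 * s) * fourier_norm G u"
  proof (rule conjugate_pow_pairing_bound[OF P pos inj _ _ s0 _ u])
    fix j
    let ?Q = "{p\<in>P. i p = j}"
    have "(\<Sum>p\<in>?Q. cmod (cnj (v p))) = (\<Sum>p\<in>?Q. \<bar>1\<bar> * \<bar>cmod (v p)\<bar>)" by simp
    also have "\<dots> \<le> L2_set (\<lambda>_. 1) ?Q * L2_set (\<lambda>p. cmod (v p)) ?Q"
      by (rule L2_set_mult_ineq)
    also have "\<dots> \<le> sqrt (real N) * s"
      unfolding L2_set_def s_def using N[of j] P
      by (intro mult_mono real_sqrt_le_mono sum_mono2) (auto intro!: sum_nonneg)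
    finally show "(\<Sum>p\<in>?Q. cmod (cnj (v p))) \<le> sqrt (real N) * s" .
  qed (use s0 s2 in auto)
  moreover have "(\<Sum>p\<in>P. cnj (v p) * u (conjugate (i p) [^] k p)) = of_real (s\<^sup>2)"
    unfolding s2[symmetric] v_def of_real_sum by (intro sum.cong refl) (simp only: complex_norm_square mult.commute)
  ultimately have "s\<^sup>2 \<le> (sqrt (real N) * s + 2 * s) * fourier_norm G u"
    by (simp only: norm_of_real abs_power2)
  then have "s * s \<le> s * ((sqrt (real N) + 2) * fourier_norm G u)"
    by (simp add: power2_eq_square algebra_simps)
  then have "s \<le> (sqrt (real N) + 2) * fourier_norm G u"
    using s0 fourier_norm_nonneg[OF u] by (cases "s = 0") auto
  then show ?thesis by (simp add: s_def v_def)
qed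


text \<open>The ranges for different n are disjoint, so different levels use different, mutually
  free conjugates.\<close>

definition gens :: "nat \<Rightarrow> int set" where
  "gens n = {4 ^ n..<2 * 4 ^ n}"

text \<open>On each conjugate the height is 1 / 4^n for exponents from 8^n to 2 * 8^n, with slopes
  down to 0 at the exponents 0 and 3 * 8^n. Each of the 4^n summands has norm at most sqrt 2 /
  4^n.\<close>

definition bump :: "nat \<Rightarrow> 'a \<Rightarrow> complex" where
  "bump n x = (\<Sum>i\<in>gens n. of_real (1 / 4 ^ n) * block_coef (conjugate i) (8 ^ n) (8 ^ n) (2 * 8 ^ n) x)"

text \<open>Samples the flat part of \<open>bump n\<close>: 4^n * 8^n points, height 1 / 4^n and
  weight 1 / 8^n give the value 1.\<close>

definition bump_dual :: "nat \<Rightarrow> ('a \<Rightarrow> complex) \<Rightarrow> complex" where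
  "bump_dual n u = (\<Sum>(i, k)\<in>gens n \<times> {8 ^ n..<2 * 8 ^ n}. of_real (1 / 8 ^ n) * u (conjugate i [^] (k::int)))"

lemma finite_gens [simp]: "finite (gens n)" and card_gens: "card (gens n) = 4 ^ n"
  by (simp_all add: gens_def nat_power_eq)

lemma gens_unique:
  assumes "i \<in> gens n" "i \<in> gens m"
  shows "n = m"
proof -
  have False if "n < m" "i \<in> gens n" "i \<in> gens m" for n m
  proof -
    have "(4::int) ^ Suc n \<le> 4 ^ m" using \<open>n < m\<close> by (intro power_increasing) auto
    moreover have "(0::int) < 4 ^ n" by simp
    ultimately show False using that by (simp add: gens_def)
  qed
  with assms show ?thesis by (metis linorder_neqE_nat)
qed

lemma bump_conjugate_pow:
  assumes "i \<in> gens m" "k \<noteq> 0"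
  shows "bump n (conjugate i [^] (k::int)) =
    (if n = m then of_real (1 / 4 ^ n) * block_coef (conjugate i) (8 ^ n) (8 ^ n) (2 * 8 ^ n) (conjugate i [^] k) else 0)"
proof -
  have z: "block_coef (conjugate j) (8 ^ n) (8 ^ n) (2 * 8 ^ n) (conjugate i [^] k) = 0" if "j \<noteq> i" for j
    by (rule block_coef_eq_0[OF infinite_order_conjugate]) (use that conjugate_pow_eq_iff[OF assms(2)] in auto)
  show ?thesis
  proof (cases "n = m")
    case True
    have "bump n (conjugate i [^] k) = (\<Sum>j\<in>gens n. if j = i then
        of_real (1 / 4 ^ n) * block_coef (conjugate i) (8 ^ n) (8 ^ n) (2 * 8 ^ n) (conjugate i [^] k) else 0)"
      unfolding bump_def by (intro sum.cong refl) (simp add: z)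
    then show ?thesis
      using True assms by simp
  next
    case False
    then have "j \<noteq> i" if "j \<in> gens n" for j
      using that assms gens_unique by blast
    then show ?thesis
      using False unfolding bump_def by (simp add: z)
  qed
qed

lemma bump_support:
  assumes "x \<notin> (\<lambda>(i, k). conjugate i [^] (k::int)) ` (gens n \<times> {0<..<3 * 8 ^ n})"
  shows "bump n x = 0"
proof -
  have "block_coef (conjugate i) (8 ^ n) (8 ^ n) (2 * 8 ^ n) x = 0" if "i \<in> gens n" for i
    by (rule block_coef_eq_0[OF infinite_order_conjugate]) (use that assms in \<open>auto simp: image_iff\<close>)
  then show ?thesis by (simp add: bump_def)
qed

lemma bump_in_fourier_algebra:
  "bump n \<in> carrier (fourier_algebra G)" "fourier_norm G (bump n) \<le> 2"
proof -
  let ?\<xi> = "\<lambda>i y. of_real (1 / 4 ^ n) * (of_real (1 / real (8 ^ n)) * block (conjugate i) 0 (8 ^ n) y)"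
  let ?\<eta> = "\<lambda>i. block (conjugate i) (8 ^ n) (2 * 8 ^ n)"
  have 1: "?\<xi> i \<in> l2 G" "?\<eta> i \<in> l2 G" for i
    by (intro l2_cmult block_l2 infinite_order_conjugate)+
  have 2: "bump n x = (\<Sum>i\<in>gens n. coef G (?\<xi> i) (?\<eta> i) x)" for x
    unfolding bump_def block_coef_def coef_cmult_left by simp
  show "bump n \<in> carrier (fourier_algebra G)"
    by (rule fourier_algebraI_finite_sum(1)[OF finite_gens 1 2])
  have "fourier_norm G (bump n) \<le> (\<Sum>i\<in>gens n. l2_norm G (?\<xi> i) * l2_norm G (?\<eta> i))"
    by (rule fourier_algebraI_finite_sum(2)[OF finite_gens 1 2])
  also have "\<dots> = (\<Sum>i\<in>gens n. (1 / 4 ^ n) * sqrt 2)"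
  proof (intro sum.cong refl)
    fix i
    define s where "s = sqrt (real (8 ^ n))"
    have s: "s * s = 8 ^ n" by (simp add: s_def)
    have "l2_norm G (?\<xi> i) = 1 / 4 ^ n * (1 / 8 ^ n * s)"
      unfolding l2_norm_cmult block_l2(2)[OF infinite_order_conjugate] by (simp add: norm_divide norm_power s_def)
    moreover have "l2_norm G (?\<eta> i) = sqrt 2 * s"
      unfolding block_l2(2)[OF infinite_order_conjugate] by (simp add: s_def real_sqrt_mult)
    ultimately have "l2_norm G (?\<xi> i) * l2_norm G (?\<eta> i) = 1 / 4 ^ n * (1 / 8 ^ n * sqrt 2) * (s * s)"
      by (simp only: ac_simps)
    then show "l2_norm G (?\<xi> i) * l2_norm G (?\<eta> i) = 1 / 4 ^ n * sqrt 2"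
      unfolding s by simp
  qed
  also have "\<dots> = sqrt 2"
    by (simp add: card_gens)
  also have "\<dots> \<le> 2"
    by (rule real_le_lsqrt) auto
  finally show "fourier_norm G (bump n) \<le> 2" .
qed

text \<open>The product has finite support, so its norm is at most its l2-norm: the height 1 / 4^n
  times the l2-norm of u on the support, which has fewer than 3 * 8^n points on each
  subgroup.\<close>

lemma bump_multiplier:
  assumes u: "u \<in> carrier (fourier_algebra G)"
  shows "(\<lambda>x. bump n x * u x) \<in> carrier (fourier_algebra G)"
    and "fourier_norm G (\<lambda>x. bump n x * u x) \<le> (sqrt (3 * 8 ^ n) + 2) / 4 ^ n * fourier_norm G u"
proof -
  let ?P = "gens n \<times> {0<..<3 * 8 ^ n :: int}" and ?g = "\<lambda>(i, k). conjugate i [^] (k::int)"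
  have inj: "inj_on ?g ?P"
    by (rule inj_onI) (auto simp: conjugate_pow_eq_iff)
  have F: "finite (?g ` ?P)" "?g ` ?P \<subseteq> carrier G"
    by auto
  have z: "bump n x * u x = 0" if "x \<notin> ?g ` ?P" for x
    using bump_support[OF that] by simp
  show "(\<lambda>x. bump n x * u x) \<in> carrier (fourier_algebra G)"
    by (rule finite_support_in_fourier_algebra(1)[OF F z])
  have le: "cmod (bump n (?g p) * u (?g p)) \<le> 1 / 4 ^ n * cmod (u (conjugate (fst p) [^] snd p))" if "p \<in> ?P" for p
  proof -
    have "cmod (bump n (?g p)) \<le> 1 / 4 ^ n"
      using that cmod_block_coef_le[OF infinite_order_conjugate, of "fst p" "8 ^ n" "8 ^ n" "2 * 8 ^ n" "?g p"]
      by (auto simp: bump_conjugate_pow norm_mult norm_divide norm_power divide_right_mono)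
    then show ?thesis
      unfolding norm_mult case_prod_unfold by (rule mult_right_mono) simp
  qed
  have "fourier_norm G (\<lambda>x. bump n x * u x) \<le> sqrt (\<Sum>x\<in>?g ` ?P. (cmod (bump n x * u x))\<^sup>2)"
    by (rule finite_support_in_fourier_algebra(2)[OF F z])
  also have "\<dots> = sqrt (\<Sum>p\<in>?P. (cmod (bump n (?g p) * u (?g p)))\<^sup>2)"
    by (simp add: sum.reindex[OF inj] comp_def)
  also have "\<dots> \<le> sqrt (\<Sum>p\<in>?P. (1 / 4 ^ n)\<^sup>2 * (cmod (u (conjugate (fst p) [^] snd p)))\<^sup>2)"
    unfolding power_mult_distrib[symmetric] by (intro real_sqrt_le_mono sum_mono power_mono le) auto
  also have "\<dots> = 1 / 4 ^ n * sqrt (\<Sum>p\<in>?P. (cmod (u (conjugate (fst p) [^] snd p)))\<^sup>2)"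
    unfolding sum_distrib_left[symmetric] real_sqrt_mult by simp
  also have "\<dots> \<le> 1 / 4 ^ n * ((sqrt (real (3 * 8 ^ n)) + 2) * fourier_norm G u)"
  proof (intro mult_left_mono sum_square_conjugate_pow_le[OF _ _ _ _ u])
    show "inj_on (\<lambda>p. (fst p, snd p)) ?P" by simp
    show "card {p\<in>?P. fst p = j} \<le> 3 * 8 ^ n" for j
    proof -
      have "card {p\<in>?P. fst p = j} \<le> card (Pair j ` {0<..<3 * 8 ^ n :: int})"
        by (intro card_mono) auto
      also have "\<dots> \<le> card {0<..<3 * 8 ^ n :: int}"
        by (rule card_image_le) simp
      also have "\<dots> \<le> 3 * 8 ^ n"
        by (simp add: nat_le_iff)
      finally show ?thesis .
    qed
  qed auto
  finally show "fourier_norm G (\<lambda>x. bump n x * u x) \<le> (sqrt (3 * 8 ^ n) + 2) / 4 ^ n * fourier_norm G u"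
    by simp
qed

lemma bump_dual_bump: "bump_dual m (bump n) = of_bool (m = n)"
proof -
  have "bump_dual m (bump n) = (\<Sum>(i, k)\<in>gens m \<times> {8 ^ m..<2 * 8 ^ m :: int}. of_real (1 / 8 ^ m) * (of_real (1 / 4 ^ m) * of_bool (m = n)))"
    unfolding bump_dual_def
  proof (intro sum.cong refl, clarify)
    fix i k :: int assume ik: "i \<in> gens m" "k \<in> {8 ^ m..<2 * 8 ^ m}"
    have "k > 0" using ik(2) by (simp add: less_le_trans[of 0 "8 ^ m"])
    have "block_coef (conjugate i) (8 ^ m) (8 ^ m) (2 * 8 ^ m) (conjugate i [^] k) = 1"
      using ik(2) by (intro block_coef_eq_1 infinite_order_conjugate) auto
    then show "of_real (1 / 8 ^ m) * bump n (conjugate i [^] k) = of_real (1 / 8 ^ m) * (of_real (1 / 4 ^ m) * of_bool (m = n))"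
      using bump_conjugate_pow[OF ik(1), of k n] \<open>k > 0\<close> by auto
  qed
  also have "\<dots> = of_nat (4 ^ m * nat (8 ^ m)) * (of_real (1 / 8 ^ m) * (of_real (1 / 4 ^ m) * of_bool (m = n)))"
    by (simp add: case_prod_unfold card_cartesian_product card_gens del: nat_power_eq)
  also have "\<dots> = of_bool (m = n)"
    by (simp add: nat_power_eq)
  finally show ?thesis .
qed

text \<open>Each conjugate belongs to one level only and carries l1-weight 8^n / 8^n = 1. The
  squares of the weights at level n add up to 4^n * 8^n / 64^n = 2^-n, in total less than 2, so that
  D = 2 suffices and the constant is 1 + 2 * 2.\<close>

lemma bump_dual_bound:
  assumes u: "u \<in> carrier (fourier_algebra G)" and c: "\<And>n. cmod (c n) \<le> 1"
  shows "cmod (\<Sum>n<K. c n * bump_dual n u) \<le> 5 * fourier_norm G u"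
proof -
  define P where "P = Sigma {..<K} (\<lambda>n. gens n \<times> {8 ^ n..<2 * 8 ^ n :: int})"
  have P: "finite P" by (auto simp: P_def)
  define d where "d = (\<lambda>(n, i :: int, k :: int). c n * of_real (1 / 8 ^ n))"
  have dle: "cmod (d (n, i, k)) \<le> 1 / 8 ^ n" for n i k
    using c[of n] by (simp add: d_def norm_mult norm_divide norm_power divide_right_mono)
  have "(\<Sum>n<K. c n * bump_dual n u) = (\<Sum>n<K. \<Sum>(i, k)\<in>gens n \<times> {8 ^ n..<2 * 8 ^ n}. d (n, i, k) * u (conjugate i [^] k))"
    by (simp add: bump_dual_def d_def sum_distrib_left case_prod_unfold mult.assoc)
  also have "\<dots> = (\<Sum>p\<in>P. d p * u (conjugate (fst (snd p)) [^] snd (snd p)))"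
    unfolding P_def by (subst sum.Sigma) (auto simp: case_prod_unfold)
  also have "cmod \<dots> \<le> (1 + 2 * 2) * fourier_norm G u"
  proof (rule conjugate_pow_pairing_bound[OF P _ _ _ _ _ _ u])
    show "snd (snd p) > 0" if "p \<in> P" for p
    proof -
      obtain n i k where p: "p = (n, i, k)" by (cases p)
      with that have "8 ^ n \<le> snd (snd p)" by (simp add: P_def)
      moreover have "(0::int) < 8 ^ n" by simp
      ultimately show ?thesis by (rule less_le_trans[rotated])
    qed
    show "inj_on (\<lambda>p. (fst (snd p), snd (snd p))) P"
      unfolding P_def by (intro inj_onI) (auto dest: gens_unique)
    show "(\<Sum>p\<in>{p\<in>P. fst (snd p) = j}. cmod (d p)) \<le> 1" for j
    proof (cases "\<exists>n. j \<in> gens n")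
      case True
      then obtain n where n: "j \<in> gens n" by blast
      let ?Q = "(\<lambda>k. (n, j, k)) ` {8 ^ n..<2 * 8 ^ n :: int}"
      have "{p\<in>P. fst (snd p) = j} \<subseteq> ?Q"
      proof
        fix p assume p: "p \<in> {p\<in>P. fst (snd p) = j}"
        obtain m i k where "p = (m, i, k)" by (cases p)
        with p gens_unique[OF n, of m] show "p \<in> ?Q" by (auto simp: P_def)
      qed
      then have "(\<Sum>p\<in>{p\<in>P. fst (snd p) = j}. cmod (d p)) \<le> (\<Sum>p\<in>?Q. cmod (d p))"
        by (intro sum_mono2) auto
      also have "\<dots> = (\<Sum>k\<in>{8 ^ n..<2 * 8 ^ n :: int}. cmod (d (n, j, k)))"
        by (subst sum.reindex) (auto simp: inj_on_def)
      also have "\<dots> \<le> (\<Sum>k\<in>{8 ^ n..<2 * 8 ^ n :: int}. 1 / 8 ^ n)"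
        by (intro sum_mono dle)
      also have "\<dots> = 1"
        by (simp add: nat_power_eq)
      finally show ?thesis .
    next
      case False
      then have empty: "{p\<in>P. fst (snd p) = j} = {}" by (auto simp: P_def)
      show ?thesis unfolding empty by simp
    qed
    have "(\<Sum>p\<in>P. (cmod (d p))\<^sup>2) = (\<Sum>n<K. \<Sum>q\<in>gens n \<times> {8 ^ n..<2 * 8 ^ n :: int}. (cmod (d (n, q)))\<^sup>2)"
      unfolding P_def by (subst sum.Sigma) auto
    also have "\<dots> \<le> (\<Sum>n<K. \<Sum>q\<in>gens n \<times> {8 ^ n..<2 * 8 ^ n :: int}. (1 / 8 ^ n)\<^sup>2)"
      by (intro sum_mono power_mono) (use dle in auto)
    also have "\<dots> = (\<Sum>n<K. (1 / 2) ^ n)"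
    proof (intro sum.cong refl)
      fix n
      have "(8::real) ^ n = 4 ^ n * 2 ^ n"
        by (simp flip: power_mult_distrib)
      then have "(\<Sum>q\<in>gens n \<times> {8 ^ n..<2 * 8 ^ n :: int}. (1 / 8 ^ n)\<^sup>2) = (4 * 8 / 8\<^sup>2 :: real) ^ n"
        by (simp add: card_cartesian_product card_gens nat_power_eq power_divide power_mult_distrib power2_eq_square)
      then show "(\<Sum>q\<in>gens n \<times> {8 ^ n..<2 * 8 ^ n :: int}. (1 / 8 ^ n)\<^sup>2) = (1 / 2 :: real) ^ n"
        by simp
    qed
    also have "\<dots> = 2 - 2 * (1 / 2) ^ K"
      by (simp add: geometric_sum)
    also have "\<dots> \<le> 2\<^sup>2"
    proof -
      have "(0::real) \<le> (1 / 2) ^ K" by simp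
      then show ?thesis unfolding power2_eq_square by linarith
    qed
    finally show "(\<Sum>p\<in>P. (cmod (d p))\<^sup>2) \<le> 2\<^sup>2" .
  qed auto
  finally show ?thesis by simp
qed

theorem not_strongly_Arens_irregular: "\<not> strongly_Arens_irregular (fourier_algebra G)"
proof (rule not_strongly_Arens_irregularI[where \<Phi> = bump and C = 2 and
      \<epsilon> = "\<lambda>n. (sqrt (3 * 8 ^ n) + 2) / 4 ^ n" and
      h = "\<lambda>u. if u \<in> carrier (fourier_algebra G) then \<Sum>n. 1 * bump_dual n u else 0"])
  show "bump n \<in> carrier (fourier_algebra G)" "fourier_norm G (bump n) \<le> 2" for n
    by (rule bump_in_fourier_algebra)+
  fix n and u :: "'a \<Rightarrow> complex" assume u: "u \<in> carrier (fourier_algebra G)"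
  show "(\<lambda>x. bump n x * u x) \<in> carrier (fourier_algebra G)"
    by (rule bump_multiplier(1)[OF u])
  show "fourier_norm G (\<lambda>x. bump n x * u x) \<le> (sqrt (3 * 8 ^ n) + 2) / 4 ^ n * fourier_norm G u"
    by (rule bump_multiplier(2)[OF u])
next
  have "(\<lambda>n::nat. sqrt 3 * (sqrt 8 / 4) ^ n + 2 * (1 / 4) ^ n) \<longlonglongrightarrow> sqrt 3 * 0 + 2 * 0"
  proof (intro tendsto_intros LIMSEQ_realpow_zero)
    have "sqrt 8 < (4::real)" by (rule real_less_lsqrt) auto
    then show "norm (sqrt 8 / 4 :: real) < 1" by simp
  qed auto
  moreover have "(sqrt (3 * 8 ^ n) + 2) / 4 ^ n = sqrt 3 * (sqrt 8 / 4) ^ n + 2 * (1 / 4) ^ n" for n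
    by (simp add: real_sqrt_mult real_sqrt_power add_divide_distrib power_divide)
  ultimately show "(\<lambda>n. (sqrt (3 * 8 ^ n) + 2) / 4 ^ n) \<longlonglongrightarrow> 0"
    by simp
  let ?f = "\<lambda>u. if u \<in> carrier (fourier_algebra G) then \<Sum>n. 1 * bump_dual n u else 0"
  show "?f \<in> carrier (dual (fourier_algebra G))"
  proof (rule fourier_series_functional)
    show "cmod (\<Sum>n<K. c n * bump_dual n u) \<le> 5 * fourier_norm G u"
      if "u \<in> carrier (fourier_algebra G)" "\<And>n. cmod (c n) \<le> 1" for K c u
      using that by (rule bump_dual_bound)
    show "cmod 1 \<le> 1" by simp
  qed (simp_all add: bump_dual_def case_prod_unfold distrib_left sum.distrib sum_distrib_left mult.left_commute)
  show "?f (bump n) = 1" for n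
    using suminf_finite[of "{n}" "\<lambda>m. bump_dual m (bump n)"] bump_in_fourier_algebra(1)
    by (simp add: bump_dual_bump)
qed simp

end

section \<open>Separability\<close>

lemma l2_norm_triangle:
  assumes "\<xi> \<in> l2 G" "\<eta> \<in> l2 G"
  shows "l2_norm G (\<lambda>y. \<xi> y + \<eta> y) \<le> l2_norm G \<xi> + l2_norm G \<eta>"
proof -
  have "(\<Sum>\<^sub>\<infinity>y\<in>carrier G. (cmod (\<xi> y + \<eta> y))\<^sup>2) \<le> (l2_norm G \<xi> + l2_norm G \<eta>)\<^sup>2"
  proof (rule infsum_le_finite_sums)
    show "(\<lambda>y. (cmod (\<xi> y + \<eta> y))\<^sup>2) summable_on carrier G"
      using l2_add[OF assms] by (simp add: l2_def)
    fix F assume F: "finite F" "F \<subseteq> carrier G"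
    have L: "L2_set (\<lambda>y. cmod (\<zeta> y)) F \<le> l2_norm G \<zeta>" if "\<zeta> \<in> l2 G" for \<zeta>
      unfolding L2_set_def using sum_le_l2_norm_power2[OF that F] by (simp add: real_le_lsqrt)
    have "L2_set (\<lambda>y. cmod (\<xi> y + \<eta> y)) F \<le> L2_set (\<lambda>y. cmod (\<xi> y) + cmod (\<eta> y)) F"
      by (intro L2_set_mono norm_triangle_ineq) auto
    also have "\<dots> \<le> L2_set (\<lambda>y. cmod (\<xi> y)) F + L2_set (\<lambda>y. cmod (\<eta> y)) F"
      by (rule L2_set_triangle_ineq)
    also have "\<dots> \<le> l2_norm G \<xi> + l2_norm G \<eta>"
      by (intro add_mono L assms)
    finally have "sqrt (\<Sum>y\<in>F. (cmod (\<xi> y + \<eta> y))\<^sup>2) \<le> l2_norm G \<xi> + l2_norm G \<eta>"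
      by (simp add: L2_set_def)
    then show "(\<Sum>y\<in>F. (cmod (\<xi> y + \<eta> y))\<^sup>2) \<le> (l2_norm G \<xi> + l2_norm G \<eta>)\<^sup>2"
      by (rule sqrt_le_D)
  qed
  then show ?thesis
    unfolding l2_norm_def[of G "\<lambda>y. \<xi> y + \<eta> y"] by (intro real_le_lsqrt) auto
qed

text \<open>The dense set consists of the finitely supported functions with values in a countable
  dense set of scalars. The squared error is at most e^2 / 4 from the tail and e^2 / 4 from the
  points of F.\<close>

lemma l2_separable:
  fixes G :: "('a, 'm) monoid_scheme"
  assumes "countable (carrier G)"
  shows "\<exists>D. countable D \<and> D \<noteq> {} \<and> D \<subseteq> l2 G \<and> (\<forall>\<xi>\<in>l2 G. \<forall>e>0. \<exists>d\<in>D. l2_norm G (\<lambda>y. \<xi> y - d y) < e)"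
proof -
  obtain Q :: "complex set" where Q: "countable Q" "\<And>X. open X \<Longrightarrow> X \<noteq> {} \<Longrightarrow> \<exists>d\<in>Q. d \<in> X"
    using countable_dense_exists by blast
  define ext where "ext = (\<lambda>F (f :: 'a \<Rightarrow> complex) y. if y \<in> F then f y else 0)"
  define D where "D = (\<Union>F\<in>{F. finite F \<and> F \<subseteq> carrier G}. ext F ` PiE F (\<lambda>_. Q))"
  have "countable D"
    unfolding D_def using assms Q(1)
    by (intro countable_UN countable_image countable_PiE countable_Collect_finite_subset) auto
  moreover have "D \<noteq> {}"
    unfolding D_def by (auto intro!: exI[of _ "{}"])
  moreover have "D \<subseteq> l2 G"
    unfolding D_def ext_def by (auto intro: l2_finite_support)
  moreover have "\<exists>d\<in>D. l2_norm G (\<lambda>y. \<xi> y - d y) < e" if \<xi>: "\<xi> \<in> l2 G" and e: "e > 0" for \<xi> e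
  proof -
    have s: "(\<lambda>y. (cmod (\<xi> y))\<^sup>2) summable_on carrier G"
      using \<xi> by (simp add: l2_def)
    have "e\<^sup>2 / 4 > 0" using e by simp
    from infsum_finite_approximation[OF s this] obtain F where F: "finite F" "F \<subseteq> carrier G"
      "dist (\<Sum>y\<in>F. (cmod (\<xi> y))\<^sup>2) (\<Sum>\<^sub>\<infinity>y\<in>carrier G. (cmod (\<xi> y))\<^sup>2) \<le> e\<^sup>2 / 4" by blast
    \<comment> \<open>The summand 1 avoids a zero denominator for empty F, and card F \<le> (1 +
      card F)^2 absorbs the number of points.\<close>
    define r where "r = e / (2 * (1 + real (card F)))"
    have r: "r > 0" using e by (simp add: r_def)
    have "\<exists>q\<in>Q. dist (\<xi> y) q < r" for y
      using Q(2)[of "ball (\<xi> y) r"] r by (auto simp: mem_ball)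
    then obtain q where q: "\<And>y. q y \<in> Q" "\<And>y. dist (\<xi> y) (q y) < r" by metis
    define d where "d = ext F (restrict q F)"
    have dD: "d \<in> D"
      unfolding D_def d_def using F q by auto
    have d: "d y = (if y \<in> F then q y else 0)" for y
      by (simp add: d_def ext_def)
    have F1: "(\<Sum>y\<in>F. (cmod (\<xi> y - d y))\<^sup>2) \<le> e\<^sup>2 / 4"
    proof -
      have "(\<Sum>y\<in>F. (cmod (\<xi> y - d y))\<^sup>2) \<le> (\<Sum>y\<in>F. r\<^sup>2)"
        using q(2) by (intro sum_mono power_mono) (auto simp: d dist_norm less_imp_le)
      also have "\<dots> = real (card F) * r\<^sup>2" by simp
      also have "\<dots> \<le> (1 + real (card F))\<^sup>2 * r\<^sup>2"
        by (intro mult_right_mono) (auto simp: power2_eq_square algebra_simps)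
      also have "\<dots> = e\<^sup>2 / 4"
      proof -
        have eq: "(1 + real (card F)) * r = e / 2" unfolding r_def by (simp add: field_simps)
        show ?thesis unfolding power_mult_distrib[symmetric] eq by (simp add: power_divide)
      qed
      finally show ?thesis .
    qed
    have "(l2_norm G (\<lambda>y. \<xi> y - d y))\<^sup>2 = (\<Sum>\<^sub>\<infinity>y\<in>carrier G. (cmod (\<xi> y - d y))\<^sup>2)"
      by (rule l2_norm_power2)
    also have "\<dots> = (\<Sum>\<^sub>\<infinity>y\<in>F \<union> (carrier G - F). (cmod (\<xi> y - d y))\<^sup>2)"
      using F(2) by (intro arg_cong2[where f = infsum]) auto
    also have "\<dots> = (\<Sum>\<^sub>\<infinity>y\<in>F. (cmod (\<xi> y - d y))\<^sup>2) + (\<Sum>\<^sub>\<infinity>y\<in>carrier G - F. (cmod (\<xi> y - d y))\<^sup>2)"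
    proof (rule infsum_Un_disjoint)
      show "(\<lambda>y. (cmod (\<xi> y - d y))\<^sup>2) summable_on carrier G - F"
        using summable_on_subset_banach[OF s, of "carrier G - F"]
        by (rule summable_on_cong[THEN iffD1, rotated]) (auto simp: d)
    qed (use F in auto)
    also have "(\<Sum>\<^sub>\<infinity>y\<in>carrier G - F. (cmod (\<xi> y - d y))\<^sup>2) = (\<Sum>\<^sub>\<infinity>y\<in>carrier G - F. (cmod (\<xi> y))\<^sup>2)"
      by (intro infsum_cong) (auto simp: d)
    also have "\<dots> = (\<Sum>\<^sub>\<infinity>y\<in>carrier G. (cmod (\<xi> y))\<^sup>2) - (\<Sum>\<^sub>\<infinity>y\<in>F. (cmod (\<xi> y))\<^sup>2)"
      using F by (intro infsum_Diff s) auto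
    also have "(\<Sum>\<^sub>\<infinity>y\<in>F. (cmod (\<xi> y - d y))\<^sup>2) + \<dots> \<le> e\<^sup>2 / 4 + e\<^sup>2 / 4"
    proof (intro add_mono)
      show "(\<Sum>\<^sub>\<infinity>y\<in>F. (cmod (\<xi> y - d y))\<^sup>2) \<le> e\<^sup>2 / 4"
        using F(1) F1 by simp
      show "(\<Sum>\<^sub>\<infinity>y\<in>carrier G. (cmod (\<xi> y))\<^sup>2) - (\<Sum>\<^sub>\<infinity>y\<in>F. (cmod (\<xi> y))\<^sup>2) \<le> e\<^sup>2 / 4"
        using F(1,3) unfolding dist_real_def infsum_finite[OF F(1)] by linarith
    qed
    also have "\<dots> < e\<^sup>2" using e by simp
    finally have "l2_norm G (\<lambda>y. \<xi> y - d y) < e"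
      using e by (simp add: power2_less_imp_less)
    with dD show ?thesis by blast
  qed
  ultimately show ?thesis by blast
qed

context group
begin

text \<open>Additivity of f reaches only the partial sums of a representation. The remainder is
  controlled by the boundedness of f, because the tails are elements of the algebra whose norms tend
  to 0.\<close>

lemma dual_le_if_coef_le:
  assumes f: "f \<in> carrier (dual (fourier_algebra G))" and s: "s \<ge> 0"
    and le: "\<And>\<xi> \<eta>. \<xi> \<in> l2 G \<Longrightarrow> \<eta> \<in> l2 G \<Longrightarrow> cmod (f (coef G \<xi> \<eta>)) \<le> s * (l2_norm G \<xi> * l2_norm G \<eta>)"
  shows "vnorm (dual (fourier_algebra G)) f \<le> s"
proof -
  interpret cseminormed_algebra "fourier_algebra G" by (rule cseminormed_algebra_fourier)
  let ?A = "fourier_algebra G"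
  let ?C = "vnorm (dual ?A) f"
  have rep_le: "cmod (f u) \<le> s * (\<Sum>n. l2_norm G (\<xi> n) * l2_norm G (\<eta> n))"
    if u: "u \<in> carrier ?A" and r: "fourier_rep G u \<xi> \<eta>" for u \<xi> \<eta>
  proof -
    define a where "a = (\<lambda>n. l2_norm G (\<xi> n) * l2_norm G (\<eta> n))"
    have l2: "\<xi> n \<in> l2 G" "\<eta> n \<in> l2 G" for n
      using r by (auto simp: fourier_rep_def)
    have sa: "summable a"
      using r by (simp add: fourier_rep_def a_def)
    define tail where "tail = (\<lambda>N x. if x \<in> carrier G then \<Sum>n. coef G (\<xi> (n + N)) (\<eta> (n + N)) x else 0)"
    have cs: "summable (\<lambda>n. coef G (\<xi> n) (\<eta> n) x)" if "x \<in> carrier G" for x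
      using fourier_rep_sums[OF r that] by (rule sums_summable)
    have trep: "fourier_rep G (tail N) (\<lambda>n. \<xi> (n + N)) (\<lambda>n. \<eta> (n + N))" for N
      unfolding fourier_rep_def tail_def
      using l2 summable_ignore_initial_segment[OF sa, of N] by (auto simp: a_def coef_def)
    have tA: "tail N \<in> carrier ?A" for N
      using trep by (auto simp: fourier_algebra_def tail_def)
    have tn: "fourier_norm G (tail N) \<le> (\<Sum>n. a (n + N))" for N
      using fourier_norm_le[OF trep] by (simp add: a_def)
    have split: "f u = (\<Sum>n<N. f (coef G (\<xi> n) (\<eta> n))) + f (tail N)" for N
    proof (induction N)
      case 0
      have "tail 0 = u"
        using fourier_rep_sums[OF r] fourier_algebra_outside[OF u] by (auto simp: tail_def sums_iff)
      then show ?case by simp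
    next
      case (Suc N)
      have "tail N = vadd ?A (coef G (\<xi> N) (\<eta> N)) (tail (Suc N))"
      proof
        fix x
        show "tail N x = vadd ?A (coef G (\<xi> N) (\<eta> N)) (tail (Suc N)) x"
          using suminf_split_head[OF summable_ignore_initial_segment[OF cs, of x N]]
          by (auto simp: tail_def coef_outside)
      qed
      then have "f (tail N) = f (coef G (\<xi> N) (\<eta> N)) + f (tail (Suc N))"
        using dual_add[OF f coef_in_fourier_algebra(1)[OF l2] tA] by metis
      with Suc show ?case by simp
    qed
    have le_N: "cmod (f u) \<le> s * suminf a + ?C * (\<Sum>n. a (n + N))" for N
    proof -
      have "cmod (f u) \<le> cmod (\<Sum>n<N. f (coef G (\<xi> n) (\<eta> n))) + cmod (f (tail N))"
        unfolding split[of N] by (rule norm_triangle_ineq)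
      also have "cmod (\<Sum>n<N. f (coef G (\<xi> n) (\<eta> n))) \<le> (\<Sum>n<N. s * a n)"
        unfolding a_def by (intro sum_norm_le le l2)
      also have "(\<Sum>n<N. s * a n) \<le> s * suminf a"
        unfolding sum_distrib_left[symmetric] using s sa
        by (intro mult_left_mono sum_le_suminf) (auto simp: a_def)
      also have "cmod (f (tail N)) \<le> ?C * (\<Sum>n. a (n + N))"
        using dual_bound[OF f tA, of N] mult_left_mono[OF tn[of N] dual_norm_nonneg[OF f]] by simp
      finally show ?thesis by simp
    qed
    have "(\<lambda>N. s * suminf a + ?C * (\<Sum>n. a (n + N))) \<longlonglongrightarrow> s * suminf a + ?C * 0"
    proof (intro tendsto_intros)
      show "(\<lambda>N. \<Sum>n. a (n + N)) \<longlonglongrightarrow> 0"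
      proof (rule LIMSEQ_I)
        fix e :: real assume "e > 0"
        from suminf_exist_split[OF this sa] show "\<exists>no. \<forall>n\<ge>no. norm ((\<Sum>i. a (i + n)) - 0) < e" by simp
      qed
    qed
    then show ?thesis
      using le_N by (auto simp: a_def intro: tendsto_lowerbound)
  qed
  show ?thesis
  proof (rule dual_norm_le[OF _ s])
    fix u assume u: "u \<in> carrier ?A"
    show "cmod (f u) \<le> s * vnorm ?A u"
    proof (cases "s = 0")
      case True
      then show ?thesis
        using u rep_le[OF u] by (auto simp: fourier_algebra_def)
    next
      case False
      then have pos: "s > 0" using s by simp
      have "cmod (f u) / s \<le> fourier_norm G u"
        by (rule fourier_norm_greatest[OF u])
           (use rep_le[OF u] pos in \<open>simp add: pos_divide_le_eq mult.commute\<close>)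
      then show ?thesis
        using pos by (simp add: pos_divide_le_eq mult.commute)
    qed
  qed
qed

text \<open>Normalised coefficients of pairs from a countable dense subset of l2. A bound on these
  passes to all coefficients by density and then to the dual norm by
  \<open>dual_le_if_coef_le\<close>.\<close>

lemma norming_sequence:
  assumes "countable (carrier G)"
  shows "\<exists>u. (\<forall>j::nat. u j \<in> carrier (fourier_algebra G) \<and> fourier_norm G (u j) \<le> 1) \<and>
    (\<forall>f\<in>carrier (dual (fourier_algebra G)). \<forall>s. (\<forall>j. cmod (f (u j)) \<le> s) \<longrightarrow> vnorm (dual (fourier_algebra G)) f \<le> s)"
proof -
  interpret cseminormed_algebra "fourier_algebra G" by (rule cseminormed_algebra_fourier)
  let ?A = "fourier_algebra G"
  obtain D where D0: "countable D \<and> D \<noteq> {} \<and> D \<subseteq> l2 G \<and>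
      (\<forall>\<xi>\<in>l2 G. \<forall>e>0. \<exists>d\<in>D. l2_norm G (\<lambda>y. \<xi> y - d y) < e)"
    using l2_separable[OF assms] by (rule exE)
  then have D: "countable D" "D \<noteq> {}" "D \<subseteq> l2 G"
    by simp_all
  have dense: "\<exists>d\<in>D. l2_norm G (\<lambda>y. \<xi> y - d y) < e" if "\<xi> \<in> l2 G" "e > 0" for \<xi> e
    using D0 that by simp
  define p where "p = from_nat_into (D \<times> D)"
  \<comment> \<open>If one of the vectors has norm 0, the factor is inverse 0 = 0 and u j is the
    zero function.\<close>
  define u where "u = (\<lambda>j x. of_real (inverse (l2_norm G (fst (p j)) * l2_norm G (snd (p j)))) * coef G (fst (p j)) (snd (p j)) x)"
  have pD: "p j \<in> D \<times> D" for j
    unfolding p_def by (rule from_nat_into) (use D(2) in auto)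
  have pl2: "fst (p j) \<in> l2 G" "snd (p j) \<in> l2 G" for j
    using pD[of j] D(3) by auto
  have uA: "u j \<in> carrier ?A" for j
    unfolding u_def by (rule fourier_algebra_cmult(1)[OF coef_in_fourier_algebra(1)[OF pl2]])
  moreover have "fourier_norm G (u j) \<le> 1" for j
  proof -
    let ?c = "inverse (l2_norm G (fst (p j)) * l2_norm G (snd (p j)))"
    have "fourier_norm G (u j) \<le> cmod (of_real ?c) * fourier_norm G (coef G (fst (p j)) (snd (p j)))"
      unfolding u_def by (rule fourier_algebra_cmult(2)[OF coef_in_fourier_algebra(1)[OF pl2]])
    also have "\<dots> \<le> cmod (of_real ?c) * (l2_norm G (fst (p j)) * l2_norm G (snd (p j)))"
      by (rule mult_left_mono[OF coef_in_fourier_algebra(2)[OF pl2]]) simp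
    also have "\<dots> = \<bar>?c\<bar> * (l2_norm G (fst (p j)) * l2_norm G (snd (p j)))"
      by (simp only: norm_of_real)
    also have "\<dots> \<le> 1"
    proof -
      have le: "\<bar>inverse r\<bar> * r \<le> 1" if "r \<ge> 0" for r :: real
        using that by (cases "r = 0") auto
      show ?thesis by (rule le) simp
    qed
    finally show ?thesis .
  qed
  moreover have "vnorm (dual ?A) f \<le> s"
    if f: "f \<in> carrier (dual ?A)" and s: "\<And>j. cmod (f (u j)) \<le> s" for f s
  proof -
    have s0: "s \<ge> 0" using order_trans[OF norm_ge_zero s[of 0]] .
    let ?C = "vnorm (dual ?A) f"
    have coef_le: "cmod (f (coef G \<xi> \<eta>)) \<le> ?C * (l2_norm G \<xi> * l2_norm G \<eta>)" if "\<xi> \<in> l2 G" "\<eta> \<in> l2 G" for \<xi> \<eta>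
      using dual_bound[OF f coef_in_fourier_algebra(1)[OF that]]
        mult_left_mono[OF coef_in_fourier_algebra(2)[OF that] dual_norm_nonneg[OF f]] by simp
    have DD: "cmod (f (coef G \<xi> \<eta>)) \<le> s * (l2_norm G \<xi> * l2_norm G \<eta>)" if \<xi>\<eta>: "\<xi> \<in> D" "\<eta> \<in> D" for \<xi> \<eta>
    proof -
      obtain j where j: "p j = (\<xi>, \<eta>)"
        using from_nat_into_surj[of "D \<times> D" "(\<xi>, \<eta>)"] D(1) \<xi>\<eta> by (auto simp: p_def)
      have l2: "\<xi> \<in> l2 G" "\<eta> \<in> l2 G" using \<xi>\<eta> D(3) by auto
      show ?thesis
      proof (cases "l2_norm G \<xi> * l2_norm G \<eta> = 0")
        case True
        show ?thesis using coef_le[OF l2] unfolding True by simp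
      next
        case False
        then have pos: "l2_norm G \<xi> * l2_norm G \<eta> > 0"
          by (metis l2_norm_nonneg mult_nonneg_nonneg order_le_less)
        have "f (u j) = of_real (inverse (l2_norm G \<xi> * l2_norm G \<eta>)) * f (coef G \<xi> \<eta>)"
          using dual_scale[OF f coef_in_fourier_algebra(1)[OF l2]] by (simp add: u_def j)
        then have "inverse (l2_norm G \<xi> * l2_norm G \<eta>) * cmod (f (coef G \<xi> \<eta>)) \<le> s"
          using s[of j] pos by (simp add: norm_mult del: inverse_mult_distrib of_real_inverse)
        then show ?thesis
          using pos by (simp add: field_simps)
      qed
    qed
    have "cmod (f (coef G \<xi> \<eta>)) \<le> s * (l2_norm G \<xi> * l2_norm G \<eta>)" if l2: "\<xi> \<in> l2 G" "\<eta> \<in> l2 G" for \<xi> \<eta>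
    proof -
      let ?N = "l2_norm G \<xi>" and ?M = "l2_norm G \<eta>"
      define \<delta> where "\<delta> = (\<lambda>n. inverse (real (Suc n)))"
      have \<delta>: "\<delta> \<longlonglongrightarrow> 0" "\<And>n. \<delta> n > 0"
        unfolding \<delta>_def using LIMSEQ_inverse_real_of_nat by auto
      \<comment> \<open>\<xi> and then \<eta> are replaced by approximants from D: the first two
        terms are the errors, the third is the bound for pairs from D.\<close>
      have le: "cmod (f (coef G \<xi> \<eta>)) \<le> ?C * (\<delta> n * ?M) + ?C * ((?N + \<delta> n) * \<delta> n) + s * ((?N + \<delta> n) * (?M + \<delta> n))" for n
      proof -
        obtain \<xi>' where \<xi>': "\<xi>' \<in> D" "l2_norm G (\<lambda>y. \<xi> y - \<xi>' y) < \<delta> n" using dense[OF l2(1) \<delta>(2)] by blast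
        obtain \<eta>' where \<eta>': "\<eta>' \<in> D" "l2_norm G (\<lambda>y. \<eta> y - \<eta>' y) < \<delta> n" using dense[OF l2(2) \<delta>(2)] by blast
        have l2': "\<xi>' \<in> l2 G" "\<eta>' \<in> l2 G" using \<xi>' \<eta>' D(3) by auto
        have near: "l2_norm G \<zeta>' \<le> l2_norm G \<zeta> + \<delta> n"
          if "\<zeta> \<in> l2 G" "\<zeta>' \<in> l2 G" "l2_norm G (\<lambda>y. \<zeta> y - \<zeta>' y) < \<delta> n" for \<zeta> \<zeta>'
        proof -
          have "l2_norm G (\<lambda>y. (-1) * (\<zeta> y - \<zeta>' y)) < \<delta> n"
            using that(3) unfolding l2_norm_cmult by simp
          then show ?thesis
            using l2_norm_triangle[OF that(1) l2_cmult[OF l2_diff[OF that(1,2)], of "-1"]] by simp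
        qed
        have N': "l2_norm G \<xi>' \<le> ?N + \<delta> n" "l2_norm G \<eta>' \<le> ?M + \<delta> n"
          using near[OF l2(1) l2'(1) \<xi>'(2)] near[OF l2(2) l2'(2) \<eta>'(2)] .
        let ?p = "coef G (\<lambda>y. \<xi> y - \<xi>' y) \<eta>" and ?q = "coef G \<xi>' (\<lambda>y. \<eta> y - \<eta>' y)" and ?r = "coef G \<xi>' \<eta>'"
        have eq: "coef G \<xi> \<eta> = vadd ?A ?p (vadd ?A ?q ?r)"
          using coef_add_left[OF l2_diff[OF l2(1) l2'(1)] l2'(1) l2(2)]
            coef_add_right[OF l2'(1) l2_diff[OF l2(2) l2'(2)] l2'(2)] by auto
        have mem: "?p \<in> carrier ?A" "?q \<in> carrier ?A" "?r \<in> carrier ?A"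
          by (intro coef_in_fourier_algebra l2_diff l2 l2')+
        then have "vadd ?A ?q ?r \<in> carrier ?A"
          by (simp add: fourier_algebra_add)
        then have "f (coef G \<xi> \<eta>) = f ?p + (f ?q + f ?r)"
          unfolding eq by (simp only: dual_add[OF f] mem)
        then have "cmod (f (coef G \<xi> \<eta>)) \<le> cmod (f ?p) + (cmod (f ?q) + cmod (f ?r))"
          by (simp only: order_trans[OF norm_triangle_ineq add_left_mono[OF norm_triangle_ineq]])
        also have "\<dots> \<le> ?C * (\<delta> n * ?M) + (?C * ((?N + \<delta> n) * \<delta> n) + s * ((?N + \<delta> n) * (?M + \<delta> n)))"
        proof (intro add_mono)
          show "cmod (f (coef G (\<lambda>y. \<xi> y - \<xi>' y) \<eta>)) \<le> ?C * (\<delta> n * ?M)"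
            by (rule order_trans[OF coef_le[OF l2_diff[OF l2(1) l2'(1)] l2(2)]])
               (use \<xi>'(2) dual_norm_nonneg[OF f] in \<open>auto intro!: mult_left_mono mult_right_mono\<close>)
          show "cmod (f (coef G \<xi>' (\<lambda>y. \<eta> y - \<eta>' y))) \<le> ?C * ((?N + \<delta> n) * \<delta> n)"
            by (rule order_trans[OF coef_le[OF l2'(1) l2_diff[OF l2(2) l2'(2)]]])
               (use \<eta>'(2) N' \<delta>(2)[of n] dual_norm_nonneg[OF f] in \<open>auto intro!: mult_left_mono mult_mono\<close>)
          show "cmod (f (coef G \<xi>' \<eta>')) \<le> s * ((?N + \<delta> n) * (?M + \<delta> n))"
            by (rule order_trans[OF DD[OF \<xi>'(1) \<eta>'(1)]])
               (use N' \<delta>(2)[of n] s0 in \<open>auto intro!: mult_left_mono mult_mono\<close>)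
        qed
        finally show ?thesis by simp
      qed
      have "(\<lambda>n. ?C * (\<delta> n * ?M) + ?C * ((?N + \<delta> n) * \<delta> n) + s * ((?N + \<delta> n) * (?M + \<delta> n))) \<longlonglongrightarrow>
          ?C * (0 * ?M) + ?C * ((?N + 0) * 0) + s * ((?N + 0) * (?M + 0))"
        by (intro tendsto_intros \<delta>)
      then show ?thesis
        using le by (auto intro: tendsto_lowerbound)
    qed
    then show ?thesis by (rule dual_le_if_coef_le[OF f s0])
  qed
  ultimately show ?thesis by blast
qed

section \<open>Oscillating functionals on a cyclic subgroup\<close>

text \<open>Exponents may repeat, so coefficients with equal exponent are merged before
  \<open>cyclic_symbol_bound\<close> applies.\<close>

lemma cyclic_pairing_bound:
  fixes a :: "'p \<Rightarrow> complex" and e :: "'p \<Rightarrow> int"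
  assumes P: "finite P" and C: "\<And>z. cmod z = 1 \<Longrightarrow> cmod (\<Sum>p\<in>P. a p * z powi e p) \<le> C"
    and x: "x \<in> carrier G" and u: "u \<in> carrier (fourier_algebra G)"
  shows "cmod (\<Sum>p\<in>P. a p * u (x [^] e p)) \<le> C * fourier_norm G u"
proof (rule fourier_pairing_bound[OF P _ u])
  show "C \<ge> 0"
    using order_trans[OF norm_ge_zero C[of 1]] by simp
  define b where "b = (\<lambda>k. \<Sum>p\<in>{p\<in>P. e p = k}. a p)"
  have conv: "(\<Sum>p\<in>P. a p * w (e p)) = (\<Sum>k\<in>e ` P. b k * w k)" for w :: "int \<Rightarrow> complex"
    unfolding b_def by (subst sum.image_gen[OF P, of _ e]) (auto simp: sum_distrib_right intro!: sum.cong)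
  fix \<xi> \<eta> assume l2: "\<xi> \<in> l2 G" "\<eta> \<in> l2 G"
  show "cmod (\<Sum>p\<in>P. a p * coef G \<xi> \<eta> (x [^] e p)) \<le> C * (l2_norm G \<xi> * l2_norm G \<eta>)"
    unfolding conv[of "\<lambda>k. coef G \<xi> \<eta> (x [^] k)"]
    by (rule cyclic_symbol_bound[OF _ _ x l2]) (use P C in \<open>auto simp flip: conv\<close>)
qed (use x in simp)

end

text \<open>For j, l < 5^m the positive exponents lie strictly between 2 * 5^m and 4 * 5^m, where
  the plateau of scale m is 1 and those of all other scales are 0. Indexing by pairs (j, l) instead
  of differences produces the triangular weight of the Fejer kernel in product form.\<close>

definition osc_exp :: "nat \<Rightarrow> nat \<times> nat \<times> bool \<Rightarrow> int" where
  "osc_exp m = (\<lambda>(j, l, s). (if s then 1 else -1) * (3 * 5 ^ m + int l - int j))"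

definition osc_index :: "nat \<Rightarrow> (nat \<times> nat \<times> bool) set" where
  "osc_index m = {..<5 ^ m} \<times> {..<5 ^ m} \<times> UNIV"

definition osc_coeff :: "nat \<Rightarrow> nat \<times> nat \<times> bool \<Rightarrow> complex" where
  "osc_coeff m = (\<lambda>(j, l, s). (if s then 1 else -1) / 25 ^ m)"

definition osc_symbol :: "nat \<Rightarrow> complex \<Rightarrow> complex" where
  "osc_symbol m z = (\<Sum>q\<in>osc_index m. osc_coeff m q * z powi osc_exp m q)"

lemma finite_osc_index [simp]: "finite (osc_index m)"
  by (simp add: osc_index_def)

text \<open>On the circle conjugation inverts z, so the double sum factors into a Fejer kernel times
  a difference of two opposite characters, which vanishes at z = 1.\<close>

lemma osc_symbol_eq:
  assumes "cmod z = 1"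
  shows "osc_symbol m z = (z ^ (3 * 5 ^ m) - cnj (z ^ (3 * 5 ^ m))) * (\<Sum>l<5 ^ m. z ^ l) * cnj (\<Sum>l<5 ^ m. z ^ l) / 25 ^ m"
proof -
  obtain t where z: "z = cis t"
    using assms by (metis cis_Arg norm_eq_zero zero_neq_one sgn_eq div_by_1 of_real_1)
  let ?w = "z ^ (3 * 5 ^ m)"
  let ?L = "5 ^ m :: nat"
  have 1: "z powi (3 * 5 ^ m + int l - int j) = ?w * z ^ l * cnj (z ^ j)" for l j
    by (simp add: z cis_cnj cis_power_int Complex.DeMoivre cis_mult algebra_simps)
  have 2: "z powi (- (3 * 5 ^ m + int l - int j)) = cnj ?w * cnj (z ^ l) * z ^ j" for l j
    by (simp add: z cis_cnj cis_power_int Complex.DeMoivre cis_mult algebra_simps)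
  have "osc_symbol m z = (\<Sum>j<?L. \<Sum>l<?L. (?w * z ^ l * cnj (z ^ j) - cnj ?w * cnj (z ^ l) * z ^ j) / 25 ^ m)"
    unfolding osc_symbol_def osc_index_def sum.cartesian_product'
    by (intro sum.cong refl) (simp add: UNIV_bool osc_coeff_def osc_exp_def 1 2[simplified] diff_divide_distrib)
  also have "\<dots> = ((\<Sum>j<?L. \<Sum>l<?L. ?w * z ^ l * cnj (z ^ j)) - (\<Sum>j<?L. \<Sum>l<?L. cnj ?w * cnj (z ^ l) * z ^ j)) / 25 ^ m"
    by (simp only: sum_divide_distrib sum_subtractf diff_divide_distrib)
  also have "(\<Sum>j<?L. \<Sum>l<?L. ?w * z ^ l * cnj (z ^ j)) = ?w * ((\<Sum>l<?L. z ^ l) * cnj (\<Sum>j<?L. z ^ j))"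
    by (subst mult.commute[of "\<Sum>l<?L. z ^ l"]) (simp only: cnj_sum sum_product sum_distrib_left ac_simps)
  also have "(\<Sum>j<?L. \<Sum>l<?L. cnj ?w * cnj (z ^ l) * z ^ j) = cnj ?w * ((\<Sum>j<?L. z ^ j) * cnj (\<Sum>l<?L. z ^ l))"
    by (subst sum.swap) (simp only: cnj_sum sum_product sum_distrib_left ac_simps)
  finally show ?thesis
    by (simp only: left_diff_distrib mult.assoc)
qed

text \<open>A bound by the increments of \<open>24 y / (1 + y)\<close>, so that the sum over all scales telescopes.\<close>

lemma osc_symbol_bound:
  assumes z: "cmod z = 1"
  defines "y \<equiv> \<lambda>m. 5 ^ m * cmod (z - 1)"
  shows "cmod (osc_symbol m z) \<le> 24 * (y (Suc m) / (1 + y (Suc m)) - y m / (1 + y m))"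
proof -
  define L :: real where "L = 5 ^ m"
  define w where "w = z ^ (3 * 5 ^ m)"
  define D where "D = (\<Sum>l<5 ^ m. z ^ l)"
  define t where "t = cmod (z - 1)"
  have L: "L > 0" "L * L = 25 ^ m"
    by (simp_all add: L_def flip: power_mult_distrib)
  have t: "t \<ge> 0" by (simp add: t_def)
  have s: "cmod (osc_symbol m z) = cmod (w - cnj w) * (cmod D * cmod D) / (L * L)"
    unfolding osc_symbol_eq[OF z] w_def[symmetric] D_def[symmetric] L(2) by (simp add: norm_mult norm_divide norm_power mult.assoc)
  \<comment> \<open>First-order vanishing at 1: each of the two characters differs from 1 by at most
    3 L t.\<close>
  have w1: "cmod (w - cnj w) \<le> 6 * L * t"
  proof -
    have "cmod (z ^ (3 * 5 ^ m) - 1 ^ (3 * 5 ^ m)) \<le> real (3 * 5 ^ m) * cmod (z - 1)"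
      by (rule norm_power_diff) (use z in auto)
    then have "cmod (w - 1) \<le> 3 * L * t"
      by (simp add: w_def L_def t_def)
    moreover have "cmod (cnj w - 1) = cmod (w - 1)"
      by (metis complex_cnj_diff complex_cnj_one complex_mod_cnj)
    moreover have "cmod (w - cnj w) \<le> cmod (w - 1) + cmod (cnj w - 1)"
      using norm_triangle_ineq4[of "w - 1" "cnj w - 1"] by simp
    ultimately show ?thesis by simp
  qed
  have "cmod w = 1"
    by (simp add: w_def norm_power z)
  then have w2: "cmod (w - cnj w) \<le> 2"
    using norm_triangle_ineq4[of w "cnj w"] by simp
  have D1: "cmod D \<le> L"
    unfolding D_def L_def using sum_norm_le[of "{..<5 ^ m}" "\<lambda>l. z ^ l" "\<lambda>_. 1"] z by (simp add: norm_power)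
  have D2: "cmod D * t \<le> 2"
  proof -
    have "D * (z - 1) = z ^ (5 ^ m) - 1"
      unfolding D_def by (simp add: power_diff_1_eq mult.commute)
    then have "cmod D * t = cmod (z ^ (5 ^ m) - 1)"
      unfolding t_def norm_mult[symmetric] by simp
    also have "\<dots> \<le> 2"
      using norm_triangle_ineq4[of "z ^ (5 ^ m)" 1] z by (simp add: norm_power)
    finally show ?thesis .
  qed
  have s1: "cmod (osc_symbol m z) \<le> 6 * (L * t)"
  proof -
    have "cmod (w - cnj w) * (cmod D * cmod D) \<le> (6 * L * t) * (L * L)"
      using w1 D1 L t by (intro mult_mono) auto
    then show ?thesis
      unfolding s using L(1) by (simp add: divide_le_eq)
  qed
  have s2: "cmod (osc_symbol m z) * (L * t)\<^sup>2 \<le> 8"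
  proof -
    have "cmod (osc_symbol m z) * (L * t)\<^sup>2 = cmod (w - cnj w) * ((cmod D * t) * (cmod D * t))"
      unfolding s using L(1) by (simp add: power2_eq_square field_simps)
    also have "\<dots> \<le> 2 * (2 * 2)"
      using w2 D2 t by (intro mult_mono) auto
    finally show ?thesis by simp
  qed
  \<comment> \<open>With y = L t the symbol is at most 6 y and at most 8 / y^2. The telescoping
    increment equals 96 y / ((1 + 5 y) (1 + y)), which is at least 8 y for y \<le> 1 and at least 8
    / y for y \<ge> 1; this is where 24 comes from.\<close>
  have ineq: "v \<le> 24 * (5 * y / (1 + 5 * y) - y / (1 + y))"
    if v: "v \<le> 6 * y" "v * y\<^sup>2 \<le> 8" and y: "y \<ge> 0" for v y :: real
  proof -
    have eq: "24 * (5 * y / (1 + 5 * y) - y / (1 + y)) = 96 * y / ((1 + 5 * y) * (1 + y))"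
      using y by (simp add: divide_simps) (simp add: algebra_simps)
    have pos: "(1 + 5 * y) * (1 + y) > 0" using y by simp
    show ?thesis
    proof (cases "y \<le> 1")
      case True
      have "(1 + 5 * y) * (1 + y) \<le> 6 * 2" using True y by (intro mult_mono) auto
      then have "6 * y * ((1 + 5 * y) * (1 + y)) \<le> 6 * y * (6 * 2)" using y by (intro mult_left_mono) auto
      then have "6 * y * ((1 + 5 * y) * (1 + y)) \<le> 96 * y" using y by simp
      then have "6 * y \<le> 96 * y / ((1 + 5 * y) * (1 + y))"
        using pos by (simp add: pos_le_divide_eq)
      then show ?thesis unfolding eq using v(1) by linarith
    next
      case False
      then have y1: "y \<ge> 1" by simp
      have "(1 + 5 * y) * (1 + y) \<le> (6 * y) * (2 * y)" using y1 by (intro mult_mono) auto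
      then have "8 * ((1 + 5 * y) * (1 + y)) \<le> 8 * ((6 * y) * (2 * y))" by (rule mult_left_mono) simp
      also have "\<dots> = 96 * y * y" by simp
      also have "\<dots> \<le> 96 * y * y * y" using y1 by (simp add: mult_le_cancel_left1)
      finally have "8 * ((1 + 5 * y) * (1 + y)) \<le> 96 * y * y\<^sup>2" by (simp add: power2_eq_square mult.assoc)
      then have "8 / y\<^sup>2 \<le> 96 * y / ((1 + 5 * y) * (1 + y))"
        using pos y1 by (simp add: pos_le_divide_eq divide_le_eq mult.commute mult.left_commute)
      moreover have "v \<le> 8 / y\<^sup>2"
        using v(2) y1 by (simp add: pos_le_divide_eq)
      ultimately show ?thesis unfolding eq by linarith
    qed
  qed
  from ineq[OF s1 s2] L t show ?thesis
    by (simp add: y_def t_def[symmetric] L_def mult.assoc)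
qed

lemma sum_osc_symbol_le:
  assumes "cmod z = 1"
  shows "(\<Sum>m<M. cmod (osc_symbol m z)) \<le> 24"
proof -
  define g where "g = (\<lambda>m. 5 ^ m * cmod (z - 1) / (1 + 5 ^ m * cmod (z - 1)))"
  have "(\<Sum>m<M. cmod (osc_symbol m z)) \<le> (\<Sum>m<M. 24 * (g (Suc m) - g m))"
    by (intro sum_mono) (use osc_symbol_bound[OF assms] in \<open>simp add: g_def\<close>)
  also have "\<dots> = 24 * (g M - g 0)"
    unfolding sum_distrib_left[symmetric] sum_lessThan_telescope ..
  also have "\<dots> \<le> 24 * 1"
  proof (rule mult_left_mono)
    have "g M \<le> 1" unfolding g_def by (subst divide_le_eq_1_pos) (auto simp: add_pos_nonneg)
    moreover have "g 0 \<ge> 0" by (simp add: g_def)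
    ultimately show "g M - g 0 \<le> 1" by linarith
  qed simp
  finally show ?thesis by simp
qed

context group
begin

definition osc :: "'a \<Rightarrow> nat \<Rightarrow> ('a \<Rightarrow> complex) \<Rightarrow> complex" where
  "osc x m u = (\<Sum>q\<in>osc_index m. osc_coeff m q * u (x [^] osc_exp m q))"

lemma osc_bound:
  assumes u: "u \<in> carrier (fourier_algebra G)" and c: "\<And>n. cmod (c n) \<le> 1" and x: "x \<in> carrier G"
  shows "cmod (\<Sum>m<M. c m * osc x m u) \<le> 24 * fourier_norm G u"
proof -
  let ?P = "Sigma {..<M} osc_index"
  have flat: "(\<Sum>m<M. c m * (\<Sum>q\<in>osc_index m. osc_coeff m q * w (osc_exp m q))) =
      (\<Sum>p\<in>?P. (c (fst p) * osc_coeff (fst p) (snd p)) * w (osc_exp (fst p) (snd p)))" for w :: "int \<Rightarrow> complex"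
    by (simp add: sum.Sigma[symmetric] sum_distrib_left mult.assoc case_prod_unfold[symmetric])
       (simp add: sum.Sigma case_prod_unfold)
  show ?thesis
    unfolding osc_def flat[of "\<lambda>k. u (x [^] k)"]
  proof (rule cyclic_pairing_bound[OF _ _ x u])
    fix z assume z: "cmod z = 1"
    have "cmod (\<Sum>m<M. c m * osc_symbol m z) \<le> (\<Sum>m<M. cmod (osc_symbol m z))"
      by (rule sum_norm_le) (simp add: norm_mult mult_left_le_one_le c)
    also have "\<dots> \<le> 24" by (rule sum_osc_symbol_le[OF z])
    finally show "cmod (\<Sum>p\<in>?P. (c (fst p) * osc_coeff (fst p) (snd p)) * z powi osc_exp (fst p) (snd p)) \<le> 24"
      unfolding osc_symbol_def flat .
  qed auto
qed


section \<open>Products of finitely supported coefficient functions\<close>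

lemma sum_left_translate:
  fixes h :: "'a \<Rightarrow> 'c :: comm_monoid_add"
  assumes R: "finite R" "R \<subseteq> carrier G" and S: "S \<subseteq> carrier G" and s: "s \<in> carrier G"
    and SR: "\<And>t. t \<in> S \<Longrightarrow> inv s \<otimes> t \<in> R" and h: "\<And>t. t \<in> carrier G - S \<Longrightarrow> h t = 0"
  shows "(\<Sum>r\<in>R. h (s \<otimes> r)) = (\<Sum>t\<in>S. h t)"
proof -
  have "inj_on ((\<otimes>) s) R"
    using inj_on_cmult[OF s] R(2) by (rule inj_on_subset)
  then have "(\<Sum>r\<in>R. h (s \<otimes> r)) = (\<Sum>t\<in>(\<otimes>) s ` R. h t)"
    by (simp add: sum.reindex)
  also have "\<dots> = (\<Sum>t\<in>S. h t)"
  proof (rule sum.mono_neutral_right)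
    show "S \<subseteq> (\<otimes>) s ` R"
    proof
      fix t assume t: "t \<in> S"
      then have "t = s \<otimes> (inv s \<otimes> t)"
        using s S by (auto simp: m_assoc[symmetric])
      with SR[OF t] show "t \<in> (\<otimes>) s ` R" by blast
    qed
    show "\<forall>t\<in>(\<otimes>) s ` R - S. h t = 0"
      using s R(2) h by auto
  qed (use R in auto)
  finally show ?thesis .
qed

text \<open>
  Fell absorption: after the substitution \<open>t = s r\<close>, the product of two coefficients of \<open>\<lambda>\<close> is a
  sum over \<open>r\<close> of coefficients of \<open>\<lambda>\<close>.
\<close>

lemma coef_mult:
  assumes S: "finite S" "S \<subseteq> carrier G"
    and supp: "\<And>y. y \<in> carrier G - S \<Longrightarrow> \<xi> y = 0" "\<And>y. y \<in> carrier G - S \<Longrightarrow> \<eta> y = 0"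
      "\<And>y. y \<in> carrier G - S \<Longrightarrow> \<xi>' y = 0" "\<And>y. y \<in> carrier G - S \<Longrightarrow> \<eta>' y = 0"
  shows "(\<lambda>x. coef G \<xi> \<eta> x * coef G \<xi>' \<eta>' x) \<in> carrier (fourier_algebra G)"
    and "fourier_norm G (\<lambda>x. coef G \<xi> \<eta> x * coef G \<xi>' \<eta>' x) \<le>
      (l2_norm G \<xi> * l2_norm G \<eta>) * (l2_norm G \<xi>' * l2_norm G \<eta>')"
proof -
  \<comment> \<open>All quotients of elements of S, so that s r with r in R reaches every t in S
    from every s in S.\<close>
  define R where "R = (\<lambda>(s, t). inv s \<otimes> t) ` (S \<times> S)"
  have R: "finite R" "R \<subseteq> carrier G"
    unfolding R_def using S by auto
  define X where "X = (\<lambda>r y. \<xi> y * \<xi>' (y \<otimes> r))"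
  define H where "H = (\<lambda>r y. \<eta> y * \<eta>' (y \<otimes> r))"
  have SR: "s \<in> carrier G" "\<And>t. t \<in> S \<Longrightarrow> inv s \<otimes> t \<in> R" if "s \<in> S" for s
    using that S by (force simp: R_def)+
  have XH: "X r \<in> l2 G" "H r \<in> l2 G" for r
    by (rule l2_finite_support[OF S(1)], use supp in \<open>auto simp: X_def H_def\<close>)+
  have prod: "coef G \<xi> \<eta> x * coef G \<xi>' \<eta>' x = (\<Sum>r\<in>R. coef G (X r) (H r) x)" for x
  proof (cases "x \<in> carrier G")
    case x: True
    have c: "coef G \<zeta> \<theta> x = (\<Sum>s\<in>S. \<zeta> (inv x \<otimes> s) * cnj (\<theta> s))" if "\<And>y. y \<in> carrier G - S \<Longrightarrow> \<theta> y = 0" for \<zeta> \<theta>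
    proof -
      have "l2_inner G (left_regular G x \<zeta>) \<theta> = (\<Sum>s\<in>S. left_regular G x \<zeta> s * cnj (\<theta> s))"
        by (rule l2_inner_finite_support[OF S]) (rule that)
      with x show ?thesis by (simp add: coef_def left_regular_def)
    qed
    have "(\<Sum>r\<in>R. coef G (X r) (H r) x) = (\<Sum>r\<in>R. \<Sum>s\<in>S. X r (inv x \<otimes> s) * cnj (H r s))"
      by (intro sum.cong refl c) (simp add: H_def supp)
    also have "\<dots> = (\<Sum>s\<in>S. \<Sum>r\<in>R. X r (inv x \<otimes> s) * cnj (H r s))"
      by (rule sum.swap)
    also have "\<dots> = (\<Sum>s\<in>S. \<xi> (inv x \<otimes> s) * cnj (\<eta> s) * (\<Sum>t\<in>S. \<xi>' (inv x \<otimes> t) * cnj (\<eta>' t)))"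
    proof (rule sum.cong[OF refl])
      fix s assume s: "s \<in> S"
      have "(\<Sum>r\<in>R. X r (inv x \<otimes> s) * cnj (H r s)) =
          (\<Sum>r\<in>R. \<xi> (inv x \<otimes> s) * cnj (\<eta> s) * (\<xi>' (inv x \<otimes> (s \<otimes> r)) * cnj (\<eta>' (s \<otimes> r))))"
        by (intro sum.cong refl) (use x s S R in \<open>auto simp: X_def H_def m_assoc subset_iff\<close>)
      also have "\<dots> = \<xi> (inv x \<otimes> s) * cnj (\<eta> s) * (\<Sum>t\<in>S. \<xi>' (inv x \<otimes> t) * cnj (\<eta>' t))"
      proof -
        have "(\<Sum>r\<in>R. \<xi>' (inv x \<otimes> (s \<otimes> r)) * cnj (\<eta>' (s \<otimes> r))) = (\<Sum>t\<in>S. \<xi>' (inv x \<otimes> t) * cnj (\<eta>' t))"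
          by (rule sum_left_translate[OF R S(2)]) (use s SR supp in auto)
        then show ?thesis unfolding sum_distrib_left[symmetric] by simp
      qed
      finally show "(\<Sum>r\<in>R. X r (inv x \<otimes> s) * cnj (H r s)) = \<dots>" .
    qed
    also have "\<dots> = coef G \<xi> \<eta> x * coef G \<xi>' \<eta>' x"
      by (subst (1 2) c) (use supp in \<open>simp_all add: sum_distrib_right\<close>)
    finally show ?thesis by simp
  qed (simp add: coef_outside)
  \<comment> \<open>Summed over r, the squared norms factorise: for each s in S the elements s r
    cover S once, and \<theta> vanishes at those outside S.\<close>
  have norm2: "(\<Sum>r\<in>R. (l2_norm G (\<lambda>y. \<zeta> y * \<theta> (y \<otimes> r)))\<^sup>2) = (l2_norm G \<zeta> * l2_norm G \<theta>)\<^sup>2"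
    if \<zeta>: "\<And>y. y \<in> carrier G - S \<Longrightarrow> \<zeta> y = 0" and \<theta>: "\<And>y. y \<in> carrier G - S \<Longrightarrow> \<theta> y = 0" for \<zeta> \<theta>
  proof -
    have n: "(l2_norm G \<theta>)\<^sup>2 = (\<Sum>s\<in>S. (cmod (\<theta> s))\<^sup>2)" if "\<And>y. y \<in> carrier G - S \<Longrightarrow> \<theta> y = 0" for \<theta>
      by (subst l2_norm_finite_support[OF S that]) (auto simp: sum_nonneg)
    have "(\<Sum>r\<in>R. (l2_norm G (\<lambda>y. \<zeta> y * \<theta> (y \<otimes> r)))\<^sup>2) = (\<Sum>r\<in>R. \<Sum>s\<in>S. (cmod (\<zeta> s))\<^sup>2 * (cmod (\<theta> (s \<otimes> r)))\<^sup>2)"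
      by (intro sum.cong refl, subst n) (simp_all add: \<zeta> norm_mult power_mult_distrib)
    also have "\<dots> = (\<Sum>s\<in>S. (cmod (\<zeta> s))\<^sup>2 * (\<Sum>r\<in>R. (cmod (\<theta> (s \<otimes> r)))\<^sup>2))"
      by (subst sum.swap) (simp add: sum_distrib_left)
    also have "\<dots> = (\<Sum>s\<in>S. (cmod (\<zeta> s))\<^sup>2 * (\<Sum>t\<in>S. (cmod (\<theta> t))\<^sup>2))"
      by (intro sum.cong refl arg_cong2[where f = "(*)"] sum_left_translate[OF R S(2)]) (use SR \<theta> in auto)
    also have "\<dots> = (l2_norm G \<zeta> * l2_norm G \<theta>)\<^sup>2"
      unfolding power_mult_distrib by (subst (1 2) n) (simp_all add: \<zeta> \<theta> sum_distrib_right)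
    finally show ?thesis .
  qed
  show "(\<lambda>x. coef G \<xi> \<eta> x * coef G \<xi>' \<eta>' x) \<in> carrier (fourier_algebra G)"
    by (rule fourier_algebraI_finite_sum(1)[OF R(1) XH prod])
  have "fourier_norm G (\<lambda>x. coef G \<xi> \<eta> x * coef G \<xi>' \<eta>' x) \<le> (\<Sum>r\<in>R. l2_norm G (X r) * l2_norm G (H r))"
    by (rule fourier_algebraI_finite_sum(2)[OF R(1) XH prod])
  also have "\<dots> = (\<Sum>r\<in>R. \<bar>l2_norm G (X r)\<bar> * \<bar>l2_norm G (H r)\<bar>)" by simp
  also have "\<dots> \<le> L2_set (\<lambda>r. l2_norm G (X r)) R * L2_set (\<lambda>r. l2_norm G (H r)) R"
    by (rule L2_set_mult_ineq)
  also have "\<dots> = (l2_norm G \<xi> * l2_norm G \<xi>') * (l2_norm G \<eta> * l2_norm G \<eta>')"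
    unfolding L2_set_def X_def H_def by (subst norm2, use supp in simp_all, subst norm2, use supp in simp_all)
  finally show "fourier_norm G (\<lambda>x. coef G \<xi> \<eta> x * coef G \<xi>' \<eta>' x) \<le>
      (l2_norm G \<xi> * l2_norm G \<eta>) * (l2_norm G \<xi>' * l2_norm G \<eta>')"
    by (simp only: ac_simps)
qed

lemma block_coef_mult:
  assumes x: "infinite_order x"
  shows "(\<lambda>y. block_coef x M s n y * block_coef x M' s' n' y) \<in> carrier (fourier_algebra G)"
    and "fourier_norm G (\<lambda>y. block_coef x M s n y * block_coef x M' s' n' y) \<le>
      sqrt (real M * real n) / real M * (sqrt (real M' * real n') / real M')"
proof -
  let ?I = "{0..<int M} \<union> {0..<int M'} \<union> {s..<s + int n} \<union> {s'..<s' + int n'}"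
  let ?S = "(\<lambda>l. x [^] l) ` ?I"
  have S: "finite ?S" "?S \<subseteq> carrier G"
    using infinite_order_carrier[OF x] by auto
  have supp: "of_real (1 / real M) * block x 0 M y = 0" "block x s n y = 0"
      "of_real (1 / real M') * block x 0 M' y = 0" "block x s' n' y = 0" if "y \<in> carrier G - ?S" for y
    using that by (auto simp: block_def)
  show "(\<lambda>y. block_coef x M s n y * block_coef x M' s' n' y) \<in> carrier (fourier_algebra G)"
    unfolding block_coef_def by (rule coef_mult(1)[OF S]) (use supp in auto)
  have n: "l2_norm G (\<lambda>y. of_real (1 / real M) * block x 0 M y) * l2_norm G (block x s n) = sqrt (real M * real n) / real M" for M s n
    unfolding l2_norm_cmult block_l2(2)[OF x] by (simp add: real_sqrt_mult norm_divide)
  have "fourier_norm G (\<lambda>y. block_coef x M s n y * block_coef x M' s' n' y) \<le>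
      (l2_norm G (\<lambda>y. of_real (1 / real M) * block x 0 M y) * l2_norm G (block x s n)) *
      (l2_norm G (\<lambda>y. of_real (1 / real M') * block x 0 M' y) * l2_norm G (block x s' n'))"
    unfolding block_coef_def by (rule coef_mult(2)[OF S]) (use supp in auto)
  then show "fourier_norm G (\<lambda>y. block_coef x M s n y * block_coef x M' s' n' y) \<le>
      sqrt (real M * real n) / real M * (sqrt (real M' * real n') / real M')"
    unfolding n .
qed

section \<open>Extreme non-Arens regularity of countable groups with an element of infinite order\<close>

text \<open>On powers of x this is the triangle with peak 1 at exponent 0 and half-width n + 1; as n
  grows it tends to 1 on the whole subgroup.\<close>

definition fejer :: "'a \<Rightarrow> nat \<Rightarrow> 'a \<Rightarrow> complex" where
  "fejer x n = block_coef x (Suc n) 0 (Suc n)"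

text \<open>A trapezoid in the exponent: 1 from 2 * 5^m to 4 * 5^m and 0 outside the open interval
  from 5^m to 5 * 5^m. The ratio 3 of the block lengths gives norm at most sqrt 3.\<close>

definition plateau :: "'a \<Rightarrow> nat \<Rightarrow> 'a \<Rightarrow> complex" where
  "plateau x m = block_coef x (5 ^ m) (2 * 5 ^ m) (3 * 5 ^ m)"

context
  fixes x assumes x: "infinite_order x"
begin

lemma fejer_in_fourier_algebra: "fejer x n \<in> carrier (fourier_algebra G)" "fourier_norm G (fejer x n) \<le> 1"
  using block_coef_in_fourier_algebra[OF x, of "Suc n" 0 "Suc n"] by (simp_all add: fejer_def)

lemma sqrt3_le: "sqrt (5 ^ m * (3 * 5 ^ m)) / 5 ^ m \<le> 2"
proof -
  have "5 ^ m * (3 * 5 ^ m) \<le> ((2::real) * 5 ^ m)\<^sup>2"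
    by (simp add: power2_eq_square)
  then have "sqrt (5 ^ m * (3 * 5 ^ m)) \<le> 2 * 5 ^ m"
    by (rule real_le_lsqrt[rotated -1]) auto
  then show ?thesis by (simp add: divide_le_eq)
qed

lemma plateau_in_fourier_algebra: "plateau x m \<in> carrier (fourier_algebra G)" "fourier_norm G (plateau x m) \<le> 2"
  using block_coef_in_fourier_algebra[OF x, of "5 ^ m" "2 * 5 ^ m" "3 * 5 ^ m"] sqrt3_le[of m] by (simp_all add: plateau_def)

lemma fejer_plateau_in_fourier_algebra:
  "(\<lambda>y. fejer x n y * plateau x m y) \<in> carrier (fourier_algebra G)"
  "fourier_norm G (\<lambda>y. fejer x n y * plateau x m y) \<le> 2"
proof -
  note mult = block_coef_mult[OF x, of "Suc n" 0 "Suc n" "5 ^ m" "2 * 5 ^ m" "3 * 5 ^ m"]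
  show "(\<lambda>y. fejer x n y * plateau x m y) \<in> carrier (fourier_algebra G)"
    using mult(1) by (simp add: fejer_def plateau_def)
  have "sqrt (real (Suc n) * real (Suc n)) / real (Suc n) = 1"
    by (simp del: of_nat_Suc)
  then show "fourier_norm G (\<lambda>y. fejer x n y * plateau x m y) \<le> 2"
    using mult(2) sqrt3_le[of m] by (simp add: fejer_def plateau_def)
qed

lemma fejer_tendsto: "(\<lambda>n. fejer x n (x [^] (k::int))) \<longlonglongrightarrow> 1"
proof -
  define c where "c = nat \<bar>k\<bar>"
  have "(\<lambda>n. 1 - of_real (real (c)) * of_real (inverse (real (Suc n)))) \<longlonglongrightarrow> (1::complex) - of_real (real (c)) * of_real 0"
    by (intro tendsto_intros LIMSEQ_inverse_real_of_nat)
  moreover have "eventually (\<lambda>n. 1 - of_real (real (c)) * of_real (inverse (real (Suc n))) = fejer x n (x [^] k)) sequentially"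
    using eventually_ge_at_top[of "c"]
  proof eventually_elim
    case (elim n)
    have "{l\<in>{0..<0 + int (Suc n)}. k \<le> l \<and> l < k + int (Suc n)} = {max 0 k..<min (int (Suc n)) (k + int (Suc n))}"
      by auto
    moreover have "min (int (Suc n)) (k + int (Suc n)) - max 0 k = int (Suc n - c)"
      using elim by (auto simp: min_def max_def of_nat_diff c_def)
    ultimately have "card {l\<in>{0..<0 + int (Suc n)}. k \<le> l \<and> l < k + int (Suc n)} = Suc n - c"
      by (simp only: card_atLeastLessThan_int nat_int)
    then have "fejer x n (x [^] k) = of_nat (Suc n - c) / of_nat (Suc n)"
      unfolding fejer_def block_coef_pow[OF x] by (simp only:)
    also have "\<dots> = 1 - of_real (real (c)) * of_real (inverse (real (Suc n)))"
      using elim by (simp add: of_nat_diff field_simps del: of_nat_Suc)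
    finally show ?case by simp
  qed
  ultimately show ?thesis by (simp add: filterlim_cong)
qed

lemma plateau_eq_0: "(\<And>k::int. 5 ^ m < k \<Longrightarrow> k < 5 * 5 ^ m \<Longrightarrow> y \<noteq> x [^] k) \<Longrightarrow> plateau x m y = 0"
  unfolding plateau_def by (rule block_coef_eq_0[OF x]) auto

lemma plateau_eq_1: "2 * 5 ^ m \<le> k \<Longrightarrow> k \<le> 4 * 5 ^ m \<Longrightarrow> plateau x m (x [^] (k::int)) = 1"
  unfolding plateau_def by (rule block_coef_eq_1[OF x]) auto

text \<open>The triangle is 0 at exponents above n, while the plateau is carried by exponents above
  5^m.\<close>

lemma fejer_plateau_eq_0:
  assumes "n < 5 ^ m"
  shows "fejer x n y * plateau x m y = 0"
proof (cases "\<exists>k::int. 5 ^ m < k \<and> y = x [^] k")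
  case True
  then obtain k :: int where k: "5 ^ m < k" "y = x [^] k" by blast
  have "int n < 5 ^ m" using assms by simp
  then have "int n < k" using k(1) by linarith
  then have "fejer x n y = 0"
    unfolding fejer_def k(2) by (intro block_coef_eq_0[OF x]) (auto simp: int_pow_eq_iff[OF x])
  then show ?thesis by simp
next
  case False
  then show ?thesis by (subst plateau_eq_0) auto
qed

text \<open>Multiplication by a plateau keeps the positive half of its own scale and removes the
  negative half and all other scales, the bands of different scales being separated by the factor
  5.\<close>

lemma osc_plateau:
  "osc x m (\<lambda>y. v y * plateau x m' y) =
    (if m = m' then (\<Sum>(j, l)\<in>{..<5 ^ m} \<times> {..<5 ^ m}. v (x [^] (3 * 5 ^ m + int l - int j)) / 25 ^ m) else 0)"
proof -
  have val: "plateau x m' (x [^] osc_exp m (j, l, s)) = of_bool (s \<and> m = m')" if jl: "j < 5 ^ m" "l < 5 ^ m" for j l s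
  proof -
    define E where "E = 3 * 5 ^ m + int l - int j"
    have "int j < 5 ^ m" "int l < 5 ^ m" using jl by simp_all
    then have E: "2 * 5 ^ m < E" "E < 4 * 5 ^ m"
      unfolding E_def by linarith+
    have exp: "osc_exp m (j, l, s) = (if s then E else - E)"
      by (simp add: osc_exp_def E_def)
    show ?thesis
    proof (cases "s \<and> m = m'")
      case True
      then show ?thesis
        unfolding exp using E by (simp add: plateau_eq_1)
    next
      case False
      have "osc_exp m (j, l, s) \<noteq> k" if k: "5 ^ m' < k" "k < 5 * 5 ^ m'" for k
      proof (cases s)
        case True
        with False have "m < m' \<or> m' < m" by auto
        then have "(5::int) ^ Suc m \<le> 5 ^ m' \<or> (5::int) ^ Suc m' \<le> 5 ^ m"
          by (auto intro!: power_increasing simp del: power_Suc)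
        moreover have "(0::int) < 5 ^ m" by simp
        ultimately have "E \<noteq> k"
          using E k unfolding power_Suc by linarith
        with True show ?thesis unfolding exp by simp
      next
        case False
        have "(0::int) < 5 ^ m'" "(0::int) < 5 ^ m" by simp_all
        then have "- E \<noteq> k" using E k by linarith
        with False show ?thesis unfolding exp by simp
      qed
      then have "plateau x m' (x [^] osc_exp m (j, l, s)) = 0"
        by (intro plateau_eq_0) (simp add: int_pow_eq_iff[OF x])
      with False show ?thesis by auto
    qed
  qed
  have "osc x m (\<lambda>y. v y * plateau x m' y) =
      (\<Sum>j<5 ^ m. \<Sum>l<5 ^ m. of_bool (m = m') * (v (x [^] (3 * 5 ^ m + int l - int j)) / 25 ^ m))"
    unfolding osc_def osc_index_def sum.cartesian_product'
    by (intro sum.cong refl) (simp add: UNIV_bool val osc_coeff_def, simp add: osc_exp_def)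
  also have "\<dots> = (if m = m' then (\<Sum>(j, l)\<in>{..<5 ^ m} \<times> {..<5 ^ m}. v (x [^] (3 * 5 ^ m + int l - int j)) / 25 ^ m) else 0)"
    by (simp add: sum.cartesian_product')
  finally show ?thesis .
qed

lemma osc_fejer_plateau_tendsto: "(\<lambda>n. osc x m (\<lambda>y. fejer x n y * plateau x m y)) \<longlonglongrightarrow> 1"
proof -
  have "(\<lambda>n. \<Sum>(j, l)\<in>{..<5 ^ m} \<times> {..<5 ^ m}. fejer x n (x [^] (3 * 5 ^ m + int l - int j)) / 25 ^ m) \<longlonglongrightarrow>
      (\<Sum>(j, l)\<in>{..<5 ^ m :: nat} \<times> {..<5 ^ m :: nat}. 1 / 25 ^ m)"
    unfolding case_prod_unfold by (intro tendsto_intros fejer_tendsto) auto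
  also have "(\<Sum>(j, l)\<in>{..<5 ^ m :: nat} \<times> {..<5 ^ m :: nat}. 1 / 25 ^ m) = (1::complex)"
    by (simp add: case_prod_unfold card_cartesian_product flip: power_mult_distrib)
  finally show ?thesis by (simp add: osc_plateau)
qed

theorem extremely_non_Arens_regular_fourier:
  assumes countable: "countable (carrier G)"
  shows "extremely_non_Arens_regular (fourier_algebra G)"
proof -
  interpret cseminormed_algebra "fourier_algebra G" by (rule cseminormed_algebra_fourier)
  let ?A = "fourier_algebra G"
  obtain u where u: "\<And>j::nat. u j \<in> carrier ?A" "\<And>j. fourier_norm G (u j) \<le> 1"
      "\<And>f s. f \<in> carrier (dual ?A) \<Longrightarrow> (\<And>j. cmod (f (u j)) \<le> s) \<Longrightarrow> vnorm (dual ?A) f \<le> s"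
    using norming_sequence[OF countable] by metis
  \<comment> \<open>\<open>prod_encode\<close> reserves infinitely many scales for each coordinate
    j, one for every i.\<close>
  define P where "P = (\<lambda>n j i y. fejer x n y * plateau x (prod_encode (j, i)) y)"
  \<comment> \<open>On the series h below, the first iterated limit is the j-th coefficient, since
    the triangles tend to 1 at fixed scale; the second is 0, since for fixed n the product vanishes
    once the scale is large.\<close>
  define \<Lambda> where "\<Lambda> = (\<lambda>j f. ulim (\<lambda>i. ulim (\<lambda>n. f (P n j i))) - ulim (\<lambda>n. ulim (\<lambda>i. f (P n j i))))"
  have b: "cmod (f (P n j i)) \<le> 2 * vnorm (dual ?A) f" if f: "f \<in> carrier (dual ?A)" for f n j i
  proof -
    have "cmod (f (P n j i)) \<le> vnorm (dual ?A) f * fourier_norm G (P n j i)"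
      using dual_bound[OF f, of "P n j i"] fejer_plateau_in_fourier_algebra(1) by (simp add: P_def)
    also have "\<dots> \<le> vnorm (dual ?A) f * 2"
      unfolding P_def by (rule mult_left_mono[OF fejer_plateau_in_fourier_algebra(2) dual_norm_nonneg[OF f]])
    finally show ?thesis by simp
  qed
  show ?thesis
  proof (rule extremely_non_Arens_regularI[where \<Lambda> = \<Lambda> and u = u and C = 4])
    fix j f g assume f: "f \<in> carrier (dual ?A)" and g: "g \<in> carrier (dual ?A)"
    show "\<Lambda> j (\<lambda>x. f x + g x) = \<Lambda> j f + \<Lambda> j g"
      unfolding \<Lambda>_def
      by (simp add: ulim_add[OF b[OF f] b[OF g]]
          ulim_add[OF cmod_ulim_le[OF b[OF f]] cmod_ulim_le[OF b[OF g]]])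
  next
    fix j f c assume f: "f \<in> carrier (dual ?A)"
    show "\<Lambda> j (\<lambda>x. c * f x) = c * \<Lambda> j f"
      unfolding \<Lambda>_def
      by (simp add: ulim_cmult[OF b[OF f]] ulim_cmult[OF cmod_ulim_le[OF b[OF f]]] right_diff_distrib)
  next
    fix j f assume f: "f \<in> carrier (dual ?A)"
    have "cmod (\<Lambda> j f) \<le> 2 * vnorm (dual ?A) f + 2 * vnorm (dual ?A) f"
      unfolding \<Lambda>_def by (intro norm_triangle_le_diff add_mono cmod_ulim_le b[OF f])
    then show "cmod (\<Lambda> j f) \<le> 4 * vnorm (dual ?A) f" by simp
  next
    fix j w assume w: "w \<in> WAP ?A"
    have "ulim (\<lambda>n. ulim (\<lambda>i. w (amult ?A (fejer x n) (plateau x (prod_encode (j, i)))))) =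
        ulim (\<lambda>i. ulim (\<lambda>n. w (amult ?A (fejer x n) (plateau x (prod_encode (j, i))))))"
      by (rule WAP_iterated_limits[OF w, where C = 2])
         (simp_all add: fejer_in_fourier_algebra plateau_in_fourier_algebra)
    then show "\<Lambda> j w = 0"
      by (simp add: \<Lambda>_def P_def)
  next
    fix f assume f: "f \<in> carrier (dual ?A)"
    \<comment> \<open>The value at u j is repeated on all scales reserved for j; as u lies in the
      unit ball, the norm of f bounds these coefficients.\<close>
    define d where "d = (\<lambda>m. f (u (fst (prod_decode m))))"
    define h where "h = (\<lambda>v. if v \<in> carrier ?A then \<Sum>m. d m * osc x m v else 0)"
    have h: "h \<in> carrier (dual ?A)"
      unfolding h_def
    proof (rule fourier_series_functional)
      show "cmod (\<Sum>m<K. c m * osc x m v) \<le> 24 * fourier_norm G v"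
        if "v \<in> carrier ?A" "\<And>m. cmod (c m) \<le> 1" for K c v
        using that by (rule osc_bound) (rule infinite_order_carrier[OF x])
      show "cmod (d m) \<le> vnorm (dual ?A) f" for m
        using order_trans[OF dual_bound[OF f u(1), simplified] mult_left_mono[OF u(2) dual_norm_nonneg[OF f]]]
        by (simp add: d_def)
    qed (simp_all add: osc_def distrib_left sum.distrib sum_distrib_left mult.left_commute)
    have hP: "h (P n j i) = f (u j) * osc x (prod_encode (j, i)) (P n j i)" for n j i
    proof -
      have "(\<Sum>m. d m * osc x m (P n j i)) = (\<Sum>m\<in>{prod_encode (j, i)}. d m * osc x m (P n j i))"
        by (rule suminf_finite) (auto simp: P_def osc_plateau)
      then show ?thesis
        using fejer_plateau_in_fourier_algebra(1) by (simp add: h_def d_def P_def)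
    qed
    have 1: "ulim (\<lambda>n. h (P n j i)) = f (u j)" for j i
    proof (rule ulim_eq_sequentially)
      show "(\<lambda>n. h (P n j i)) \<longlonglongrightarrow> f (u j)"
        using tendsto_mult_left[OF osc_fejer_plateau_tendsto, of "f (u j)" "prod_encode (j, i)"]
        unfolding hP by (simp add: P_def)
    qed
    have 2: "ulim (\<lambda>i. h (P n j i)) = 0" for n j
    proof (rule ulim_eq_sequentially)
      have "eventually (\<lambda>i. h (P n j i) = 0) sequentially"
        using eventually_gt_at_top[of n]
      proof eventually_elim
        case (elim i)
        have "n < prod_encode (j, i)"
          using elim le_prod_encode_2[of i j] by linarith
        also have "\<dots> < 5 ^ prod_encode (j, i)"
          by (rule power_gt_expt) simp
        finally have zero: "P n j i = (\<lambda>_. 0)"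
          using fejer_plateau_eq_0 by (auto simp: P_def)
        show ?case unfolding hP unfolding zero by (simp add: osc_def)
      qed
      then show "(\<lambda>i. h (P n j i)) \<longlonglongrightarrow> 0"
        by (rule tendsto_eventually)
    qed
    have "\<Lambda> j h = f (u j)" for j
      unfolding \<Lambda>_def 1 2 by (simp add: ulim_eq_sequentially[OF tendsto_const])
    with h show "\<exists>h\<in>carrier (dual ?A). \<forall>j. \<Lambda> j h = f (u j)"
      by blast
  qed (use u in auto)
qed

end

end

section \<open>Free groups\<close>

lemma foldr_cons_reduce_replicate:
  "w = [] \<or> hd w \<noteq> inv_letter l \<Longrightarrow> foldr cons_reduce (replicate n l) w = replicate n l @ w"
proof (induction n)
  case (Suc n)
  have "cons_reduce l (replicate n l @ w) = l # replicate n l @ w"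
    using Suc.prems by (cases n; cases w) auto
  with Suc show ?case by simp
qed simp

lemma reduced_replicate: "reduced_word (replicate n l)"
proof (induction n)
  case (Suc n)
  then show ?case by (cases n) (auto simp: reduced_word_def)
qed (simp add: reduced_word_def)

lemma free_group_simps [simp]:
  "mult (free_group r) = foldr cons_reduce" "one (free_group r) = []"
  by (simp_all add: free_group_def)

lemma generator_int_pow:
  assumes "i < r"
  shows "[(i, True)] [^]\<^bsub>free_group r\<^esub> (k::int) = replicate (nat \<bar>k\<bar>) (i, k \<ge> 0)"
proof -
  interpret F: group "free_group r" by (rule group_free_group)
  have carr: "replicate n (i, s) \<in> carrier (free_group r)" for n s
    using assms by (auto simp: free_group_def reduced_replicate)
  have pow: "[(i, True)] [^]\<^bsub>free_group r\<^esub> n = replicate n (i, True)" for n :: nat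
  proof (induction n)
    case (Suc n)
    have "foldr cons_reduce (replicate n (i, True)) [(i, True)] = replicate n (i, True) @ [(i, True)]"
      by (rule foldr_cons_reduce_replicate) (simp add: inv_letter_def)
    with Suc show ?case by (simp add: replicate_append_same)
  qed simp
  \<comment> \<open>The inverse is the reversed word of inverse letters, and reversing a constant
    word does nothing.\<close>
  have "inv\<^bsub>free_group r\<^esub> (replicate n (i, True)) = replicate n (i, False)" for n
  proof (rule F.inv_equality[OF _ carr carr])
    show "replicate n (i, False) \<otimes>\<^bsub>free_group r\<^esub> replicate n (i, True) = \<one>\<^bsub>free_group r\<^esub>"
      using foldr_inverse[of "[]" "replicate n (i, True)"] foldr_Nil[OF reduced_replicate, of n "(i, True)"]
      by (simp add: reduced_word_def inv_letter_def)
  qed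
  then show ?thesis
    by (simp add: int_pow_def2 pow)
qed

text \<open>A nonzero power of a generator times a reduced word that starts with neither it nor its
  inverse has no cancellation. So powers of the generator 1 move words into the set, and powers of
  the generator 0 move the set off itself.\<close>

lemma ping_pong_free_group:
  assumes "r \<ge> 2"
  shows "ping_pong (free_group r) [(0, True)] [(1, True)] {w \<in> carrier (free_group r). w \<noteq> [] \<and> fst (hd w) = 1}"
proof -
  interpret F: group "free_group r" by (rule group_free_group)
  have r: "0 < r" "1 < r" using assms by auto
  let ?B = "{w \<in> carrier (free_group r). w \<noteq> [] \<and> fst (hd w) = 1}"
  have gen: "[(i, True)] \<in> carrier (free_group r)" if "i < r" for i
    using that by (auto simp: free_group_def reduced_word_def)
  have mult: "[(i, True)] [^]\<^bsub>free_group r\<^esub> k \<otimes>\<^bsub>free_group r\<^esub> w = replicate (nat \<bar>k\<bar>) (i, k \<ge> 0) @ w"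
    if "i < r" "w = [] \<or> fst (hd w) \<noteq> i" for i w and k :: int
    unfolding generator_int_pow[OF that(1)] free_group_simps
    by (rule foldr_cons_reduce_replicate) (use that(2) in \<open>auto simp: inv_letter_def\<close>)
  show ?thesis
  proof unfold_locales
    fix y and k :: int assume y: "y \<in> carrier (free_group r)" "y \<notin> ?B" and k: "k \<noteq> 0"
    have "[(1, True)] [^]\<^bsub>free_group r\<^esub> k \<otimes>\<^bsub>free_group r\<^esub> y \<in> carrier (free_group r)"
      by (intro F.m_closed F.int_pow_closed gen r y)
    then show "[(1, True)] [^]\<^bsub>free_group r\<^esub> k \<otimes>\<^bsub>free_group r\<^esub> y \<in> ?B"
      using y k mult[OF r(2), of y k] by (auto simp del: free_group_simps)
  next
    fix y and k :: int assume y: "y \<in> ?B" and k: "k \<noteq> 0"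
    show "[(0, True)] [^]\<^bsub>free_group r\<^esub> k \<otimes>\<^bsub>free_group r\<^esub> y \<notin> ?B"
      using y k mult[OF r(1), of y k] by (auto simp del: free_group_simps)
  next
    fix k :: int
    show "[(0, True)] [^]\<^bsub>free_group r\<^esub> k \<notin> ?B"
      unfolding generator_int_pow[OF r(1)] by auto
  qed (use gen r in auto)
qed

theorem corollary5p9:
  fixes r :: nat
  assumes "r \<ge> 2"
  shows "extremely_non_Arens_regular (fourier_algebra (free_group r)) \<and>
         \<not> strongly_Arens_irregular (fourier_algebra (free_group r))"
proof -
  interpret ping_pong "free_group r" "[(0, True)]" "[(1, True)]"
    "{w \<in> carrier (free_group r). w \<noteq> [] \<and> fst (hd w) = 1}"
    by (rule ping_pong_free_group[OF assms])
  \<comment> \<open>The carrier is countable because words are lists over a countable alphabet; the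
    generator 1 is the required element of infinite order.\<close>
  show ?thesis
    using extremely_non_Arens_regular_fourier[OF infinite_order_b] not_strongly_Arens_irregular by simp
qed

end
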